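(* Let $E$ be a linear subspace of $\operatorname{Sym}(n)$ such that $[X,[X,Y]]\in E$ for all $X,Y\in E$, and let $F:=E^\perp=\{X\in\operatorname{Sym}(n) : \operatorname{Tr}(XY)=0\ \ \forall\, Y\in E\}$. Then for every symmetric positive-definite matrix $x\in\operatorname{SPD}(n)$ there exist a unique element $e\in\exp(E)$ and a unique element $f\in\exp(F)$ such that $x=e\,f\,e$. More precisely, $$e=\pi(x)^{1/2}\in\exp(E),\qquad f=\pi(x)^{-1/2}\,x\,\pi(x)^{-1/2}\in\exp(F),$$ where $\pi:\operatorname{SPD}(n)\to\exp(E)$ denotes the projection onto the totally geodesic submanifold $\exp(E)$. Moreover, the map from $\operatorname{SPD}(n)$ to $\exp(E)\times\exp(F)$ taking $x$ to $(e,f)$ is a homeomorphism.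
   Context: $\operatorname{Sym}(n)$ is the vector space of symmetric $n\times n$ real matrices and $\operatorname{SPD}(n)$ the manifold of symmetric positive-definite real $n\times n$ matrices, endowed with the affine-invariant Riemannian metric $\langle X,Y\rangle_x=\operatorname{Tr}(x^{-1}Xx^{-1}Y)$ and its geodesic distance $\operatorname{dist}$. $[A,B]=AB-BA$, and $\exp(E)$, $\exp(F)$ are the images of $E$, $F$ under the matrix exponential. Under the hypothesis on $E$, for each $x\in\operatorname{SPD}(n)$ the projection $\pi(x)$ is the unique point of $\exp(E)$ with $\operatorname{dist}(x,\pi(x))=\inf_{y\in\exp(E)}\operatorname{dist}(x,y)$. For $y\in\operatorname{SPD}(n)$, $y^{1/2}$ is its symmetric positive-definite square root and $y^{-1/2}=(y^{1/2})^{-1}$. *)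

theory Defs
  imports "HOL-Analysis.Analysis"
begin

definition Sym :: "(real^'n^'n) set" where
  "Sym = {A. transpose A = A}"

definition SPD :: "(real^'n^'n) set" where
  "SPD = {A \<in> Sym. \<forall>v. v \<noteq> 0 \<longrightarrow> v \<bullet> (A *v v) > 0}"

definition commutator :: "real^'n^'n \<Rightarrow> real^'n^'n \<Rightarrow> real^'n^'n" where
  "commutator A B = A ** B - B ** A"

definition perp_in_Sym :: "(real^'n^'n) set \<Rightarrow> (real^'n^'n) set" where
  "perp_in_Sym E = {X \<in> Sym. \<forall>Y\<in>E. trace (X ** Y) = 0}"

(* The class operations times, 1 and power on real^'n^'n are componentwise, so the
   powers in the exponential series are built from the matrix product. *)
primrec matpow :: "real^'n^'n \<Rightarrow> nat \<Rightarrow> real^'n^'n" where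
  "matpow A 0 = mat 1"
| "matpow A (Suc k) = A ** matpow A k"

definition mexp :: "real^'n^'n \<Rightarrow> real^'n^'n" where
  "mexp A = (\<Sum>k. (1 / fact k) *\<^sub>R matpow A k)"

definition spd_sqrt :: "real^'n^'n \<Rightarrow> real^'n^'n" where
  "spd_sqrt y = (THE s. s \<in> SPD \<and> s ** s = y)"

definition ai_metric :: "real^'n^'n \<Rightarrow> real^'n^'n \<Rightarrow> real^'n^'n \<Rightarrow> real" where
  "ai_metric x X Y = trace (matrix_inv x ** X ** matrix_inv x ** Y)"

definition ai_speed :: "(real \<Rightarrow> real^'n^'n) \<Rightarrow> real \<Rightarrow> real" where
  "ai_speed \<gamma> t =
    (let v = vector_derivative \<gamma> (at t within {0..1}) in sqrt (ai_metric (\<gamma> t) v v))"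

definition ai_length :: "(real \<Rightarrow> real^'n^'n) \<Rightarrow> real" where
  "ai_length \<gamma> = integral {0..1} (ai_speed \<gamma>)"

(* A valid_path is continuous and, off a finite set of parameters, continuously
   differentiable.  It may have unbounded speed near the exceptional parameters, hence
   infinite length, for which the integral above takes the default value 0.  The
   integrability condition excludes exactly these curves. *)
definition spd_curves :: "real^'n^'n \<Rightarrow> real^'n^'n \<Rightarrow> (real \<Rightarrow> real^'n^'n) set" where
  "spd_curves x y = {\<gamma>. valid_path \<gamma> \<and> path_image \<gamma> \<subseteq> SPD \<and> pathstart \<gamma> = x \<and> pathfinish \<gamma> = y
      \<and> ai_speed \<gamma> integrable_on {0..1}}"

definition ai_dist :: "real^'n^'n \<Rightarrow> real^'n^'n \<Rightarrow> real" where
  "ai_dist x y = (INF \<gamma>\<in>spd_curves x y. ai_length \<gamma>)"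

definition is_nearest :: "(real^'n^'n) set \<Rightarrow> real^'n^'n \<Rightarrow> real^'n^'n \<Rightarrow> bool" where
  "is_nearest S x p \<longleftrightarrow> p \<in> S \<and> ai_dist x p = (INF y\<in>S. ai_dist x y)"

definition ai_proj :: "(real^'n^'n) set \<Rightarrow> real^'n^'n \<Rightarrow> real^'n^'n" where
  "ai_proj S x = (THE p. is_nearest S x p)"

end

theory Submission
  imports Defs
begin

text \<open>
  No calculus of the matrix logarithm is needed. Writing two symmetric matrices \<open>A\<close>, \<open>B\<close> in their
  own eigenbases turns functions of them into entrywise multipliers, and
  \<open>s\<^sup>2 \<le> exp s + exp (- s) - 2\<close> gives \<open>|A - B|\<^sup>2 \<le> Theta (exp A) (exp B)\<close> for the
  smooth, congruence-invariant function \<open>Theta x y = tr (x\<^sup>-\<^sup>1 y) + tr (y\<^sup>-\<^sup>1 x) - 2 n\<close>. Subdividing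
  a geodesic yields \<open>|A - B| \<le> dist (exp A) (exp B)\<close>, that is, non-positive curvature. The same
  two-basis computation differentiates \<open>|log x|\<^sup>2\<close> and shows that curves are no shorter than
  geodesics.

  The set \<open>exp E\<close> is invariant under \<open>q \<mapsto> e q e\<close> for \<open>e \<in> exp E\<close>, so the nearest point of
  \<open>exp E\<close> to \<open>x\<close> may be moved to the identity. There the first-order condition says that
  \<open>log x\<close> is orthogonal to \<open>E\<close>, and conversely for \<open>log f \<in> F\<close> and \<open>q \<in> exp E\<close> the curvature
  bound becomes \<open>dist f q\<^sup>2 \<ge> |log f|\<^sup>2 + |log q|\<^sup>2\<close>. This gives uniqueness and the
  continuity of the projection.
\<close>

section \<open>Spectral calculus for symmetric matrices\<close>

text \<open>The distance is an infimum over curves, so little can be computed from its definition.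
  All geometry is done with the closed formula \<open>spd_dist\<close>, and the infimum over curves
  enters only when its value is identified. The hard step is the invariance of \<open>exp E\<close>
  under congruence by its own elements. \<open>E\<close> is closed under double brackets but in
  general not under \<open>[X, Y]\<close>, so only even functions of \<open>ad Z\<close> are sure to
  preserve it. In logarithmic coordinates the flow from \<open>q\<close> to \<open>e q e\<close> is
  governed by such a function. Solving that differential equation inside \<open>E\<close> is
  replaced by Euler steps: they stay in \<open>E\<close> by construction, and the exact step, being
  a congruence, carries old errors along unchanged in \<open>spd_dist\<close>. \<open>Theta\<close>
  serves in both directions: it dominates squared differences of logarithms, and it is itself at
  most quadratic in \<open>y - x\<close> near \<open>x\<close>, so that ordinary norm estimates
  become distance estimates.\<close>

lemma norm_matrix_sq: "(norm (A::real^'n^'m))\<^sup>2 = (\<Sum>i\<in>UNIV. \<Sum>j\<in>UNIV. (A $ i $ j)\<^sup>2)"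
  by (simp add: power2_norm_eq_inner inner_vec_def) (simp add: power2_eq_square)

lemma inner_eq_trace: "(A::real^'n^'n) \<bullet> B = trace (transpose A ** B)"
  unfolding trace_def matrix_matrix_mult_def transpose_def
  by (simp add: inner_vec_def) (rule sum.swap)

lemma norm_matrix_mult_le: "norm ((A::real^'n^'m) ** (B::real^'k^'n)) \<le> norm A * norm B"
proof -
  have B: "(norm B)\<^sup>2 = (\<Sum>j\<in>UNIV. (norm (column j B))\<^sup>2)"
    unfolding norm_matrix_sq power2_norm_eq_inner
    by (subst sum.swap) (simp add: inner_vec_def column_def power2_eq_square)
  have A: "(norm A)\<^sup>2 = (\<Sum>i\<in>UNIV. (norm (A $ i))\<^sup>2)"
    unfolding power2_norm_eq_inner by (simp add: inner_vec_def)
  have "(norm (A ** B))\<^sup>2 = (\<Sum>i\<in>UNIV. \<Sum>j\<in>UNIV. (A $ i \<bullet> column j B)\<^sup>2)"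
    unfolding norm_matrix_sq by (simp add: matrix_matrix_mult_def inner_vec_def column_def)
  also have "\<dots> \<le> (\<Sum>i\<in>UNIV. \<Sum>j\<in>UNIV. (norm (A $ i))\<^sup>2 * (norm (column j B))\<^sup>2)"
  proof (intro sum_mono)
    fix i j
    have "\<bar>A $ i \<bullet> column j B\<bar> \<le> \<bar>norm (A $ i) * norm (column j B)\<bar>"
      using Cauchy_Schwarz_ineq2 by fastforce
    then show "(A $ i \<bullet> column j B)\<^sup>2 \<le> (norm (A $ i))\<^sup>2 * (norm (column j B))\<^sup>2"
      by (metis abs_le_square_iff power_mult_distrib)
  qed
  also have "\<dots> = (norm A * norm B)\<^sup>2"
    unfolding power_mult_distrib A B by (simp add: sum_product)
  finally show ?thesis
    by (simp add: power2_le_iff_abs_le)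
qed

lemma bounded_bilinear_matrix_mult:
  "bounded_bilinear ((**) :: real^'n^'m \<Rightarrow> real^'k^'n \<Rightarrow> real^'k^'m)"
proof
  fix a a' :: "real^'n^'m" and b b' :: "real^'k^'n" and r :: real
  show "(a + a') ** b = a ** b + a' ** b"
    by (simp add: matrix_matrix_mult_def vec_eq_iff sum.distrib ring_distribs)
  show "a ** (b + b') = a ** b + a ** b'"
    by (rule matrix_add_ldistrib)
  show "(r *\<^sub>R a) ** b = r *\<^sub>R (a ** b)"
    by (simp add: matrix_matrix_mult_def vec_eq_iff sum_distrib_left mult.assoc)
  show "a ** (r *\<^sub>R b) = r *\<^sub>R (a ** b)"
    by (simp add: matrix_matrix_mult_def vec_eq_iff sum_distrib_left mult.left_commute)
  show "\<exists>K. \<forall>(a::real^'n^'m) (b::real^'k^'n). norm (a ** b) \<le> norm a * norm b * K"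
    by (rule exI[of _ 1]) (simp add: norm_matrix_mult_le)
qed

text \<open>Supplies distributivity, scaling, continuity and the product rule for the matrix product
  under the prefix \<open>mm\<close>.\<close>

interpretation mm: bounded_bilinear "(**) :: real^'n^'m \<Rightarrow> real^'k^'n \<Rightarrow> real^'k^'m"
  by (rule bounded_bilinear_matrix_mult)

lemma bounded_linear_transpose: "bounded_linear (transpose :: real^'n^'m \<Rightarrow> real^'m^'n)"
  by (rule linear_conv_bounded_linear[THEN iffD1], rule linearI)
     (simp_all add: transpose_def vec_eq_iff)


lemma bounded_linear_trace: "bounded_linear (trace :: real^'n^'n \<Rightarrow> real)"
  by (rule linear_conv_bounded_linear[THEN iffD1], rule linearI)
     (simp_all add: trace_def sum.distrib sum_distrib_left)


lemma abs_trace_mult_le: "\<bar>trace ((A::real^'n^'n) ** B)\<bar> \<le> norm A * norm B"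
proof -
  have "norm (transpose A) = norm A"
    by (rule power2_eq_imp_eq) (simp_all add: norm_matrix_sq transpose_def, rule sum.swap)
  then show ?thesis
    using inner_eq_trace[of "transpose A" B] Cauchy_Schwarz_ineq2[of "transpose A" B] by simp
qed

lemma orthogonal_matrix_mults:
  assumes "orthogonal_matrix (U::real^'n^'n)"
  shows "transpose U ** U = mat 1" "U ** transpose U = mat 1"
    "transpose U ** (U ** A) = A" "U ** (transpose U ** A) = A"
  using assms by (simp_all add: orthogonal_matrix_def matrix_mul_assoc)

lemma norm_orthogonal_left:
  assumes "orthogonal_matrix (U::real^'n^'n)"
  shows "norm (U ** (A::real^'n^'n)) = norm A"
  using assms
  by (simp add: norm_eq_sqrt_inner inner_eq_trace matrix_transpose_mul
      matrix_mul_assoc[symmetric] orthogonal_matrix_mults)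

lemma norm_orthogonal_right:
  assumes "orthogonal_matrix (U::real^'n^'n)"
  shows "norm ((A::real^'n^'n) ** U) = norm A"
proof -
  have "trace (transpose U ** (transpose A ** (A ** U))) = trace (transpose A ** A)"
    using assms trace_mul_sym[of "transpose U" "transpose A ** (A ** U)"]
    by (simp add: matrix_mul_assoc[symmetric] orthogonal_matrix_mults)
  then show ?thesis
    by (simp add: norm_eq_sqrt_inner inner_eq_trace matrix_transpose_mul
      matrix_mul_assoc[symmetric])
qed

lemma orthogonal_matrix_transpose: "orthogonal_matrix U \<Longrightarrow> orthogonal_matrix (transpose U)"
  by (simp add: orthogonal_matrix_def)

section \<open>Diagonal matrices, orthonormal eigenbases and functional calculus\<close>

definition diag :: "('n \<Rightarrow> real) \<Rightarrow> real^'n^'n" where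
  "diag d = (\<chi> i j. if i = j then d i else 0)"

lemma diag_mult_left: "(diag d ** A) $ i $ j = d i * A $ i $ j"
  by (simp add: diag_def matrix_matrix_mult_def if_distrib cong: if_cong)
     (simp add: if_distribR sum.delta' cong: if_cong)

lemma diag_mult_right: "(A ** diag d) $ i $ j = A $ i $ j * d j"
  by (simp add: diag_def matrix_matrix_mult_def if_distrib cong: if_cong)

lemma diag_mult_diag: "diag d ** diag e = diag (\<lambda>i. d i * e i)"
  by (simp add: vec_eq_iff diag_mult_left) (simp add: diag_def)

lemma diag_one: "diag (\<lambda>i. 1) = mat 1"
  by (simp add: diag_def mat_def)

lemma transpose_diag: "transpose (diag d) = diag d"
  by (auto simp: diag_def transpose_def vec_eq_iff)

lemma symmetric_inner_swap:
  "transpose (A::real^'n^'n) = A \<Longrightarrow> v \<bullet> (A *v w) = (A *v v) \<bullet> w"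
  by (metis dot_lmul_matrix vector_transpose_matrix)

text \<open>A maximiser \<open>u\<close> of the quadratic form on the unit sphere of
  \<open>S\<close> is an eigenvector: otherwise the residual \<open>w\<close>, which lies in
  \<open>S\<close> by invariance, is a direction along which the form outgrows
  \<open>l * (v \<bullet> v)\<close>.\<close>

lemma symmetric_max_eigenvector:
  fixes A :: "real^'n^'n"
  assumes A: "transpose A = A" and S: "subspace S" "\<And>v. v \<in> S \<Longrightarrow> A *v v \<in> S" "S \<noteq> {0}"
  obtains u l where "u \<in> S" "norm u = 1" "A *v u = l *\<^sub>R u"
proof -
  obtain s where s: "s \<in> S" "s \<noteq> 0"
    using S subspace_0 by blast
  have "s /\<^sub>R norm s \<in> S \<inter> sphere 0 1"
    using s S(1) by (simp add: subspace_scale)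
  then have "S \<inter> sphere 0 1 \<noteq> {}"
    by blast
  moreover have "compact (S \<inter> sphere 0 1)"
    by (simp add: closed_Int_compact closed_subspace S(1))
  moreover have "continuous_on (S \<inter> sphere 0 1) (\<lambda>v. v \<bullet> (A *v v))"
    by (intro continuous_intros matrix_vector_mult_linear_continuous_on)
  ultimately obtain u where "u \<in> S \<inter> sphere 0 1"
      "\<forall>v\<in>S \<inter> sphere 0 1. v \<bullet> (A *v v) \<le> u \<bullet> (A *v u)"
    using continuous_attains_sup[of "S \<inter> sphere 0 1" "\<lambda>v. v \<bullet> (A *v v)"] by blast
  then have u: "u \<in> S" "norm u = 1"
    and max: "\<And>v. v \<in> S \<Longrightarrow> norm v = 1 \<Longrightarrow> v \<bullet> (A *v v) \<le> u \<bullet> (A *v u)"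
    by auto
  define l where "l = u \<bullet> (A *v u)"
  have quad: "v \<bullet> (A *v v) \<le> l * (v \<bullet> v)" if "v \<in> S" for v
  proof (cases "v = 0")
    case False
    have "(v /\<^sub>R norm v) \<bullet> (A *v (v /\<^sub>R norm v)) \<le> l"
      unfolding l_def using that S(1) False by (intro max) (simp_all add: subspace_scale)
    then have "(v \<bullet> (A *v v)) / (norm v)\<^sup>2 \<le> l"
      by (simp add: matrix_vector_mult_scaleR power2_eq_square divide_inverse mult_ac)
    then show ?thesis
      using False by (simp add: field_simps power2_norm_eq_inner)
  qed simp
  define w where "w = A *v u - l *\<^sub>R u"
  have wS: "w \<in> S"
    unfolding w_def using S u(1) by (simp add: subspace_diff subspace_scale)
  define c where "c = l * (w \<bullet> w) - w \<bullet> (A *v w)"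
  have uu: "u \<bullet> u = 1"
    using u(2) by (simp add: dot_square_norm)
  have "w \<bullet> w = 0"
  proof (rule ccontr)
    assume "w \<bullet> w \<noteq> 0"
    then have pos: "w \<bullet> w > 0"
      by simp
    \<comment> \<open>Small enough that the second-order term \<open>t * c\<close> cannot reach the
      first-order gain \<open>2 * (w \<bullet> w)\<close>; the \<open>+ 1\<close> keeps the
      denominator positive.\<close>
    define t where "t = (w \<bullet> w) / (\<bar>c\<bar> + 1)"
    have t: "t > 0"
      using pos by (simp add: t_def)
    have "(u + t *\<^sub>R w) \<bullet> (A *v (u + t *\<^sub>R w)) \<le> l * ((u + t *\<^sub>R w) \<bullet> (u + t *\<^sub>R w))"
      using wS u(1) S(1) by (intro quad) (simp add: subspace_add subspace_scale)
    moreover have "u \<bullet> (A *v w) = w \<bullet> (A *v u)"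
      using symmetric_inner_swap[OF A, of u w] by (simp add: inner_commute)
    moreover have "w \<bullet> (A *v u) = w \<bullet> w + l * (u \<bullet> w)"
      using inner_diff_right[of w "A *v u" "l *\<^sub>R u"]
      unfolding w_def[symmetric] by (simp add: inner_commute)
    ultimately have "2 * t * (w \<bullet> w) \<le> t * (t * c)"
      by (simp add: l_def[symmetric] uu c_def matrix_vector_right_distrib matrix_vector_mult_scaleR
          inner_add_left inner_add_right inner_commute algebra_simps)
    then have "2 * (w \<bullet> w) \<le> t * c"
      using t by (metis mult.assoc mult.commute mult_le_cancel_left_pos)
    also have "\<dots> \<le> t * (\<bar>c\<bar> + 1)"
      using t by (intro mult_left_mono) auto
    also have "\<dots> = w \<bullet> w"
      by (simp add: t_def add_nonneg_eq_0_iff)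
    finally show False
      using pos by simp
  qed
  then have "A *v u = l *\<^sub>R u"
    by (simp add: w_def)
  with u that show thesis
    by blast
qed

text \<open>Induction on the dimension of an invariant subspace: split off a unit eigenvector
  \<open>u\<close>; by symmetry of \<open>A\<close> the orthogonal complement of \<open>u\<close> in
  \<open>S\<close> is again invariant and has smaller dimension.\<close>

lemma symmetric_orthonormal_eigenbasis:
  fixes A :: "real^'n^'n"
  assumes A: "transpose A = A" and "subspace S" "\<And>v. v \<in> S \<Longrightarrow> A *v v \<in> S"
  shows "\<exists>B. pairwise orthogonal B \<and> (\<forall>b\<in>B. norm b = 1 \<and> (\<exists>l. A *v b = l *\<^sub>R b)) \<and> span B = S"
  using assms(2,3)
proof (induction "dim S" arbitrary: S rule: less_induct)
  case less
  show ?case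
  proof (cases "S = {0}")
    case True
    then show ?thesis
      by (intro exI[of _ "{}"]) simp
  next
    case False
    then obtain u l where u: "u \<in> S" "norm u = 1" "A *v u = l *\<^sub>R u"
      using symmetric_max_eigenvector[OF A less.prems] by blast
    have uu: "u \<bullet> u = 1"
      using u(2) by (simp add: dot_square_norm)
    define T where "T = S \<inter> {v. u \<bullet> v = 0}"
    have T: "subspace T"
      unfolding T_def by (intro subspace_inter less.prems(1) subspace_hyperplane)
    have "A *v v \<in> T" if "v \<in> T" for v
    proof -
      have "u \<bullet> (A *v v) = l * (u \<bullet> v)"
        using symmetric_inner_swap[OF A, of u v] u(3) by simp
      then show ?thesis
        using that less.prems(2) by (simp add: T_def)
    qed
    moreover have "dim T < dim S"
    proof (rule dim_psubset)
      have "u \<notin> T"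
        using uu by (simp add: T_def)
      then show "span T \<subset> span S"
        using T less.prems(1) u(1) by (metis T_def inf_le1 psubsetI span_eq_iff)
    qed
    ultimately obtain B where B: "pairwise orthogonal B"
      "\<forall>b\<in>B. norm b = 1 \<and> (\<exists>l. A *v b = l *\<^sub>R b)" "span B = T"
      using less.hyps T by blast
    have "B \<subseteq> T"
      using B(3) span_superset by blast
    then have "pairwise orthogonal (insert u B)"
      using B(1) unfolding pairwise_insert
      by (auto simp: T_def orthogonal_def inner_commute[of _ u])
    moreover have "span (insert u B) = S"
    proof
      show "span (insert u B) \<subseteq> S"
        using \<open>B \<subseteq> T\<close> u(1) less.prems(1) by (intro span_minimal) (auto simp: T_def)
      show "S \<subseteq> span (insert u B)"
      proof
        fix v assume v: "v \<in> S"
        have "v - (u \<bullet> v) *\<^sub>R u \<in> span B"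
          unfolding B(3) T_def using v u(1) less.prems(1) uu
          by (simp add: subspace_diff subspace_scale inner_diff_right)
        then show "v \<in> span (insert u B)"
          by (metis span_breakdown_eq)
      qed
    qed
    ultimately show ?thesis
      using B(2) u by (intro exI[of _ "insert u B"]) auto
  qed
qed

theorem spectral_theorem:
  fixes A :: "real^'n^'n"
  assumes A: "A \<in> Sym"
  obtains U a where "orthogonal_matrix U" "A = U ** diag a ** transpose U"
proof -
  have AT: "transpose A = A"
    using A by (simp add: Sym_def)
  obtain B where B: "pairwise orthogonal B" 
    "\<forall>b\<in>B. norm b = 1 \<and> (\<exists>l. A *v b = l *\<^sub>R b)" "span B = UNIV"
    using symmetric_orthonormal_eigenbasis[OF AT, of UNIV] by auto
  have "independent B"
    using B(1,2) norm_zero zero_neq_one by (metis pairwise_orthogonal_independent)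
  then have "card B = CARD('n)" "finite B"
    using B(3) dim_eq_card_independent[of B] dim_span[of B] independent_imp_finite
    by (auto simp: dim_UNIV)
  then obtain f where f: "bij_betw f (UNIV::'n set) B"
    using finite_same_card_bij[of "UNIV::'n set" B] by auto
  have fB: "f i \<in> B" for i
    using f by (auto simp: bij_betw_def)
  have "\<forall>i. \<exists>l. A *v f i = l *\<^sub>R f i"
    using B(2) fB by blast
  then obtain a where a: "\<And>i. A *v f i = a i *\<^sub>R f i"
    by (auto dest!: choice)
  define U where "U = (\<chi> i j. f j $ i)"
  have ff: "f i \<bullet> f j = (if i = j then 1 else 0)" for i j
  proof (cases "i = j")
    case False
    then have "f i \<noteq> f j"
      using f by (auto simp: bij_betw_def inj_on_def)
    then show ?thesis
      using B(1) fB False by (auto simp: pairwise_def orthogonal_def)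
  next
    case True
    then show ?thesis
      using B(2) fB[of j] by (simp add: dot_square_norm)
  qed
  have "transpose U ** U = mat 1"
    using ff unfolding U_def transpose_def matrix_matrix_mult_def mat_def vec_eq_iff inner_vec_def
    by simp
  then have U: "orthogonal_matrix U"
    by (simp add: orthogonal_matrix)
  have "A ** U = U ** diag a"
  proof -
    have "(A ** U) $ i $ j = (A *v f j) $ i" for i j
      by (simp add: U_def matrix_matrix_mult_def matrix_vector_mult_def)
    moreover have "(U ** diag a) $ i $ j = (a j *\<^sub>R f j) $ i" for i j
      by (simp add: diag_mult_right U_def)
    ultimately show ?thesis
      by (simp add: vec_eq_iff a)
  qed
  then have "A = U ** diag a ** transpose U"
    using U by (metis matrix_mul_assoc matrix_mul_rid orthogonal_matrix_mults(2))
  with U that show thesis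
    by blast
qed

text \<open>Carrying \<open>U\<close> and \<open>a\<close> separately makes functional calculus a
  change of \<open>a\<close> with \<open>U\<close> fixed, and products of functions of one matrix
  become pointwise products.\<close>

definition spectral :: "real^'n^'n \<Rightarrow> ('n \<Rightarrow> real) \<Rightarrow> real^'n^'n" where
  "spectral U a = U ** diag a ** transpose U"

lemma spectral_cases:
  assumes "A \<in> Sym"
  obtains U a where "orthogonal_matrix U" "A = spectral U a"
  using spectral_theorem[OF assms] that unfolding spectral_def by blast

lemma spectral_in_Sym: "spectral U a \<in> Sym"
  by (simp add: Sym_def spectral_def matrix_transpose_mul transpose_diag matrix_mul_assoc)

lemma spectral_mult:
  "orthogonal_matrix U \<Longrightarrow> spectral U a ** spectral U b = spectral U (\<lambda>i. a i * b i)"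
  unfolding spectral_def diag_mult_diag[symmetric]
  by (simp add: matrix_mul_assoc[symmetric] orthogonal_matrix_mults)

lemma spectral_one: "orthogonal_matrix U \<Longrightarrow> spectral U (\<lambda>i. 1) = mat 1"
  by (simp add: spectral_def diag_one orthogonal_matrix_mults)

text \<open>Transports the convergence of the scalar exponential series to \<open>mexp\<close>. The
  eigenvalues are packed into a vector because bounded linearity asks for a normed space as
  source.\<close>

lemma bounded_linear_spectral: "bounded_linear (\<lambda>v::real^'n. spectral U (\<lambda>i. v $ i))"
proof (rule linear_conv_bounded_linear[THEN iffD1], rule linearI)
  fix v w :: "real^'n" and r :: real
  have "diag (\<lambda>i. (v + w) $ i) = diag (\<lambda>i. v $ i) + diag (\<lambda>i. w $ i)"
    by (simp add: diag_def vec_eq_iff)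
  then show "spectral U (\<lambda>i. (v + w) $ i) = spectral U (\<lambda>i. v $ i) + spectral U (\<lambda>i. w $ i)"
    by (simp only: spectral_def mm.add_left mm.add_right)
  have "diag (\<lambda>i. (r *\<^sub>R v) $ i) = r *\<^sub>R diag (\<lambda>i. v $ i)"
    by (simp add: diag_def vec_eq_iff)
  then show "spectral U (\<lambda>i. (r *\<^sub>R v) $ i) = r *\<^sub>R spectral U (\<lambda>i. v $ i)"
    by (simp only: spectral_def mm.scaleR_left mm.scaleR_right)
qed

lemma spectral_scaleR: "r *\<^sub>R spectral U a = spectral U (\<lambda>i. r * a i)"
  using linear_scale[OF bounded_linear.linear[OF bounded_linear_spectral], of U r "\<chi> i. a i"]
  by simp

lemma spectral_zero [simp]: "spectral U (\<lambda>i. 0) = 0"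
  using spectral_scaleR[of 0 U "\<lambda>i. 0"] by simp

lemma spectral_uminus: "- spectral U a = spectral U (\<lambda>i. - a i)"
  using spectral_scaleR[of "- 1" U a] by simp

lemma matpow_spectral:
  "orthogonal_matrix U \<Longrightarrow> matpow (spectral U a) k = spectral U (\<lambda>i. a i ^ k)"
  by (induction k) (simp_all add: spectral_one spectral_mult)

lemma mexp_spectral:
  assumes U: "orthogonal_matrix U"
  shows "mexp (spectral U a) = spectral U (\<lambda>i. exp (a i))"
proof -
  have "(\<lambda>k. \<Sum>j<k. \<chi> i. a i ^ j /\<^sub>R fact j) \<longlonglongrightarrow> (\<chi> i. exp (a i))"
  proof (rule vec_tendstoI)
    fix i
    show "(\<lambda>k. (\<Sum>j<k. \<chi> i. a i ^ j /\<^sub>R fact j) $ i) \<longlonglongrightarrow> (\<chi> i. exp (a i)) $ i"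
      using exp_converges[of "a i"] by (simp add: sums_def)
  qed
  then have "(\<lambda>k. \<chi> i. a i ^ k /\<^sub>R fact k) sums (\<chi> i. exp (a i))"
    by (simp add: sums_def)
  from bounded_linear.sums[OF bounded_linear_spectral this, of U]
  have "(\<lambda>k. spectral U (\<lambda>i. a i ^ k /\<^sub>R fact k)) sums spectral U (\<lambda>i. exp (a i))"
    by simp
  then have "(\<lambda>k. (1 / fact k) *\<^sub>R matpow (spectral U a) k) sums spectral U (\<lambda>i. exp (a i))"
    by (simp add: matpow_spectral[OF U] spectral_scaleR divide_inverse)
  then show ?thesis
    unfolding mexp_def by (rule sums_unique[symmetric])
qed

section \<open>Inverses, and positivity read off from eigenvalues\<close>

lemma matrix_inv_mult:
  assumes "invertible (A::real^'n^'n)"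
  shows "A ** matrix_inv A = mat 1" "matrix_inv A ** A = mat 1"
  using someI_ex[OF assms[unfolded invertible_def]] unfolding matrix_inv_def by auto

lemma matrix_inv_eqI:
  fixes A :: "real^'n^'n"
  assumes "A ** B = mat 1"
  shows "matrix_inv A = B"
proof -
  have "invertible A"
    using assms matrix_left_right_inverse unfolding invertible_def by blast
  then show ?thesis
    by (metis assms matrix_inv_mult(2) matrix_mul_assoc matrix_mul_lid matrix_mul_rid)
qed

lemma inner_spectral:
  "v \<bullet> (spectral U a *v v) = (\<Sum>i\<in>UNIV. a i * ((transpose U *v v) $ i)\<^sup>2)"
proof -
  have "v \<bullet> (spectral U a *v v) = (transpose U *v v) \<bullet> (diag a *v (transpose U *v v))"
    unfolding spectral_def
    by (simp add: matrix_vector_mul_assoc[symmetric] matrix_mul_assoc[symmetric] dot_lmul_matrix[symmetric])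
  also have "\<dots> = (\<Sum>i\<in>UNIV. a i * ((transpose U *v v) $ i)\<^sup>2)"
  proof -
    have "(diag a *v w) $ i = a i * w $ i" for w i
      by (simp add: diag_def matrix_vector_mult_def if_distrib if_distribR cong: if_cong)
    then show ?thesis
      by (simp add: inner_vec_def power2_eq_square mult_ac)
  qed
  finally show ?thesis .
qed

lemma spectral_in_SPD_iff:
  assumes U: "orthogonal_matrix (U::real^'n^'n)"
  shows "spectral U a \<in> SPD \<longleftrightarrow> (\<forall>i. a i > 0)"
proof
  assume S: "spectral U a \<in> SPD"
  show "\<forall>i. a i > 0"
  proof
    fix i
    define v where "v = U *v axis i 1"
    have v: "transpose U *v v = axis i 1"
      using U unfolding v_def by (simp add: matrix_vector_mul_assoc orthogonal_matrix_mults)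
    then have "v \<noteq> 0"
      by (metis axis_eq_0_iff matrix_vector_mult_0_right zero_neq_one)
    then have "(\<Sum>k\<in>UNIV. a k * (axis i 1 $ k)\<^sup>2) > 0"
      using S unfolding SPD_def v[symmetric] inner_spectral[symmetric] by blast
    then show "a i > 0"
      by (simp add: axis_def if_distrib[of "\<lambda>x. x\<^sup>2"] if_distrib[of "\<lambda>x. _ * x"] cong: if_cong)
  qed
next
  assume a: "\<forall>i. a i > 0"
  show "spectral U a \<in> SPD"
    unfolding SPD_def
  proof (intro CollectI conjI allI impI spectral_in_Sym)
    fix v :: "real^'n" assume "v \<noteq> 0"
    then have "transpose U *v v \<noteq> 0"
      using U by (metis matrix_vector_mul_assoc matrix_vector_mul_lid matrix_vector_mult_0_right 
          orthogonal_matrix_mults(2))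
    then obtain i where "(transpose U *v v) $ i \<noteq> 0"
      by (auto simp: vec_eq_iff)
    then show "v \<bullet> (spectral U a *v v) > 0"
      unfolding inner_spectral using a by (intro sum_pos2[of _ i]) (auto simp: less_imp_le)
  qed
qed

section \<open>The exponential of symmetric matrices\<close>

lemma Sym_minus [intro]: "A \<in> Sym \<Longrightarrow> - A \<in> Sym"
  by (simp add: Sym_def transpose_def vec_eq_iff)

lemma Sym_scaleR [intro]: "A \<in> Sym \<Longrightarrow> r *\<^sub>R A \<in> Sym"
  by (simp add: Sym_def transpose_def vec_eq_iff)

lemma Sym_add [intro]: "A \<in> Sym \<Longrightarrow> B \<in> Sym \<Longrightarrow> A + B \<in> Sym"
  by (simp add: Sym_def transpose_def vec_eq_iff)

lemma Sym_zero [simp]: "0 \<in> Sym"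
  by (simp add: Sym_def transpose_def vec_eq_iff)

lemma Sym_conj [intro]: "A \<in> Sym \<Longrightarrow> g ** A ** transpose g \<in> Sym"
  by (simp add: Sym_def matrix_transpose_mul matrix_mul_assoc)

lemma SPD_imp_Sym: "x \<in> SPD \<Longrightarrow> x \<in> Sym"
  by (simp add: SPD_def)

lemma mexp_in_SPD:
  assumes "Z \<in> Sym" shows "mexp Z \<in> SPD"
  by (rule spectral_cases[OF assms]) (simp add: mexp_spectral spectral_in_SPD_iff)

lemma SPD_cases:
  assumes "x \<in> SPD"
  obtains Z where "Z \<in> Sym" "x = mexp Z"
proof -
  obtain U a where U: "orthogonal_matrix U" "x = spectral U a"
    using spectral_cases[OF SPD_imp_Sym[OF assms]] by blast
  then have "\<forall>i. a i > 0"
    using assms spectral_in_SPD_iff by blast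
  then have "x = mexp (spectral U (\<lambda>i. ln (a i)))"
    using U by (simp add: mexp_spectral)
  then show thesis
    using that spectral_in_Sym by blast
qed

lemma transpose_mexp [simp]: "Z \<in> Sym \<Longrightarrow> transpose (mexp Z) = mexp Z"
  using SPD_imp_Sym[OF mexp_in_SPD] by (simp add: Sym_def)

lemma mexp_mult_scaleR:
  assumes "Z \<in> Sym"
  shows "mexp (s *\<^sub>R Z) ** mexp (t *\<^sub>R Z) = mexp ((s + t) *\<^sub>R Z)"
  by (rule spectral_cases[OF assms])
     (simp add: spectral_scaleR mexp_spectral spectral_mult exp_add ring_distribs)

lemma mexp_0 [simp]: "mexp (0 :: real^'n^'n) = mat 1"
proof -
  have "mexp (spectral (mat 1 :: real^'n^'n) (\<lambda>i. 0)) = mat 1"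
    by (simp add: mexp_spectral orthogonal_matrix_id spectral_one del: spectral_zero)
  then show ?thesis
    by simp
qed

lemma mexp_mult_minus: "Z \<in> Sym \<Longrightarrow> mexp Z ** mexp (- Z) = mat 1"
  using mexp_mult_scaleR[of Z 1 "- 1"] by simp

lemma mexp_minus_mult: "Z \<in> Sym \<Longrightarrow> mexp (- Z) ** mexp Z = mat 1"
  using mexp_mult_scaleR[of Z "- 1" 1] by simp

lemma matrix_inv_mexp: "Z \<in> Sym \<Longrightarrow> matrix_inv (mexp Z) = mexp (- Z)"
  by (simp add: matrix_inv_eqI mexp_mult_minus)

lemma mexp_half_sq: "Z \<in> Sym \<Longrightarrow> mexp ((1/2) *\<^sub>R Z) ** mexp ((1/2) *\<^sub>R Z) = mexp Z"
  using mexp_mult_scaleR[of Z "1/2" "1/2"] by simp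

lemma invertible_mexp: "Z \<in> Sym \<Longrightarrow> invertible (mexp Z)"
  unfolding invertible_def using mexp_mult_minus mexp_minus_mult by blast

lemma invertible_SPD: "x \<in> SPD \<Longrightarrow> invertible x"
  by (elim SPD_cases) (simp add: invertible_mexp)

lemma mexp_orthogonal_conj:
  fixes K Z :: "real^'n^'n"
  assumes K: "orthogonal_matrix K" and Z: "Z \<in> Sym"
  shows "mexp (K ** Z ** transpose K) = K ** mexp Z ** transpose K"
proof -
  obtain U a where U: "orthogonal_matrix U" "Z = spectral U a"
    using spectral_cases[OF Z] by blast
  have *: "K ** spectral U b ** transpose K = spectral (K ** U) b" for b :: "'n \<Rightarrow> real"
    by (simp add: spectral_def matrix_transpose_mul matrix_mul_assoc)
  show ?thesis
    using K U by (simp add: * mexp_spectral orthogonal_matrix_mul)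
qed

lemma SPD_conj:
  fixes g x :: "real^'n^'n"
  assumes x: "x \<in> SPD" and g: "invertible g"
  shows "g ** x ** transpose g \<in> SPD"
  unfolding SPD_def
proof (intro CollectI conjI allI impI)
  show "g ** x ** transpose g \<in> Sym"
    by (intro Sym_conj SPD_imp_Sym x)
  fix v :: "real^'n" assume "v \<noteq> 0"
  have "transpose (matrix_inv g) ** transpose g = mat 1"
    using matrix_inv_mult(1)[OF g] by (metis matrix_transpose_mul transpose_mat)
  then have "transpose g *v v \<noteq> 0"
    using \<open>v \<noteq> 0\<close> by (metis matrix_vector_mul_assoc matrix_vector_mul_lid matrix_vector_mult_0_right)
  then have "(transpose g *v v) \<bullet> (x *v (transpose g *v v)) > 0"
    using x unfolding SPD_def by blast
  then show "v \<bullet> ((g ** x ** transpose g) *v v) > 0"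
    by (simp add: matrix_vector_mul_assoc[symmetric] matrix_mul_assoc[symmetric] dot_lmul_matrix[symmetric])
qed

section \<open>Comparing two eigenbases\<close>

text \<open>Multiplying by \<open>transpose U\<close> on the left and \<open>W\<close> on the right
  keeps the norm and turns the difference into a matrix with entries \<open>(g j - f i)\<close>
  times those of \<open>transpose U ** W\<close>. The squared entries are nonnegative weights, so
  scalar inequalities between pairs of eigenvalues sum up to matrix inequalities.\<close>

lemma norm_spectral_diff:
  assumes U: "orthogonal_matrix U" and W: "orthogonal_matrix W"
  shows "(norm (spectral W g - spectral U f))\<^sup>2 =
    (\<Sum>i\<in>UNIV. \<Sum>j\<in>UNIV. (g j - f i)\<^sup>2 * ((transpose U ** W) $ i $ j)\<^sup>2)"
proof -
  have "transpose U ** (spectral W g - spectral U f) ** W =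
      (transpose U ** W) ** diag g - diag f ** (transpose U ** W)"
    using U W unfolding spectral_def mm.diff_right mm.diff_left
    by (simp add: matrix_mul_assoc[symmetric] orthogonal_matrix_mults)
  then have "norm (spectral W g - spectral U f) =
      norm ((transpose U ** W) ** diag g - diag f ** (transpose U ** W))"
    using U W by (metis norm_orthogonal_left norm_orthogonal_right orthogonal_matrix_transpose)
  then have "(norm (spectral W g - spectral U f))\<^sup>2 = (\<Sum>i\<in>UNIV. \<Sum>j\<in>UNIV.
      ((transpose U ** W ** diag g - diag f ** (transpose U ** W)) $ i $ j)\<^sup>2)"
    by (simp only: norm_matrix_sq)
  then show ?thesis
    by (simp add: diag_mult_left diag_mult_right power_mult_distrib[symmetric] algebra_simps)
qed

text \<open>The weights are those of \<open>norm_spectral_diff\<close>, so traces and norms can be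
  compared term by term.\<close>

lemma trace_spectral_mult:
  "trace (spectral U f ** spectral W g) =
    (\<Sum>i\<in>UNIV. \<Sum>j\<in>UNIV. f i * g j * ((transpose U ** W) $ i $ j)\<^sup>2)"
proof -
  define M where "M = transpose U ** W"
  have "trace (spectral U f ** spectral W g) = trace (U ** (diag f ** (M ** diag g ** transpose W)))"
    by (simp add: spectral_def M_def matrix_mul_assoc)
  also have "\<dots> = trace (diag f ** (M ** diag g ** transpose M))"
    by (subst trace_mul_sym) (simp add: M_def matrix_transpose_mul matrix_mul_assoc)
  also have "\<dots> = (\<Sum>i\<in>UNIV. \<Sum>j\<in>UNIV. f i * g j * (M $ i $ j)\<^sup>2)"
    unfolding trace_def diag_mult_left
    by (simp add: matrix_matrix_mult_def[of "M ** diag g"] diag_mult_right transpose_def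
        sum_distrib_left power2_eq_square mult_ac)
  finally show ?thesis
    by (simp add: M_def)
qed

text \<open>Lets the constant \<open>2 * real CARD('n)\<close> in \<open>Theta\<close> be spread
  over the same weights as its two traces.\<close>

lemma sum_orthogonal_entries_sq:
  assumes "orthogonal_matrix (M::real^'n^'n)"
  shows "(\<Sum>i\<in>UNIV. \<Sum>j\<in>UNIV. (M $ i $ j)\<^sup>2) = real CARD('n)"
proof -
  have "(norm M)\<^sup>2 = trace (mat 1 :: real^'n^'n)"
    using assms by (simp add: power2_norm_eq_inner inner_eq_trace orthogonal_matrix_mults)
  then show ?thesis
    by (simp add: norm_matrix_sq trace_I)
qed

text \<open>For positive definite \<open>x\<close> and \<open>y\<close> this is twice the sum of the
  two Kullback-Leibler divergences between the centred Gaussian laws with covariances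
  \<open>x\<close> and \<open>y\<close>. To leading order near the diagonal it is the squared
  distance.\<close>

definition Theta :: "real^'n^'n \<Rightarrow> real^'n^'n \<Rightarrow> real" where
  "Theta x y = trace (matrix_inv x ** y) + trace (matrix_inv y ** x) - 2 * real CARD('n)"

lemma Theta_mexp_spectral:
  assumes U: "orthogonal_matrix U" and W: "orthogonal_matrix W"
  shows "Theta (mexp (spectral U a)) (mexp (spectral W b)) =
    (\<Sum>i\<in>UNIV. \<Sum>j\<in>UNIV. (exp (b j - a i) + exp (a i - b j) - 2) * ((transpose U ** W) $ i $ j)\<^sup>2)"
proof -
  define M where "M = transpose U ** W"
  have M: "orthogonal_matrix M"
    unfolding M_def by (intro orthogonal_matrix_mul orthogonal_matrix_transpose U W)
  have "trace (mexp (- spectral U a) ** mexp (spectral W b)) =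
     (\<Sum>i\<in>UNIV. \<Sum>j\<in>UNIV. exp (b j - a i) * (M $ i $ j)\<^sup>2)"
    by (simp add: spectral_uminus mexp_spectral U W trace_spectral_mult M_def mult_exp_exp)
  moreover have "trace (mexp (- spectral W b) ** mexp (spectral U a)) =
     (\<Sum>i\<in>UNIV. \<Sum>j\<in>UNIV. exp (a i - b j) * (M $ i $ j)\<^sup>2)"
    by (subst trace_mul_sym) (simp add: spectral_uminus mexp_spectral U W trace_spectral_mult M_def mult_exp_exp)
  ultimately show ?thesis
    unfolding Theta_def M_def[symmetric] sum_orthogonal_entries_sq[OF M, symmetric]
    by (simp add: matrix_inv_mexp spectral_in_Sym sum_distrib_left sum.distrib sum_subtractf left_diff_distrib
        ring_distribs)
qed

text \<open>The value is \<open>4 sinh^2 (s/2)\<close>. The square shows nonnegativity and reduces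
  both quadratic bounds below to linear ones.\<close>

lemma exp_plus_exp_minus_eq: "exp s + exp (- s) - 2 = (exp (s/2) - exp (- (s/2)))\<^sup>2" for s :: real
proof -
  have "exp s = (exp (s/2))\<^sup>2" "exp (- s) = (exp (- (s/2)))\<^sup>2" "exp (s/2) * exp (- (s/2)) = 1"
    by (simp_all add: exp_double[symmetric] mult_exp_exp)
  then show ?thesis
    by (simp add: power2_diff)
qed

text \<open>For \<open>t \<ge> 0\<close> one has \<open>2 * t \<le> exp t - exp (- t)\<close>, since
  the difference has derivative \<open>exp x + exp (- x) - 2\<close>, a square. Take
  \<open>t = \<bar>s\<bar> / 2\<close> and square.\<close>

lemma sq_le_exp_plus_exp_minus: "s\<^sup>2 \<le> exp s + exp (- s) - 2" for s :: real
proof -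
  have *: "2 * t \<le> exp t - exp (- t)" if "t \<ge> 0" for t :: real
  proof -
    have "exp 0 - exp (- 0) - 2 * 0 \<le> exp t - exp (- t) - 2 * t"
    proof (rule DERIV_nonneg_imp_nondecreasing[OF that])
      fix x :: real
      have "exp x + exp (- x) - 2 \<ge> 0"
        unfolding exp_plus_exp_minus_eq by simp
      moreover have "((\<lambda>t. exp t - exp (- t) - 2 * t) has_real_derivative exp x + exp (- x) - 2) (at x)"
        by (auto intro!: derivative_eq_intros)
      ultimately show "\<exists>y. ((\<lambda>t. exp t - exp (- t) - 2 * t) has_real_derivative y) (at x) \<and> 0 \<le> y"
        by blast
    qed
    then show ?thesis
      by simp
  qed
  have "\<bar>s\<bar> \<le> \<bar>exp (s/2) - exp (- (s/2))\<bar>"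
    using *[of "s/2"] *[of "- s/2"] by (cases "s \<ge> 0") auto
  then show ?thesis
    unfolding exp_plus_exp_minus_eq by (simp add: abs_le_square_iff)
qed

text \<open>The converse of the preceding bound up to a factor that tends to \<open>1\<close> as
  \<open>s\<close> tends to \<open>0\<close>; this is why a fine subdivision loses nothing in the
  limit.\<close>

lemma exp_plus_exp_minus_le: "exp s + exp (- s) - 2 \<le> s\<^sup>2 * exp \<bar>s\<bar>" for s :: real
proof -
  have *: "exp t + exp (- t) - 2 \<le> t\<^sup>2 * exp t" if "t \<ge> 0" for t :: real
  proof -
    have "1 - exp (- t) \<le> t"
      using exp_ge_add_one_self[of "- t"] by linarith
    then have "exp (t/2) * (1 - exp (- t)) \<le> exp (t/2) * t"
      by simp
    then have "exp (t/2) - exp (- (t/2)) \<le> exp (t/2) * t"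
      by (simp add: right_diff_distrib mult_exp_exp)
    then have "(exp (t/2) - exp (- (t/2)))\<^sup>2 \<le> (exp (t/2) * t)\<^sup>2"
      using that by (intro power_mono) auto
    then show ?thesis
      unfolding exp_plus_exp_minus_eq by (simp add: power_mult_distrib exp_double[symmetric] mult.commute)
  qed
  show ?thesis
    using *[of s] *[of "- s"] by (cases "s \<ge> 0") (auto simp: add.commute)
qed

lemma norm_diff_sq_le_Theta:
  assumes "A \<in> Sym" "B \<in> Sym"
  shows "(norm (B - A))\<^sup>2 \<le> Theta (mexp A) (mexp B)"
proof -
  obtain U a where U: "orthogonal_matrix U" "A = spectral U a"
    using spectral_cases[OF assms(1)] by blast
  obtain W b where W: "orthogonal_matrix W" "B = spectral W b"
    using spectral_cases[OF assms(2)] by blast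
  have "(b j - a i)\<^sup>2 \<le> exp (b j - a i) + exp (a i - b j) - 2" for i j
    using sq_le_exp_plus_exp_minus[of "b j - a i"] by simp
  then show ?thesis
    unfolding U(2) W(2) norm_spectral_diff[OF U(1) W(1)] Theta_mexp_spectral[OF U(1) W(1)]
    by (intro sum_mono mult_right_mono) simp_all
qed

lemma abs_eigenvalue_le_norm:
  assumes U: "orthogonal_matrix (U::real^'n^'n)"
  shows "\<bar>a j\<bar> \<le> norm (spectral U a)"
proof -
  have "(norm (spectral U a))\<^sup>2 = (\<Sum>i\<in>UNIV. \<Sum>j\<in>UNIV. (a j)\<^sup>2 * ((transpose U ** U) $ i $ j)\<^sup>2)"
    using norm_spectral_diff[OF U U, of a "\<lambda>i. 0"] by simp
  moreover have "(a j)\<^sup>2 \<le> (\<Sum>i\<in>UNIV. \<Sum>j\<in>UNIV. (a j)\<^sup>2 * ((mat 1 :: real^'n^'n) $ i $ j)\<^sup>2)"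
    by (simp add: mat_def if_distrib[of "\<lambda>x. x\<^sup>2"] if_distrib[of "\<lambda>x. _ * x"] sum.delta cong: if_cong)
      (rule member_le_sum, auto)
  ultimately show ?thesis
    using U abs_le_square_iff[of "a j" "norm (spectral U a)"] by (simp add: orthogonal_matrix_mults)
qed

lemma Theta_one_le:
  assumes "(Z::real^'n^'n) \<in> Sym"
  shows "Theta (mat 1) (mexp Z) \<le> (norm Z)\<^sup>2 * exp (norm Z)"
proof -
  obtain U a where U: "orthogonal_matrix U" "Z = spectral U a"
    using spectral_cases[OF assms] by blast
  have one: "mat 1 = mexp (spectral U (\<lambda>i. 0))"
    by simp
  have Z: "(norm Z)\<^sup>2 = (\<Sum>i\<in>UNIV. \<Sum>j\<in>UNIV. (a j)\<^sup>2 * ((transpose U ** U) $ i $ j)\<^sup>2)"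
    using norm_spectral_diff[OF U(1) U(1), of a "\<lambda>i. 0"] by (simp add: U(2))
  have "\<bar>a j\<bar> \<le> norm Z" for j
    unfolding U(2) by (rule abs_eigenvalue_le_norm[OF U(1)])
  then have *: "exp (a j) + exp (- a j) - 2 \<le> exp (norm Z) * (a j)\<^sup>2" for j
    using exp_plus_exp_minus_le[of "a j"] mult_left_mono[of "exp \<bar>a j\<bar>" "exp (norm Z)" "(a j)\<^sup>2"] 
    by (simp add: mult.commute)
  have "Theta (mat 1) (mexp Z) \<le> (\<Sum>i\<in>UNIV. \<Sum>j\<in>UNIV. exp (norm Z) * (a j)\<^sup>2 * ((transpose U ** U) $ i $ j)\<^sup>2)"
    unfolding one U(2) Theta_mexp_spectral[OF U(1) U(1)]
    using * unfolding U(2) by (intro sum_mono mult_right_mono) simp_all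
  also have "\<dots> = (norm Z)\<^sup>2 * exp (norm Z)"
    unfolding Z by (simp add: sum_distrib_left sum_distrib_right mult_ac)
  finally show ?thesis .
qed

section \<open>Congruence invariance of \<open>Theta\<close> and its quadratic upper bound\<close>

lemma matrix_inv_conj:
  fixes g x :: "real^'n^'n"
  assumes "invertible g" "invertible x"
  shows "matrix_inv (g ** x ** transpose g) = transpose (matrix_inv g) ** matrix_inv x ** matrix_inv g"
proof (rule matrix_inv_eqI)
  have "transpose g ** transpose (matrix_inv g) = mat 1"
    using matrix_inv_mult(2)[OF assms(1)] by (metis matrix_transpose_mul transpose_mat)
  then have "transpose g ** (transpose (matrix_inv g) ** C) = C" for C :: "real^'n^'n"
    by (simp add: matrix_mul_assoc)
  moreover have "x ** (matrix_inv x ** C) = C" for C :: "real^'n^'n"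
    using matrix_inv_mult(1)[OF assms(2)] by (simp add: matrix_mul_assoc)
  ultimately show "g ** x ** transpose g ** (transpose (matrix_inv g) ** matrix_inv x ** matrix_inv g) = mat 1"
    using matrix_inv_mult(1)[OF assms(1)] by (simp add: matrix_mul_assoc[symmetric])
qed

lemma Theta_conj:
  fixes g x y :: "real^'n^'n"
  assumes "invertible g" "invertible x" "invertible y"
  shows "Theta (g ** x ** transpose g) (g ** y ** transpose g) = Theta x y"
proof -
  have *: "trace (matrix_inv (g ** u ** transpose g) ** (g ** w ** transpose g)) = trace (matrix_inv u ** w)"
    if "invertible u" for u w :: "real^'n^'n"
  proof -
    have "matrix_inv g ** (g ** C) = C" for C :: "real^'n^'n"
      using matrix_inv_mult(2)[OF assms(1)] by (simp add: matrix_mul_assoc)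
    moreover have "transpose g ** transpose (matrix_inv g) = mat 1"
      using matrix_inv_mult(2)[OF assms(1)] by (metis matrix_transpose_mul transpose_mat)
    ultimately show ?thesis
      using trace_mul_sym[of "transpose (matrix_inv g)" "matrix_inv u ** (w ** transpose g)"]
      unfolding matrix_inv_conj[OF assms(1) that] by (simp add: matrix_mul_assoc[symmetric])
  qed
  show ?thesis
    unfolding Theta_def by (simp add: * assms)
qed

text \<open>Expand the product; the mixed factors \<open>matrix_inv x ** y\<close> and
  \<open>matrix_inv y ** x\<close> cancel each other. In this form \<open>Theta\<close> is visibly
  of second order in \<open>y - x\<close>, which controls both derivatives and the errors of Euler
  steps.\<close>

lemma Theta_eq_trace:
  fixes x y :: "real^'n^'n"
  assumes "invertible x" "invertible y"
  shows "Theta x y = trace (matrix_inv x ** (y - x) ** matrix_inv y ** (y - x))"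
proof -
  have "matrix_inv x ** (y - x) ** matrix_inv y ** (y - x) =
      (matrix_inv x ** y - mat 1) ** (mat 1 - matrix_inv y ** x)"
    using matrix_inv_mult[OF assms(1)] matrix_inv_mult[OF assms(2)]
    by (simp add: mm.diff_right matrix_mul_assoc[symmetric])
  also have "\<dots> = matrix_inv x ** y + matrix_inv y ** x - mat 1 - mat 1"
  proof -
    have "matrix_inv x ** y ** (matrix_inv y ** x) = mat 1"
      using matrix_inv_mult[OF assms(1)] matrix_inv_mult[OF assms(2)]
      by (metis matrix_mul_assoc matrix_mul_lid)
    then show ?thesis
      by (simp add: mm.diff_right mm.diff_left)
  qed
  finally show ?thesis
    by (simp only: Theta_def trace_add trace_sub trace_I)
qed

lemma Theta_le_norm:
  fixes x y :: "real^'n^'n"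
  assumes "invertible x" "invertible y"
  shows "Theta x y \<le> norm (matrix_inv x) * norm (matrix_inv y) * (norm (y - x))\<^sup>2"
proof -
  have "Theta x y \<le> norm (matrix_inv x ** (y - x)) * norm (matrix_inv y ** (y - x))"
    using abs_trace_mult_le[of "matrix_inv x ** (y - x)" "matrix_inv y ** (y - x)"]
    by (simp add: Theta_eq_trace[OF assms] matrix_mul_assoc)
  also have "\<dots> \<le> (norm (matrix_inv x) * norm (y - x)) * (norm (matrix_inv y) * norm (y - x))"
    by (intro mult_mono norm_matrix_mult_le mult_nonneg_nonneg) auto
  finally show ?thesis
    by (simp add: power2_eq_square mult_ac)
qed

section \<open>Logarithm, square root and the distance function\<close>

definition spd_log :: "real^'n^'n \<Rightarrow> real^'n^'n" where
  "spd_log x = (THE Z. Z \<in> Sym \<and> mexp Z = x)"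

text \<open>\<open>Theta\<close> vanishes on the diagonal and dominates the squared difference of
  logarithms, so two logarithms of one matrix coincide without any comparison of
  eigenspaces.\<close>

lemma mexp_inject:
  assumes "A \<in> Sym" "B \<in> Sym" "mexp A = mexp B"
  shows "A = B"
proof -
  have "Theta (mexp A) (mexp B) = 0"
    unfolding assms(3) Theta_def matrix_inv_mult(2)[OF invertible_mexp[OF assms(2)]] trace_I by simp
  then have "(norm (B - A))\<^sup>2 \<le> 0"
    using norm_diff_sq_le_Theta[OF assms(1,2)] by simp
  then show ?thesis
    by simp
qed

lemma spd_log_mexp [simp]: "Z \<in> Sym \<Longrightarrow> spd_log (mexp Z) = Z"
  unfolding spd_log_def by (rule the_equality) (auto intro: mexp_inject)

lemma spd_log_Sym: "x \<in> SPD \<Longrightarrow> spd_log x \<in> Sym"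
  by (elim SPD_cases) simp

lemma mexp_spd_log [simp]: "x \<in> SPD \<Longrightarrow> mexp (spd_log x) = x"
  by (elim SPD_cases) simp

lemma spd_sqrt_mexp:
  assumes Z: "Z \<in> Sym"
  shows "spd_sqrt (mexp Z) = mexp ((1/2) *\<^sub>R Z)"
  unfolding spd_sqrt_def
proof (rule the_equality)
  show "mexp ((1/2) *\<^sub>R Z) \<in> SPD \<and> mexp ((1/2) *\<^sub>R Z) ** mexp ((1/2) *\<^sub>R Z) = mexp Z"
    using Z by (simp add: mexp_in_SPD mexp_half_sq Sym_scaleR)
  fix s assume s: "s \<in> SPD \<and> s ** s = mexp Z"
  then obtain W where W: "W \<in> Sym" "s = mexp W"
    using SPD_cases by blast
  then have "mexp (2 *\<^sub>R W) = mexp Z"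
    using s mexp_mult_scaleR[of W 1 1] by simp
  then have "2 *\<^sub>R W = Z"
    using W(1) Z by (simp add: mexp_inject Sym_scaleR)
  then show "s = mexp ((1/2) *\<^sub>R Z)"
    using W by auto
qed

text \<open>The closed formula for the affine-invariant distance, independent of curves; it is
  matched with the infimum in \<open>ai_dist_eq_spd_dist\<close>.\<close>

definition spd_dist :: "real^'n^'n \<Rightarrow> real^'n^'n \<Rightarrow> real" where
  "spd_dist x y = norm (spd_log (matrix_inv (spd_sqrt x) ** y ** matrix_inv (spd_sqrt x)))"

text \<open>Any \<open>g\<close> with \<open>g ** transpose g = x\<close> may replace the square
  root of \<open>x\<close>: the quotient \<open>K = r ** g\<close> is orthogonal, and conjugation by
  \<open>K\<close> commutes with \<open>mexp\<close> and keeps the norm. Invariance and symmetry of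
  \<open>spd_dist\<close> then need only a good choice of \<open>g\<close>.\<close>

lemma spd_dist_eqI:
  fixes g :: "real^'n^'n"
  assumes g: "invertible g" and Z: "Z \<in> Sym"
  shows "spd_dist (g ** transpose g) (g ** mexp Z ** transpose g) = norm Z"
proof -
  have "g ** transpose g \<in> SPD"
    using SPD_conj[OF mexp_in_SPD[OF Sym_zero] g] by simp
  then obtain X where X: "X \<in> Sym" "g ** transpose g = mexp X"
    using SPD_cases by blast
  define s where "s = mexp ((1/2) *\<^sub>R X)"
  define r where "r = mexp (- (1/2) *\<^sub>R X)"
  have s: "spd_sqrt (g ** transpose g) = s" "matrix_inv s = r" "transpose r = r" "r ** s = mat 1" "s ** r = mat 1"
    "s ** s = g ** transpose g"
    using X matrix_inv_mexp[of "(1/2) *\<^sub>R X"] mexp_minus_mult[of "(1/2) *\<^sub>R X"]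
      mexp_mult_minus[of "(1/2) *\<^sub>R X"] mexp_half_sq[of X]
    by (auto simp: spd_sqrt_mexp s_def r_def Sym_scaleR Sym_minus)
  define K where "K = r ** g"
  have "K ** transpose K = r ** (s ** s) ** r"
    unfolding K_def s(6) by (simp add: matrix_transpose_mul s(3) matrix_mul_assoc)
  also have "\<dots> = (r ** s) ** (s ** r)"
    by (simp only: matrix_mul_assoc)
  also have "\<dots> = mat 1"
    using s by simp
  finally have K: "orthogonal_matrix K"
    by (metis matrix_left_right_inverse orthogonal_matrix_def)
  have "r ** (g ** mexp Z ** transpose g) ** r = K ** mexp Z ** transpose K"
    by (simp add: K_def matrix_transpose_mul s(3) matrix_mul_assoc)
  also have "\<dots> = mexp (K ** Z ** transpose K)"
    by (simp add: mexp_orthogonal_conj K Z)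
  finally have "spd_log (r ** (g ** mexp Z ** transpose g) ** r) = K ** Z ** transpose K"
    using Z by (simp add: Sym_conj)
  then show ?thesis
    using K by (simp add: spd_dist_def s norm_orthogonal_left norm_orthogonal_right orthogonal_matrix_transpose)
qed

text \<open>Normal form of a pair: congruence by \<open>g\<close> moves the identity to
  \<open>x\<close>, and the curve from \<open>g ** g\<close> through
  \<open>g ** mexp (t *\<^sub>R L) ** g\<close> is the geodesic to \<open>y\<close>.\<close>

lemma spd_pair_cases:
  fixes x y :: "real^'n^'n"
  assumes "x \<in> SPD" "y \<in> SPD"
  obtains g L where "g \<in> SPD" "invertible g" "transpose g = g" "L \<in> Sym"
    "x = g ** g" "y = g ** mexp L ** g" "spd_dist x y = norm L"
proof -
  obtain X where X: "X \<in> Sym" "x = mexp X"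
    using assms(1) SPD_cases by blast
  define g where "g = mexp ((1/2) *\<^sub>R X)"
  define r where "r = mexp (- (1/2) *\<^sub>R X)"
  have g: "g \<in> SPD" "invertible g" "transpose g = g" "x = g ** g"
    using X by (auto simp: g_def mexp_in_SPD invertible_mexp mexp_half_sq Sym_scaleR)
  have r: "r \<in> SPD" "invertible r" "transpose r = r" "g ** r = mat 1" "r ** g = mat 1"
    using X mexp_mult_minus[of "(1/2) *\<^sub>R X"] mexp_minus_mult[of "(1/2) *\<^sub>R X"]
    by (auto simp: g_def r_def mexp_in_SPD invertible_mexp Sym_scaleR Sym_minus)
  obtain L where L: "L \<in> Sym" "r ** y ** r = mexp L"
    using SPD_conj[OF assms(2) r(2)] r(3) SPD_cases by metis
  have y: "y = g ** mexp L ** g"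
    unfolding L(2)[symmetric] using r by (metis matrix_mul_assoc matrix_mul_lid matrix_mul_rid)
  moreover have "spd_dist x y = norm L"
    using spd_dist_eqI[OF g(2) L(1)] g y by simp
  ultimately show thesis
    using that g L by blast
qed

text \<open>Apply \<open>spd_dist_eqI\<close> to \<open>h ** g\<close>, which in general is not
  symmetric.\<close>

lemma spd_dist_conj:
  fixes x y h :: "real^'n^'n"
  assumes "x \<in> SPD" "y \<in> SPD" "invertible h"
  shows "spd_dist (h ** x ** transpose h) (h ** y ** transpose h) = spd_dist x y"
proof -
  obtain g L where g: "invertible g" "transpose g = g" "L \<in> Sym"
    "x = g ** g" "y = g ** mexp L ** g" "spd_dist x y = norm L"
    using spd_pair_cases[OF assms(1,2)] by metis
  have "spd_dist ((h ** g) ** transpose (h ** g)) ((h ** g) ** mexp L ** transpose (h ** g)) = norm L"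
    by (rule spd_dist_eqI[OF invertible_mult[OF assms(3) g(1)] g(3)])
  then show ?thesis
    using g by (simp add: matrix_transpose_mul matrix_mul_assoc)
qed

text \<open>The geodesic read backwards: with \<open>h\<close> the square root of
  \<open>mexp L\<close>, the matrix \<open>g ** h\<close> takes the identity to \<open>y\<close> and
  \<open>mexp (- L)\<close> to \<open>x\<close>.\<close>

lemma spd_dist_commute:
  fixes x y :: "real^'n^'n"
  assumes "x \<in> SPD" "y \<in> SPD"
  shows "spd_dist y x = spd_dist x y"
proof -
  obtain g L where g: "invertible g" "transpose g = g" "L \<in> Sym"
    "x = g ** g" "y = g ** mexp L ** g" "spd_dist x y = norm L"
    using spd_pair_cases[OF assms] by metis
  define h where "h = mexp ((1/2) *\<^sub>R L)"
  have h: "invertible h" "transpose h = h" "h ** h = mexp L" "h ** mexp (- L) ** h = mat 1"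
    using g(3) mexp_mult_scaleR[of L "1/2" "- 1"] mexp_mult_scaleR[of L "- (1/2)" "1/2"] 
    by (auto simp: h_def invertible_mexp mexp_half_sq Sym_scaleR)
  have "spd_dist ((g ** h) ** transpose (g ** h)) ((g ** h) ** mexp (- L) ** transpose (g ** h)) = norm (- L)"
    by (rule spd_dist_eqI[OF invertible_mult[OF g(1) h(1)] Sym_minus[OF g(3)]])
  moreover have "(g ** h) ** transpose (g ** h) = y"
    using g h by (metis matrix_mul_assoc matrix_transpose_mul)
  moreover have "(g ** h) ** mexp (- L) ** transpose (g ** h) = x"
    using g h by (metis matrix_mul_assoc matrix_transpose_mul matrix_mul_rid)
  ultimately show ?thesis
    using g(6) by simp
qed

lemma spd_dist_one_mexp: "Z \<in> Sym \<Longrightarrow> spd_dist (mat 1) (mexp Z) = norm Z"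
  using spd_dist_eqI[of "mat 1" Z] by (simp add: invertible_def)

lemma spd_dist_one: "x \<in> SPD \<Longrightarrow> spd_dist (mat 1) x = norm (spd_log x)"
  by (elim SPD_cases) (simp add: spd_dist_one_mexp)

lemma mat_1_SPD [simp]: "mat 1 \<in> SPD"
  using mexp_in_SPD[OF Sym_zero] by simp

lemma spd_dist_nonneg: "spd_dist x y \<ge> 0"
  by (simp add: spd_dist_def)

lemma spd_dist_sq_le_Theta:
  fixes x y :: "real^'n^'n"
  assumes "x \<in> SPD" "y \<in> SPD"
  shows "(spd_dist x y)\<^sup>2 \<le> Theta x y"
proof -
  obtain g L where g: "invertible g" "transpose g = g" "L \<in> Sym"
    "x = g ** g" "y = g ** mexp L ** g" "spd_dist x y = norm L"
    using spd_pair_cases[OF assms] by metis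
  have "(norm L)\<^sup>2 \<le> Theta (mat 1) (mexp L)"
    using norm_diff_sq_le_Theta[of 0 L] g by simp
  also have "\<dots> = Theta x y"
    using Theta_conj[OF g(1) invertible_SPD[OF mat_1_SPD] invertible_mexp[OF g(3)]] g by simp
  finally show ?thesis
    using g by simp
qed

lemma spd_dist_self: "x \<in> SPD \<Longrightarrow> spd_dist x x = 0"
  using spd_dist_sq_le_Theta[of x x] matrix_inv_mult(2)[OF invertible_SPD, of x]
  by (simp add: Theta_def trace_I)

text \<open>The inequality \<open>norm_diff_sq_le_Theta\<close> is sharp to first order, so summing it over a
  fine subdivision of the geodesic yields the exponential metric increasing property.\<close>

theorem norm_diff_le_spd_dist:
  fixes A B :: "real^'n^'n"
  assumes A: "A \<in> Sym" and B: "B \<in> Sym"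
  shows "norm (B - A) \<le> spd_dist (mexp A) (mexp B)"
proof -
  obtain g L where g: "invertible g" "transpose g = g" "L \<in> Sym"
    "mexp A = g ** g" "mexp B = g ** mexp L ** g" "spd_dist (mexp A) (mexp B) = norm L"
    using spd_pair_cases[OF mexp_in_SPD mexp_in_SPD, OF A B] by metis
  define p where "p t = g ** mexp (t *\<^sub>R L) ** g" for t :: real
  define z where "z t = spd_log (p t)" for t
  have p: "p t \<in> SPD" for t
    using SPD_conj[OF mexp_in_SPD g(1), of "t *\<^sub>R L"] g by (simp add: p_def Sym_scaleR)
  have z: "z t \<in> Sym" "mexp (z t) = p t" for t
    by (simp_all add: z_def spd_log_Sym p)
  have z01: "z 0 = A" "z 1 = B"
    using g A B by (auto simp: z_def p_def) (metis spd_log_mexp)+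
  have step: "norm (z (t + r) - z t) \<le> r * norm L * exp (r * (norm L / 2))" if r: "r > 0" for t r :: real
  proof -
    \<comment> \<open>Congruence by \<open>g ** h\<close> takes the identity to \<open>p t\<close>
      and \<open>mexp (r *\<^sub>R L)\<close> to \<open>p (t + r)\<close>, so \<open>Theta\<close>
      of one step depends on \<open>r\<close> and \<open>L\<close> only.\<close>
    define h where "h = mexp ((t/2) *\<^sub>R L)"
    have h: "invertible h" "transpose h = h" "h ** h = mexp (t *\<^sub>R L)"
       "h ** mexp (r *\<^sub>R L) ** h = mexp ((t + r) *\<^sub>R L)"
      using g(3) by (auto simp: h_def invertible_mexp Sym_scaleR mexp_mult_scaleR)
    have "p t = (g ** h) ** mat 1 ** transpose (g ** h)"
      "p (t + r) = (g ** h) ** mexp (r *\<^sub>R L) ** transpose (g ** h)"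
      unfolding p_def h(3,4)[symmetric] using g(2) h(2)
      by (simp_all add: matrix_transpose_mul matrix_mul_assoc)
    then have "Theta (p t) (p (t + r)) = Theta (mat 1) (mexp (r *\<^sub>R L))"
      using g h by (simp only: Theta_conj invertible_mult invertible_SPD mat_1_SPD invertible_mexp Sym_scaleR)
    also have "\<dots> \<le> (r * norm L)\<^sup>2 * exp (r * norm L)"
      using Theta_one_le[of "r *\<^sub>R L"] g(3) r by (simp add: Sym_scaleR)
    also have "\<dots> = (r * norm L * exp (r * (norm L / 2)))\<^sup>2"
      by (simp add: power_mult_distrib exp_double[symmetric])
    finally have "(norm (z (t + r) - z t))\<^sup>2 \<le> (r * norm L * exp (r * (norm L / 2)))\<^sup>2"
      using norm_diff_sq_le_Theta[OF z(1) z(1), of "t + r" t] by (simp add: z(2))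
    then show ?thesis
      using r by (simp add: power2_le_iff_abs_le)
  qed
  have "norm (B - A) \<le> norm L * exp (norm L / 2 * inverse (real (Suc m)))" for m
  proof -
    define N where "N = real (Suc m)"
    have N: "N > 0"
      by (simp add: N_def)
    have "B - A = (\<Sum>k<Suc m. z (real (Suc k) / N) - z (real k / N))"
      using N by (subst sum_lessThan_telescope) (simp add: z01 N_def)
    then have "norm (B - A) \<le> (\<Sum>k<Suc m. norm (z (real (Suc k) / N) - z (real k / N)))"
      by (simp only: norm_sum)
    also have "\<dots> \<le> (\<Sum>k<Suc m. 1 / N * norm L * exp (1 / N * (norm L / 2)))"
    proof (rule sum_mono)
      fix k
      show "norm (z (real (Suc k) / N) - z (real k / N)) \<le> 1 / N * norm L * exp (1 / N * (norm L / 2))"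
        using step[of "1 / N" "real k / N"] N by (simp add: add_divide_distrib add.commute)
    qed
    also have "\<dots> = N * (1 / N * norm L * exp (1 / N * (norm L / 2)))"
      by (simp add: N_def)
    also have "\<dots> = norm L * exp (norm L / 2 * inverse N)"
      using N by (simp add: field_simps)
    finally show ?thesis
      by (simp add: N_def)
  qed
  moreover have "(\<lambda>m. norm L * exp (norm L / 2 * inverse (real (Suc m)))) \<longlonglongrightarrow> norm L * exp (norm L / 2 * 0)"
    by (intro tendsto_intros LIMSEQ_inverse_real_of_nat)
  ultimately have "norm (B - A) \<le> norm L * exp (norm L / 2 * 0)"
    by (intro LIMSEQ_le_const) auto
  then show ?thesis
    using g by simp
qed

text \<open>Move \<open>x\<close> to the identity. There the left side is exactly the norm of a
  logarithm, and the triangle inequality of that norm passes to the right side by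
  \<open>norm_diff_le_spd_dist\<close>.\<close>

lemma spd_dist_triangle:
  fixes x y z :: "real^'n^'n"
  assumes x: "x \<in> SPD" and y: "y \<in> SPD" and z: "z \<in> SPD"
  shows "spd_dist x z \<le> spd_dist x y + spd_dist y z"
proof -
  obtain g L where g: "invertible g" "transpose g = g" "L \<in> Sym"
    "x = g ** g" "z = g ** mexp L ** g" "spd_dist x z = norm L"
    using spd_pair_cases[OF x z] by metis
  define r where "r = matrix_inv g"
  have gr: "g ** r = mat 1" "r ** g = mat 1"
    using matrix_inv_mult[OF g(1)] by (auto simp: r_def)
  then have r: "invertible r" "transpose r = r"
    unfolding invertible_def using g(2) by (auto, metis matrix_mul_assoc matrix_mul_lid matrix_transpose_mul 
        transpose_mat matrix_mul_rid)
  obtain W where W: "W \<in> Sym" "r ** y ** transpose r = mexp W"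
    using SPD_cases SPD_conj[OF y r(1)] by blast
  have rx: "r ** x ** transpose r = mexp 0" "r ** z ** transpose r = mexp L"
    unfolding g(4,5) r(2) using gr by (simp_all add: matrix_mul_assoc[symmetric]) (simp add: matrix_mul_assoc)
  have "norm L \<le> norm W + norm (L - W)"
    using norm_triangle_ineq[of W "L - W"] by simp
  also have "\<dots> \<le> spd_dist (mexp 0) (mexp W) + spd_dist (mexp W) (mexp L)"
    using norm_diff_le_spd_dist[OF Sym_zero W(1)] norm_diff_le_spd_dist[OF W(1) g(3)] by simp
  also have "\<dots> = spd_dist x y + spd_dist y z"
    unfolding rx[symmetric] W(2)[symmetric] using spd_dist_conj x y z r(1) by metis
  finally show ?thesis
    using g by simp
qed

text \<open>For a pair of eigenvalues and \<open>s = b j - a i\<close> the left side is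
  \<open>s\<^sup>2 - 2 * a i * (exp s - 1 - s)\<close>, and both terms are controlled by
  \<open>exp s + exp (- s) - 2\<close>, the summand of \<open>Theta\<close>. The linear term is the
  differential of the squared norm of the logarithm.\<close>

lemma norm_sq_expansion:
  fixes A B :: "real^'n^'n"
  assumes A: "A \<in> Sym" and B: "B \<in> Sym"
  shows "\<bar>(norm B)\<^sup>2 - (norm A)\<^sup>2 - 2 * trace (A ** mexp (- A) ** (mexp B - mexp A))\<bar>
    \<le> (1 + 2 * norm A) * Theta (mexp A) (mexp B)"
proof -
  obtain U a where U: "orthogonal_matrix U" "A = spectral U a"
    using spectral_cases[OF A] by blast
  obtain W b where W: "orthogonal_matrix W" "B = spectral W b"
    using spectral_cases[OF B] by blast
  define m where "m i j = ((transpose U ** W) $ i $ j)\<^sup>2" for i j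
  have nB: "(norm B)\<^sup>2 = (\<Sum>i\<in>UNIV. \<Sum>j\<in>UNIV. (b j)\<^sup>2 * m i j)"
    using norm_spectral_diff[OF U(1) W(1), of b "\<lambda>i. 0"] by (simp add: m_def W(2))
  have nA: "(norm A)\<^sup>2 = (\<Sum>i\<in>UNIV. \<Sum>j\<in>UNIV. (a i)\<^sup>2 * m i j)"
    using norm_spectral_diff[OF U(1) W(1), of "\<lambda>i. 0" a] by (simp add: m_def U(2))
  have AA: "A ** mexp (- A) = spectral U (\<lambda>i. a i * exp (- a i))"
    by (simp add: U spectral_uminus mexp_spectral spectral_mult)
  have "trace (A ** mexp (- A) ** mexp A) = trace (A ** mat 1)"
    using mexp_minus_mult[OF A] by (metis matrix_mul_assoc)
  also have "\<dots> = (\<Sum>i\<in>UNIV. \<Sum>j\<in>UNIV. a i * m i j)"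
    unfolding spectral_one[OF W(1), symmetric] U(2) trace_spectral_mult m_def by simp
  finally have tA: "trace (A ** mexp (- A) ** mexp A) = \<dots>" .
  have tB: "trace (A ** mexp (- A) ** mexp B) = (\<Sum>i\<in>UNIV. \<Sum>j\<in>UNIV. a i * exp (- a i) * exp (b j) * m i j)"
    unfolding AA W(2) mexp_spectral[OF W(1)] trace_spectral_mult m_def by simp
  define q where "q i j = (b j)\<^sup>2 - (a i)\<^sup>2 - 2 * (a i * exp (- a i) * exp (b j) - a i)" for i j
  have "(norm B)\<^sup>2 - (norm A)\<^sup>2 - 2 * trace (A ** mexp (- A) ** (mexp B - mexp A))
     = (\<Sum>i\<in>UNIV. \<Sum>j\<in>UNIV. q i j * m i j)"
    unfolding mm.diff_right trace_sub nA nB tA tB q_def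
    by (simp add: sum_subtractf sum_distrib_left left_diff_distrib right_diff_distrib mult.assoc)
  also have "\<bar>\<dots>\<bar> \<le> (\<Sum>i\<in>UNIV. \<Sum>j\<in>UNIV. \<bar>q i j * m i j\<bar>)"
    by (rule order.trans[OF sum_abs sum_mono[OF sum_abs]])
  also have "\<dots> \<le> (\<Sum>i\<in>UNIV. \<Sum>j\<in>UNIV. (1 + 2 * norm A) * ((exp (b j - a i) + exp (a i - b j) - 2) * m i j))"
  proof (intro sum_mono)
    fix i j
    define s where "s = b j - a i"
    have "exp (- a i) * exp (b j) = exp s"
      by (simp add: s_def mult_exp_exp)
    then have "q i j = s\<^sup>2 - 2 * a i * (exp s - 1 - s)"
      unfolding q_def by (simp add: s_def mult.assoc) (simp add: power2_eq_square algebra_simps)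
    moreover have "exp s - 1 - s \<ge> 0" "exp (- s) - 1 + s \<ge> 0"
      using exp_ge_add_one_self[of s] exp_ge_add_one_self[of "- s"] by linarith+
    ultimately have "\<bar>q i j\<bar> \<le> s\<^sup>2 + 2 * \<bar>a i\<bar> * (exp s - 1 - s)"
      using abs_triangle_ineq4[of "s\<^sup>2" "2 * a i * (exp s - 1 - s)"] by (simp add: abs_mult)
    also have "\<dots> \<le> (exp s + exp (- s) - 2) + 2 * norm A * (exp s + exp (- s) - 2)"
      using sq_le_exp_plus_exp_minus[of s] abs_eigenvalue_le_norm[OF U(1), of a i]
        \<open>exp s - 1 - s \<ge> 0\<close> \<open>exp (- s) - 1 + s \<ge> 0\<close> unfolding U(2)
      by (intro add_mono mult_mono) auto
    finally have "\<bar>q i j\<bar> \<le> (1 + 2 * norm A) * (exp (b j - a i) + exp (a i - b j) - 2)"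
      by (simp add: s_def algebra_simps)
    then show "\<bar>q i j * m i j\<bar> \<le> (1 + 2 * norm A) * ((exp (b j - a i) + exp (a i - b j) - 2) * m i j)"
      unfolding abs_mult mult.assoc[symmetric] by (simp add: m_def mult_right_mono)
  qed
  also have "\<dots> = (1 + 2 * norm A) * Theta (mexp A) (mexp B)"
    unfolding U(2) W(2) Theta_mexp_spectral[OF U(1) W(1)] m_def by (simp add: sum_distrib_left)
  finally show ?thesis .
qed

lemma abs_exp_diff_le:
  fixes u v R :: real
  assumes "u \<le> R" "v \<le> R"
  shows "\<bar>exp v - exp u\<bar> \<le> exp R * \<bar>v - u\<bar>"
proof -
  have *: "exp v - exp u \<le> exp R * (v - u)" if "u \<le> v" "v \<le> R" for u v :: real
  proof -
    have "1 - exp (u - v) \<le> v - u"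
      using exp_ge_add_one_self[of "u - v"] by linarith
    then have "exp v * (1 - exp (u - v)) \<le> exp R * (v - u)"
      using that by (intro mult_mono) auto
    then show ?thesis
      by (simp add: right_diff_distrib mult_exp_exp)
  qed
  show ?thesis
    using *[of u v] *[of v u] assms by (cases "u \<le> v") auto
qed

lemma mexp_diff_le:
  fixes A B :: "real^'n^'n"
  assumes "A \<in> Sym" "B \<in> Sym" "norm A \<le> R" "norm B \<le> R"
  shows "norm (mexp B - mexp A) \<le> exp R * norm (B - A)"
proof -
  obtain U a where U: "orthogonal_matrix U" "A = spectral U a"
    using spectral_cases[OF assms(1)] by blast
  obtain W b where W: "orthogonal_matrix W" "B = spectral W b"
    using spectral_cases[OF assms(2)] by blast
  have "(exp (b j) - exp (a i))\<^sup>2 \<le> (exp R)\<^sup>2 * (b j - a i)\<^sup>2" for i j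
  proof -
    have "a i \<le> R" "b j \<le> R"
      using abs_eigenvalue_le_norm[OF U(1), of a i] abs_eigenvalue_le_norm[OF W(1), of b j] assms U W by auto
    then have "\<bar>exp (b j) - exp (a i)\<bar> \<le> \<bar>exp R * (b j - a i)\<bar>"
      using abs_exp_diff_le[of "a i" R "b j"] by (simp add: abs_mult)
    then show ?thesis
      by (metis abs_le_square_iff power_mult_distrib)
  qed
  then have "(norm (mexp B - mexp A))\<^sup>2 \<le> (exp R * norm (B - A))\<^sup>2"
    unfolding power_mult_distrib U(2) W(2) mexp_spectral[OF U(1)] mexp_spectral[OF W(1)]
      norm_spectral_diff[OF U(1) W(1)] sum_distrib_left mult.assoc[symmetric]
    by (intro sum_mono mult_right_mono) auto
  then show ?thesis
    by (simp add: power2_le_iff_abs_le)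
qed

section \<open>The geodesic distance\<close>

text \<open>The identity \<open>matrix_inv y ** (y - x) ** matrix_inv x = matrix_inv x - matrix_inv
  y\<close>; the bound \<open>1/2\<close> lets the term containing \<open>matrix_inv y\<close> be
  absorbed on the left.\<close>

lemma matrix_inv_near:
  fixes x y :: "real^'n^'n"
  assumes "invertible x" "invertible y" "norm (y - x) * norm (matrix_inv x) \<le> 1/2"
  shows "norm (matrix_inv y) \<le> 2 * norm (matrix_inv x)"
proof -
  have "matrix_inv y ** (y - x) ** matrix_inv x = matrix_inv x - matrix_inv y"
    using matrix_inv_mult[OF assms(1)] matrix_inv_mult[OF assms(2)]
    by (simp add: mm.diff_left mm.diff_right matrix_mul_assoc[symmetric])
  then have "norm (matrix_inv y) \<le> norm (matrix_inv x) + norm (matrix_inv y ** (y - x) ** matrix_inv x)"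
    using norm_triangle_ineq4[of "matrix_inv x" "matrix_inv x - matrix_inv y"] by simp
  also have "\<dots> \<le> norm (matrix_inv x) + norm (matrix_inv y) * (norm (y - x) * norm (matrix_inv x))"
    using order.trans[OF norm_matrix_mult_le mult_right_mono[OF norm_matrix_mult_le norm_ge_zero],
        of "matrix_inv y" "y - x" "matrix_inv x"] by (simp add: mult.assoc)
  also have "\<dots> \<le> norm (matrix_inv x) + norm (matrix_inv y) * (1/2)"
    using assms(3) by (intro add_left_mono mult_left_mono) auto
  finally show ?thesis
    by simp
qed

lemma Theta_near:
  fixes x y :: "real^'n^'n"
  assumes "invertible x" "invertible y" "norm (y - x) * norm (matrix_inv x) \<le> 1/2"
  shows "Theta x y \<le> 2 * (norm (matrix_inv x))\<^sup>2 * (norm (y - x))\<^sup>2"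
proof -
  have "Theta x y \<le> norm (matrix_inv x) * norm (matrix_inv y) * (norm (y - x))\<^sup>2"
    by (rule Theta_le_norm[OF assms(1,2)])
  also have "\<dots> \<le> norm (matrix_inv x) * (2 * norm (matrix_inv x)) * (norm (y - x))\<^sup>2"
    using matrix_inv_near[OF assms] by (intro mult_right_mono mult_left_mono) auto
  finally show ?thesis
    by (simp add: power2_eq_square mult_ac)
qed

text \<open>The remainder in \<open>norm_sq_expansion\<close> is a multiple of
  \<open>Theta x y\<close>, hence of second order in \<open>y - x\<close>. So the squared norm is
  differentiated without differentiating \<open>spd_log\<close>.\<close>

lemma has_derivative_norm_spd_log_sq:
  fixes x :: "real^'n^'n"
  assumes x: "x \<in> SPD"
  shows "((\<lambda>y. (norm (spd_log y))\<^sup>2) has_derivative (\<lambda>h. 2 * trace (spd_log x ** matrix_inv x ** h)))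
    (at x within SPD)"
  unfolding has_derivative_within_alt
proof (intro conjI allI impI)
  show "bounded_linear (\<lambda>h. 2 * trace (spd_log x ** matrix_inv x ** h))"
    by (rule bounded_linear_const_mult
        [OF bounded_linear_compose[OF bounded_linear_trace mm.bounded_linear_right]])
  fix e :: real assume e: "e > 0"
  define n where "n = norm (matrix_inv x)"
  define K where "K = (1 + 2 * norm (spd_log x)) * (2 * n\<^sup>2)"
  have K: "K \<ge> 0" "n \<ge> 0"
    by (auto simp: K_def n_def)
  \<comment> \<open>The first entry admits \<open>Theta_near\<close>, the second makes
    \<open>K * d \<le> e\<close>; the added ones keep the denominators positive.\<close>
  define d where "d = min (1 / (2 * (n + 1))) (e / (K + 1))"
  have d: "d > 0" "K * d \<le> e" "d * n \<le> 1/2"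
  proof -
    show "d > 0"
      using K e by (simp add: d_def)
    have "K * d \<le> K * (e / (K + 1))"
      using K by (intro mult_left_mono) (auto simp: d_def)
    also have "\<dots> \<le> e"
      using K e by (simp add: field_simps)
    finally show "K * d \<le> e" .
    have "d * n \<le> 1 / (2 * (n + 1)) * n"
      using K by (intro mult_right_mono) (auto simp: d_def)
    also have "\<dots> \<le> 1/2"
      using K by (simp add: field_simps)
    finally show "d * n \<le> 1/2" .
  qed
  show "\<exists>d>0. \<forall>y\<in>SPD. norm (y - x) < d \<longrightarrow> norm ((norm (spd_log y))\<^sup>2 - (norm (spd_log x))\<^sup>2 -
      2 * trace (spd_log x ** matrix_inv x ** (y - x))) \<le> e * norm (y - x)"
  proof (intro exI[of _ d] conjI ballI impI d(1))
    fix y assume y: "y \<in> SPD" "norm (y - x) < d"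
    have "norm (y - x) * n \<le> d * n"
      using y K by (intro mult_right_mono) auto
    then have Th: "Theta x y \<le> 2 * n\<^sup>2 * (norm (y - x))\<^sup>2"
      unfolding n_def using d(3) by (intro Theta_near invertible_SPD x y) (auto simp: n_def)
    have "norm ((norm (spd_log y))\<^sup>2 - (norm (spd_log x))\<^sup>2 -
      2 * trace (spd_log x ** matrix_inv x ** (y - x))) \<le> (1 + 2 * norm (spd_log x)) * Theta x y"
      using norm_sq_expansion[OF spd_log_Sym[OF x] spd_log_Sym[OF y(1)]] x y(1)
        matrix_inv_mexp[OF spd_log_Sym[OF x]] by simp
    also have "\<dots> \<le> K * (norm (y - x))\<^sup>2"
      unfolding K_def mult.assoc using Th by (intro mult_left_mono) (auto simp: mult.assoc)
    also have "\<dots> = K * norm (y - x) * norm (y - x)"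
      by (simp add: power2_eq_square)
    also have "\<dots> \<le> e * norm (y - x)"
    proof (rule mult_right_mono)
      have "K * norm (y - x) \<le> K * d"
        using y(2) K by (intro mult_left_mono) auto
      then show "K * norm (y - x) \<le> e"
        using d(2) by linarith
    qed simp
    finally show "norm ((norm (spd_log y))\<^sup>2 - (norm (spd_log x))\<^sup>2 -
      2 * trace (spd_log x ** matrix_inv x ** (y - x))) \<le> e * norm (y - x)" .
  qed
qed

lemma DERIV_norm_spd_log_sq:
  assumes c: "(c has_vector_derivative v) (at t within T)" and T: "t \<in> T" "c ` T \<subseteq> SPD"
  shows "((\<lambda>s. (norm (spd_log (c s)))\<^sup>2) has_real_derivative
    2 * trace (spd_log (c t) ** matrix_inv (c t) ** v)) (at t within T)"
  using vector_derivative_diff_chain_within[OF c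
      has_derivative_subset[OF has_derivative_norm_spd_log_sq T(2)]] T
  unfolding has_real_derivative_iff_has_vector_derivative o_def by blast

section \<open>Speed and length of curves\<close>

lemma ai_metric_conj:
  fixes g x v w :: "real^'n^'n"
  assumes g: "invertible g" and x: "invertible x"
  shows "ai_metric (g ** x ** transpose g) (g ** v ** transpose g) (g ** w ** transpose g) = ai_metric x v w"
proof -
  have 1: "matrix_inv g ** (g ** C) = C" for C :: "real^'n^'n"
    using matrix_inv_mult(2)[OF g] by (simp add: matrix_mul_assoc)
  have "transpose g ** transpose (matrix_inv g) = mat 1"
    using matrix_inv_mult(2)[OF g] by (metis matrix_transpose_mul transpose_mat)
  then have 2: "transpose g ** (transpose (matrix_inv g) ** C) = C" "transpose g ** transpose (matrix_inv g) = mat 1"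
    for C :: "real^'n^'n"
    by (simp_all add: matrix_mul_assoc)
  have "ai_metric (g ** x ** transpose g) (g ** v ** transpose g) (g ** w ** transpose g) =
    trace (transpose (matrix_inv g) ** (matrix_inv x ** (v ** (matrix_inv x ** (w ** transpose g)))))"
    unfolding ai_metric_def matrix_inv_conj[OF assms] by (simp add: matrix_mul_assoc[symmetric] 1 2)
  also have "\<dots> = ai_metric x v w"
    by (subst trace_mul_sym) (simp add: ai_metric_def matrix_mul_assoc[symmetric] 2)
  finally show ?thesis .
qed

lemma mexp_commute:
  assumes "L \<in> Sym"
  shows "L ** mexp (t *\<^sub>R L) = mexp (t *\<^sub>R L) ** L"
  by (rule spectral_cases[OF assms]) (simp add: spectral_scaleR mexp_spectral spectral_mult mult.commute)

text \<open>\<open>h\<close> is the inverse square root of \<open>mexp L\<close>, and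
  \<open>h ** v ** h\<close> is the tangent vector \<open>v\<close> moved to the identity, where the
  metric is the Frobenius one. In the second equation \<open>L\<close> commutes with
  \<open>h\<close>. Speed and the differential of the squared logarithm are thus expressed by one
  vector, ready for Cauchy-Schwarz.\<close>

lemma ai_metric_mexp_eq:
  fixes L v :: "real^'n^'n"
  assumes L: "L \<in> Sym" and v: "v \<in> Sym"
  defines "h \<equiv> mexp (- (1/2) *\<^sub>R L)"
  shows "ai_metric (mexp L) v v = (norm (h ** v ** h))\<^sup>2"
    and "trace (L ** matrix_inv (mexp L) ** v) = trace (L ** (h ** v ** h))"
proof -
  have h: "transpose h = h" "h ** h = mexp (- L)"
    using L mexp_mult_scaleR[of L "- (1/2)" "- (1/2)"] by (auto simp: h_def Sym_scaleR Sym_minus)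
  have v': "transpose v = v"
    using v by (simp add: Sym_def)
  have "(norm (h ** v ** h))\<^sup>2 = trace (h ** (v ** (h ** h) ** v ** h))"
    unfolding power2_norm_eq_inner inner_eq_trace by (simp add: matrix_transpose_mul h(1) v' matrix_mul_assoc)
  also have "\<dots> = trace ((v ** (h ** h) ** v ** h) ** h)"
    by (rule trace_mul_sym)
  also have "\<dots> = trace ((v ** (h ** h)) ** (v ** (h ** h)))"
    by (simp add: matrix_mul_assoc)
  also have "\<dots> = trace ((h ** h) ** (v ** (h ** h) ** v))"
    by (subst trace_mul_sym) (simp add: matrix_mul_assoc trace_mul_sym[of "v ** h ** h ** v ** h"] 
        trace_mul_sym[of "v ** h ** h ** v"])
  finally show "ai_metric (mexp L) v v = (norm (h ** v ** h))\<^sup>2"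
    by (simp add: ai_metric_def matrix_inv_mexp L h(2) matrix_mul_assoc)
  have "L ** h = h ** L"
    unfolding h_def by (rule mexp_commute[OF L])
  then have "trace (L ** (h ** v ** h)) = trace (h ** (L ** v ** h))"
    by (metis matrix_mul_assoc)
  also have "\<dots> = trace (L ** v ** h ** h)"
    by (rule trace_mul_sym)
  also have "\<dots> = trace ((h ** h) ** (L ** v))"
    by (subst trace_mul_sym[of "h ** h"]) (simp add: matrix_mul_assoc)
  also have "\<dots> = trace (L ** (h ** h) ** v)"
    using \<open>L ** h = h ** L\<close> by (metis matrix_mul_assoc)
  finally show "trace (L ** matrix_inv (mexp L) ** v) = trace (L ** (h ** v ** h))"
    by (simp add: matrix_inv_mexp L h(2))
qed

lemma ai_metric_nonneg:
  assumes "x \<in> SPD" "v \<in> Sym" shows "ai_metric x v v \<ge> 0"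
  using assms by (elim SPD_cases) (simp add: ai_metric_mexp_eq)

text \<open>Cauchy-Schwarz at the identity. Geometrically, the distance from the identity grows
  along a curve no faster than arc length.\<close>

lemma abs_trace_log_le:
  fixes x v :: "real^'n^'n"
  assumes x: "x \<in> SPD" and v: "v \<in> Sym"
  shows "\<bar>trace (spd_log x ** matrix_inv x ** v)\<bar> \<le> norm (spd_log x) * sqrt (ai_metric x v v)"
proof -
  obtain L where L: "L \<in> Sym" "x = mexp L"
    using SPD_cases[OF x] by blast
  show ?thesis
    using abs_trace_mult_le unfolding L(2) spd_log_mexp[OF L(1)] ai_metric_mexp_eq[OF L(1) v] by simp
qed

text \<open>The curve agrees with its own transpose on the interval, and derivatives within the
  interval are unique, also at its end points.\<close>

lemma vector_derivative_in_Sym: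
  fixes \<gamma> :: "real \<Rightarrow> real^'n^'n"
  assumes d: "(\<gamma> has_vector_derivative v) (at t within {0..1})" and "t \<in> {0..1}" "\<gamma> ` {0..1} \<subseteq> Sym"
  shows "v \<in> Sym"
proof -
  have "((\<lambda>s. transpose (\<gamma> s)) has_vector_derivative transpose v) (at t within {0..1})"
    by (rule bounded_linear.has_vector_derivative[OF bounded_linear_transpose d])
  moreover have eq: "\<gamma> s = transpose (\<gamma> s)" if "s \<in> {0..1}" for s
  proof -
    have "\<gamma> s \<in> Sym"
      using assms(3) that by blast
    then show ?thesis
      by (simp add: Sym_def)
  qed
  ultimately have "(\<gamma> has_vector_derivative transpose v) (at t within {0..1})"
    by (metis (no_types, lifting) assms(2) has_vector_derivative_transform)
  then have "transpose v = v"
    using vector_derivative_unique_within_closed_interval[of 0 1 t \<gamma> "transpose v" v] d assms(2)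
    unfolding box_real by simp
  then show ?thesis
    by (simp add: Sym_def)
qed

text \<open>After a congruence the curve starts at the identity, and \<open>f\<close>, the squared
  norm of its logarithm, satisfies \<open>\<bar>f'\<bar> \<le> 2 sqrt f\<close> times the speed. One
  would integrate the derivative of \<open>sqrt f\<close>, but \<open>sqrt\<close> is not
  differentiable at \<open>0\<close>, the starting value of \<open>f\<close>. So
  \<open>sqrt (f + e)\<close> is integrated and \<open>e\<close> is sent to
  \<open>0\<close>.\<close>

lemma ai_length_ge:
  fixes x y :: "real^'n^'n"
  assumes x: "x \<in> SPD" and y: "y \<in> SPD" and \<gamma>: "\<gamma> \<in> spd_curves x y"
  shows "spd_dist x y \<le> ai_length \<gamma>"
proof -
  obtain g L where g: "invertible g" "transpose g = g" "L \<in> Sym"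
    "x = g ** g" "y = g ** mexp L ** g" "spd_dist x y = norm L"
    using spd_pair_cases[OF x y] by metis
  define r where "r = matrix_inv g"
  have gr: "g ** r = mat 1" "r ** g = mat 1"
    using matrix_inv_mult[OF g(1)] by (auto simp: r_def)
  have "transpose r ** g = mat 1"
    using gr(1) g(2) by (metis matrix_transpose_mul transpose_mat)
  then have r: "invertible r" "transpose r = r"
    unfolding invertible_def using gr by (auto, metis matrix_mul_assoc matrix_mul_lid matrix_mul_rid)
  have \<gamma>SPD: "\<gamma> t \<in> SPD" if "t \<in> {0..1}" for t
    using \<gamma> that by (auto simp: spd_curves_def path_image_def)
  have \<gamma>01: "\<gamma> 0 = x" "\<gamma> 1 = y" and int: "ai_speed \<gamma> integrable_on {0..1}"
    using \<gamma> by (auto simp: spd_curves_def pathstart_def pathfinish_def)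
  obtain S D where S: "finite S" "continuous_on {0..1} \<gamma>"
    "\<And>t. t \<in> {0..1} - S \<Longrightarrow> (\<gamma> has_vector_derivative D t) (at t)"
    using \<gamma> unfolding spd_curves_def valid_path_def piecewise_C1_differentiable_on_def C1_differentiable_on_def
    by blast
  define c where "c t = r ** \<gamma> t ** r" for t
  have cSPD: "c t \<in> SPD" if "t \<in> {0..1}" for t
    using SPD_conj[OF \<gamma>SPD[OF that] r(1)] by (simp add: c_def r(2))
  have c01: "c 0 = mat 1" "c 1 = mexp L"
    unfolding c_def \<gamma>01 g(4,5) using gr by (simp_all add: matrix_mul_assoc[symmetric]) (simp add: matrix_mul_assoc)
  define f where "f t = (norm (spd_log (c t)))\<^sup>2" for t
  have f01: "f 0 = 0" "f 1 = (norm L)\<^sup>2"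
    using spd_log_mexp[OF Sym_zero] g(3) by (auto simp: f_def c01)
  have "continuous_on SPD (\<lambda>x::real^'n^'n. (norm (spd_log x))\<^sup>2)"
    using has_derivative_norm_spd_log_sq by (intro has_derivative_continuous_on)
  moreover have "continuous_on {0..1} c"
    unfolding c_def using S(2) by (intro mm.continuous_on continuous_on_const)
  ultimately have fcont: "continuous_on {0..1} f"
    unfolding f_def by (rule continuous_on_compose2) (use cSPD in auto)
  define f' where "f' t = 2 * trace (spd_log (c t) ** matrix_inv (c t) ** (r ** D t ** r))" for t
  have f': "(f has_real_derivative f' t) (at t)" if t: "t \<in> {0<..<1} - S" for t
  proof -
    have "(c has_vector_derivative r ** D t ** r) (at t)"
      unfolding c_def
      using S(3)[of t] t by (intro bounded_linear.has_vector_derivative[OF mm.bounded_linear_left]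
          bounded_linear.has_vector_derivative[OF mm.bounded_linear_right]) auto
    then have "(c has_vector_derivative r ** D t ** r) (at t within {0<..<1})"
      by (rule has_vector_derivative_at_within)
    then have "(f has_real_derivative f' t) (at t within {0<..<1})"
      unfolding f_def f'_def by (rule DERIV_norm_spd_log_sq) (use t cSPD in auto)
    then show ?thesis
      using t by (simp add: at_within_open[of t "{0<..<1}"])
  qed
  have DSym: "D t \<in> Sym" if "t \<in> {0..1} - S" for t
  proof (rule vector_derivative_in_Sym)
    show "(\<gamma> has_vector_derivative D t) (at t within {0..1})"
      by (rule has_vector_derivative_at_within[OF S(3)[OF that]])
  qed (use that \<gamma>SPD SPD_imp_Sym in blast)+
  have speed: "ai_speed \<gamma> t = sqrt (ai_metric (c t) (r ** D t ** r) (r ** D t ** r))" if "t \<in> {0..1} - S" for t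
  proof -
    have "vector_derivative \<gamma> (at t within {0..1}) = D t"
      using S(3)[OF that] that by (intro vector_derivative_at_within_ivl) auto
    then show ?thesis
      unfolding ai_speed_def Let_def c_def using ai_metric_conj[OF r(1) invertible_SPD[OF \<gamma>SPD, of t]] that r(2)
      by simp
  qed
  have f'_le: "\<bar>f' t\<bar> \<le> 2 * (norm (spd_log (c t)) * ai_speed \<gamma> t)" if "t \<in> {0..1} - S" for t
    using abs_trace_log_le[OF cSPD[of t], of "r ** D t ** r"] Sym_conj[OF DSym[OF that], of r] that r(2)
    unfolding f'_def speed[OF that] by (simp add: abs_mult)
  have main: "sqrt ((norm L)\<^sup>2 + e) \<le> ai_length \<gamma> + sqrt e" if e: "e > 0" for e
  proof -
    \<comment> \<open>The value \<open>0\<close> outside the open interval and at the break points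
      \<open>S\<close> allows a pointwise comparison on all of \<open>{0..1}\<close> with the speed
      cut off in the same way; a finite set does not change its integral.\<close>
    define h' where "h' t = (if t \<in> {0<..<1} - S then f' t / (2 * sqrt (f t + e)) else 0)" for t
    have pos: "f t + e > 0" for t
      using e by (simp add: f_def add_nonneg_pos)
    have "(h' has_integral sqrt (f 1 + e) - sqrt (f 0 + e)) {0..1}"
    proof (rule fundamental_theorem_of_calculus_interior_strong[OF S(1)])
      show "continuous_on {0..1} (\<lambda>t. sqrt (f t + e))"
        by (intro continuous_intros fcont)
      fix t assume t: "t \<in> {0<..<1} - S"
      have "((\<lambda>t. sqrt (f t + e)) has_real_derivative f' t / (2 * sqrt (f t + e))) (at t)"
        using f'[OF t] pos[of t] by (auto intro!: derivative_eq_intros simp: field_simps)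
      then show "((\<lambda>t. sqrt (f t + e)) has_vector_derivative h' t) (at t)"
        using t by (simp add: h'_def has_real_derivative_iff_has_vector_derivative)
    qed simp
    moreover have "((\<lambda>t. if t \<in> {0<..<1} - S then ai_speed \<gamma> t else 0) has_integral ai_length \<gamma>) {0..1}"
      using integrable_integral[OF int] unfolding ai_length_def
      by (rule has_integral_spike_finite[of "S \<union> {0, 1}", rotated 2]) (use S(1) in auto)
    moreover have "h' t \<le> (if t \<in> {0<..<1} - S then ai_speed \<gamma> t else 0)" for t
    proof (cases "t \<in> {0<..<1} - S")
      case True
      have "ai_speed \<gamma> t \<ge> 0"
        using speed[of t] True ai_metric_nonneg[OF cSPD[of t] Sym_conj[OF DSym[of t], of r]] by (simp add: r(2))
      moreover have "norm (spd_log (c t)) \<le> sqrt (f t + e)"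
        using e by (intro real_le_rsqrt) (simp add: f_def)
      ultimately have "norm (spd_log (c t)) * ai_speed \<gamma> t \<le> sqrt (f t + e) * ai_speed \<gamma> t"
        by (rule mult_right_mono[rotated])
      then have "f' t \<le> ai_speed \<gamma> t * (2 * sqrt (f t + e))"
        using f'_le[of t] True by (simp add: mult_ac)
      then show ?thesis
        using True pos[of t] by (simp add: h'_def pos_divide_le_eq)
    next
      case False
      then show ?thesis
        unfolding h'_def by (simp only: if_False)
    qed
    ultimately have "sqrt (f 1 + e) - sqrt (f 0 + e) \<le> ai_length \<gamma>"
      by (rule has_integral_le)
    then show ?thesis
      by (simp add: f01)
  qed
  show ?thesis
  proof (rule field_le_epsilon)
    fix e :: real assume e: "e > 0"
    have "norm L \<le> sqrt ((norm L)\<^sup>2 + e\<^sup>2)"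
      by (rule real_le_rsqrt) simp
    also have "\<dots> \<le> ai_length \<gamma> + e"
      using main[of "e\<^sup>2"] e by simp
    finally show "spd_dist x y \<le> ai_length \<gamma> + e"
      by (simp add: g(6))
  qed
qed

section \<open>Geodesics attain the distance\<close>

lemma spectral_eq_sum: "spectral U a = (\<Sum>i\<in>UNIV. a i *\<^sub>R spectral U (\<lambda>j. if j = i then 1 else 0))"
proof -
  have "(\<chi> i. a i) = (\<Sum>i\<in>UNIV. a i *\<^sub>R axis i 1)"
    using basis_expansion[of "\<chi> i. a i"] by (simp add: scalar_mult_eq_scaleR)
  then have "spectral U (\<lambda>i. (\<chi> i. a i) $ i) = (\<Sum>i\<in>UNIV. spectral U (\<lambda>j. (a i *\<^sub>R axis i 1) $ j))"
    by (simp only: linear_sum[OF bounded_linear.linear[OF bounded_linear_spectral[of U]]])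
  moreover have "spectral U (\<lambda>j. (a i *\<^sub>R axis i 1) $ j) = a i *\<^sub>R spectral U (\<lambda>j. if j = i then 1 else 0)" for i
    by (simp add: spectral_scaleR axis_def)
  ultimately show ?thesis
    by simp
qed

text \<open>Expanding in the spectral projections \<open>E i\<close> leaves scalar exponentials with
  constant matrix coefficients to differentiate.\<close>

lemma has_vector_derivative_mexp:
  fixes L :: "real^'n^'n"
  assumes "L \<in> Sym"
  shows "((\<lambda>t. mexp (t *\<^sub>R L)) has_vector_derivative L ** mexp (t *\<^sub>R L)) (at t)"
proof -
  obtain U a where U: "orthogonal_matrix U" "L = spectral U a"
    using spectral_cases[OF assms] by blast
  define E where "E i = spectral U (\<lambda>j. if j = i then 1 else 0)" for i
  have 1: "mexp (t *\<^sub>R L) = (\<Sum>i\<in>UNIV. exp (t * a i) *\<^sub>R E i)" for t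
    unfolding U(2) spectral_scaleR mexp_spectral[OF U(1)] by (subst spectral_eq_sum) (simp add: E_def)
  have 2: "L ** mexp (t *\<^sub>R L) = (\<Sum>i\<in>UNIV. (exp (t * a i) * a i) *\<^sub>R E i)"
    unfolding U(2) spectral_scaleR mexp_spectral[OF U(1)] spectral_mult[OF U(1)]
    by (subst spectral_eq_sum) (simp add: E_def mult.commute)
  show ?thesis
    unfolding 2 unfolding 1
    by (auto intro!: derivative_eq_intros simp: has_vector_derivative_def scaleR_sum_right mult_ac)
qed

text \<open>The speed is constant: congruence by \<open>g\<close> drops out, and since
  \<open>L\<close> commutes with \<open>mexp (t *\<^sub>R L)\<close> the metric evaluates to
  \<open>trace (L ** L)\<close>.\<close>

lemma geodesic_curve:
  fixes x y :: "real^'n^'n"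
  assumes x: "x \<in> SPD" and y: "y \<in> SPD"
  obtains \<gamma> where "\<gamma> \<in> spd_curves x y" "ai_length \<gamma> = spd_dist x y"
proof -
  obtain g L where g: "invertible g" "transpose g = g" "L \<in> Sym"
    "x = g ** g" "y = g ** mexp L ** g" "spd_dist x y = norm L"
    using spd_pair_cases[OF x y] by metis
  define \<gamma> where "\<gamma> t = g ** mexp (t *\<^sub>R L) ** g" for t
  define D where "D t = g ** (L ** mexp (t *\<^sub>R L)) ** g" for t
  have D: "(\<gamma> has_vector_derivative D t) (at t)" for t
    unfolding \<gamma>_def D_def
    by (intro bounded_linear.has_vector_derivative[OF mm.bounded_linear_left]
        bounded_linear.has_vector_derivative[OF mm.bounded_linear_right] has_vector_derivative_mexp g)
  have "continuous_on UNIV (\<lambda>t. mexp (t *\<^sub>R L))"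
    using has_vector_derivative_mexp[OF g(3)]
    by (intro continuous_at_imp_continuous_on) (auto intro: has_vector_derivative_continuous)
  then have "continuous_on {0..1} D"
    unfolding D_def by (intro mm.continuous_on continuous_on_const) (auto intro: continuous_on_subset)
  then have vp: "valid_path \<gamma>"
    unfolding valid_path_def using D
    by (intro C1_differentiable_imp_piecewise) (auto simp: C1_differentiable_on_def)
  have SPD: "\<gamma> t \<in> SPD" for t
    using SPD_conj[OF mexp_in_SPD g(1), of "t *\<^sub>R L"] g by (simp add: \<gamma>_def Sym_scaleR)
  have speed: "ai_speed \<gamma> t = norm L" if "t \<in> {0..1}" for t
  proof -
    define E where "E = mexp (t *\<^sub>R L)"
    have E: "invertible E" "E ** matrix_inv E = mat 1" "matrix_inv E ** E = mat 1" "L ** E = E ** L"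
      using g(3) matrix_inv_mult[of E] by (auto simp: E_def invertible_mexp Sym_scaleR mexp_commute)
    have "vector_derivative \<gamma> (at t within {0..1}) = D t"
      using D that by (intro vector_derivative_at_within_ivl) auto
    then have "ai_speed \<gamma> t = sqrt (ai_metric E (L ** E) (L ** E))"
      unfolding ai_speed_def Let_def \<gamma>_def D_def using ai_metric_conj[OF g(1) E(1)] g(2)
      by (simp add: E_def)
    also have "matrix_inv E ** (L ** E) ** matrix_inv E ** (L ** E) = L ** L"
      unfolding E(4) using E(3) by (simp add: matrix_mul_assoc) (metis E(3) matrix_mul_assoc matrix_mul_lid)
    then have "ai_metric E (L ** E) (L ** E) = (norm L)\<^sup>2"
      using g(3) by (simp add: ai_metric_def power2_norm_eq_inner inner_eq_trace Sym_def)
    finally show ?thesis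
      by simp
  qed
  have "((\<lambda>t::real. norm L) has_integral norm L) {0..1}"
    using has_integral_const_real[of "norm L" 0 1] by simp
  then have "(ai_speed \<gamma> has_integral norm L) {0..1}"
    by (rule has_integral_eq[rotated]) (simp add: speed)
  then have "ai_speed \<gamma> integrable_on {0..1}" "ai_length \<gamma> = spd_dist x y"
    unfolding ai_length_def g(6) by auto
  moreover have "pathstart \<gamma> = x" "pathfinish \<gamma> = y"
    using g by (auto simp: \<gamma>_def pathstart_def pathfinish_def)
  ultimately show thesis
    using vp SPD by (intro that[of \<gamma>]) (auto simp: spd_curves_def path_image_def)
qed

theorem ai_dist_eq_spd_dist:
  assumes x: "x \<in> SPD" and y: "y \<in> SPD"
  shows "ai_dist x y = spd_dist x y"
proof -
  obtain \<gamma> where \<gamma>: "\<gamma> \<in> spd_curves x y" "ai_length \<gamma> = spd_dist x y"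
    using geodesic_curve[OF x y] by blast
  show ?thesis
    unfolding ai_dist_def using \<gamma> ai_length_ge[OF x y]
    by (intro cInf_eq_minimum) (auto simp: image_iff intro: bexI[of _ \<gamma>])
qed

lemma is_nearest_iff:
  assumes x: "x \<in> SPD" and S: "S \<subseteq> SPD"
  shows "is_nearest S x p \<longleftrightarrow> p \<in> S \<and> (\<forall>q\<in>S. spd_dist x p \<le> spd_dist x q)"
proof (cases "p \<in> S")
  case True
  have eq: "(INF q\<in>S. ai_dist x q) = (INF q\<in>S. spd_dist x q)"
    using S by (intro INF_cong) (auto intro: ai_dist_eq_spd_dist[OF x])
  have bdd: "bdd_below (spd_dist x ` S)"
    by (rule bdd_belowI[of _ 0]) (auto simp: spd_dist_nonneg)
  have px: "ai_dist x p = spd_dist x p"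
    using S True by (intro ai_dist_eq_spd_dist[OF x]) auto
  show ?thesis
  proof
    assume "is_nearest S x p"
    then have "spd_dist x p = (INF q\<in>S. spd_dist x q)"
      by (simp add: is_nearest_def eq px)
    then show "p \<in> S \<and> (\<forall>q\<in>S. spd_dist x p \<le> spd_dist x q)"
      using True cINF_lower[OF bdd] by auto
  next
    assume "p \<in> S \<and> (\<forall>q\<in>S. spd_dist x p \<le> spd_dist x q)"
    then have "(INF q\<in>S. spd_dist x q) = spd_dist x p"
      by (intro cInf_eq_minimum) auto
    then show "is_nearest S x p"
      using True by (simp add: is_nearest_def eq px)
  qed
qed (simp add: is_nearest_def)

section \<open>Lie triple systems\<close>

text \<open>Even functions of \<open>ad Z\<close>, acting on \<open>X\<close> in the eigenbasis \<open>U\<close> of \<open>Z = spectral U a\<close>.\<close>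

definition ad_even :: "real^'n^'n \<Rightarrow> ('n \<Rightarrow> real) \<Rightarrow> (real \<Rightarrow> real) \<Rightarrow> real^'n^'n \<Rightarrow> real^'n^'n" where
  "ad_even U a c X = U ** (\<chi> i j. c ((a i - a j)\<^sup>2) * (transpose U ** X ** U) $ i $ j) ** transpose U"

lemma ad_even_entries:
  assumes "orthogonal_matrix U"
  shows "(transpose U ** ad_even U a c X ** U) $ i $ j = c ((a i - a j)\<^sup>2) * (transpose U ** X ** U) $ i $ j"
proof -
  have "transpose U ** ad_even U a c X ** U = (\<chi> i j. c ((a i - a j)\<^sup>2) * (transpose U ** X ** U) $ i $ j)"
    using assms unfolding ad_even_def by (simp add: matrix_mul_assoc[symmetric] orthogonal_matrix_mults)
  then show ?thesis
    by simp
qed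

lemma orthogonal_conj_eqI:
  fixes U X Y :: "real^'n^'n"
  assumes U: "orthogonal_matrix U"
    and eq: "\<And>i j. (transpose U ** X ** U) $ i $ j = (transpose U ** Y ** U) $ i $ j"
  shows "X = Y"
proof -
  have "transpose U ** X ** U = transpose U ** Y ** U"
    using eq by (simp add: vec_eq_iff)
  then have "U ** (transpose U ** X ** U) ** transpose U = U ** (transpose U ** Y ** U) ** transpose U"
    by simp
  then show ?thesis
    using U by (simp add: matrix_mul_assoc[symmetric] orthogonal_matrix_mults)
qed

lemma commutator_spectral_entries:
  assumes U: "orthogonal_matrix U"
  shows "(transpose U ** commutator (spectral U a) Y ** U) $ i $ j = (a i - a j) * (transpose U ** Y ** U) $ i $ j"
proof -
  have "transpose U ** commutator (spectral U a) Y ** U =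
      diag a ** (transpose U ** Y ** U) - (transpose U ** Y ** U) ** diag a"
    using U unfolding commutator_def spectral_def mm.diff_right mm.diff_left
    by (simp add: matrix_mul_assoc[symmetric] orthogonal_matrix_mults)
  then show ?thesis
    by (simp only: vector_minus_component diag_mult_left diag_mult_right) (simp add: algebra_simps)
qed

text \<open>A commutator with \<open>spectral U a\<close> multiplies the entry \<open>(i, j)\<close>
  by \<open>a i - a j\<close>, so a double commutator multiplies it by the argument of
  \<open>c\<close>. Polynomials in \<open>(ad Z)^2\<close> are built from this, one linear factor at
  a time.\<close>

lemma ad_even_shift_mult:
  assumes U: "orthogonal_matrix U"
  shows "ad_even U a (\<lambda>d. (d - s) * c d) X =
    commutator (spectral U a) (commutator (spectral U a) (ad_even U a c X)) - s *\<^sub>R ad_even U a c X"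
  by (rule orthogonal_conj_eqI[OF U])
     (simp add: mm.diff_right mm.diff_left mm.scaleR_left mm.scaleR_right ad_even_entries[OF U]
       commutator_spectral_entries[OF U] power2_eq_square algebra_simps)

lemma ad_even_one:
  assumes U: "orthogonal_matrix U"
  shows "ad_even U a (\<lambda>d. 1) X = X"
  by (rule orthogonal_conj_eqI[OF U]) (simp add: ad_even_entries[OF U])

lemma ad_even_sum:
  assumes U: "orthogonal_matrix U"
  shows "ad_even U a (\<lambda>d. \<Sum>s\<in>D. k s * c s d) X = (\<Sum>s\<in>D. k s *\<^sub>R ad_even U a (c s) X)"
  by (rule orthogonal_conj_eqI[OF U])
     (simp add: mm.sum_right mm.sum_left mm.scaleR_left mm.scaleR_right ad_even_entries[OF U]
       sum_distrib_right mult.assoc)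

lemma norm_ad_even_le:
  assumes U: "orthogonal_matrix U" and K: "\<And>i j. \<bar>c ((a i - a j)\<^sup>2)\<bar> \<le> K"
  shows "norm (ad_even U a c X) \<le> K * norm X"
proof -
  have K0: "K \<ge> 0"
    using K order.trans[OF abs_ge_zero] by blast
  have conj: "norm (transpose U ** A ** U) = norm A" for A
    using U by (simp add: norm_orthogonal_left norm_orthogonal_right orthogonal_matrix_transpose)
  have "(norm (ad_even U a c X))\<^sup>2 = (\<Sum>i\<in>UNIV. \<Sum>j\<in>UNIV. (c ((a i - a j)\<^sup>2))\<^sup>2 * ((transpose U ** X ** U) $ i $ j)\<^sup>2)"
    unfolding conj[of "ad_even U a c X", symmetric] norm_matrix_sq ad_even_entries[OF U] power_mult_distrib ..
  also have "\<dots> \<le> (\<Sum>i\<in>UNIV. \<Sum>j\<in>UNIV. K\<^sup>2 * ((transpose U ** X ** U) $ i $ j)\<^sup>2)"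
    using K K0 by (intro sum_mono mult_right_mono) (auto simp: abs_le_square_iff[symmetric])
  also have "\<dots> = (K * norm (transpose U ** X ** U))\<^sup>2"
    unfolding power_mult_distrib norm_matrix_sq by (simp add: sum_distrib_left)
  finally show ?thesis
    using K0 by (simp add: conj power2_le_iff_abs_le)
qed

locale lie_triple_system =
  fixes E :: "(real^'n^'n) set"
  assumes E: "subspace E" and E_Sym: "E \<subseteq> Sym"
    and triple: "\<And>X Y. X \<in> E \<Longrightarrow> Y \<in> E \<Longrightarrow> commutator X (commutator X Y) \<in> E"
begin

text \<open>On the finitely many values \<open>(a i - a j)\<^sup>2\<close> every function agrees with a polynomial, so
  the general case reduces to powers of \<open>(ad Z)\<^sup>2\<close>.\<close>

lemma ad_even_in:
  assumes U: "orthogonal_matrix U" and Z: "spectral U a \<in> E" and X: "X \<in> E"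
  shows "ad_even U a c X \<in> E"
proof -
  have P: "ad_even U a (\<lambda>d. \<Prod>s\<in>S. d - s) X \<in> E" if "finite S" for S
    using that
  proof induction
    case empty
    then show ?case
      using X by (simp add: ad_even_one[OF U])
  next
    case (insert s S)
    then show ?case
      using E Z triple by (simp add: ad_even_shift_mult[OF U] subspace_diff subspace_scale)
  qed
  define D where "D = (\<lambda>(i, j). (a i - a j)\<^sup>2) ` UNIV"
  have D: "finite D" "(a i - a j)\<^sup>2 \<in> D" for i j
    by (auto simp: D_def)
  \<comment> \<open>Lagrange interpolation of \<open>c\<close> at the nodes \<open>D\<close>: the
    value at a node divided by its nodal product.\<close>
  define k where "k s = c s / (\<Prod>s'\<in>D - {s}. s - s')" for s
  have interp: "(\<Sum>s\<in>D. k s * (\<Prod>s'\<in>D - {s}. d - s')) = c d" if d: "d \<in> D" for d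
  proof -
    have "(\<Sum>s\<in>D. k s * (\<Prod>s'\<in>D - {s}. d - s')) = (\<Sum>s\<in>D. if s = d then c d else 0)"
    proof (rule sum.cong[OF refl])
      fix s assume "s \<in> D"
      have "(\<Prod>s'\<in>D - {s}. d - s') = 0" if "s \<noteq> d"
        using D(1) d that by (intro prod_zero) auto
      moreover have "(\<Prod>s'\<in>D - {d}. d - s') \<noteq> 0"
        using D(1) by (simp add: prod_zero_iff)
      ultimately show "k s * (\<Prod>s'\<in>D - {s}. d - s') = (if s = d then c d else 0)"
        by (auto simp: k_def)
    qed
    then show ?thesis
      using D(1) d by simp
  qed
  have "ad_even U a c X = ad_even U a (\<lambda>d. \<Sum>s\<in>D. k s * (\<Prod>s'\<in>D - {s}. d - s')) X"
    unfolding ad_even_def by (simp add: interp[OF D(2)])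
  then show ?thesis
    using D(1) P E by (simp add: ad_even_sum[OF U] subspace_sum subspace_scale)
qed

end

text \<open>The divided difference of \<open>exp\<close> at the nodes \<open>a\<close> and
  \<open>b\<close>, as an integral along the segment between them (Hermite-Genocchi) and not as a
  quotient. Equal nodes are then no special case, and Lipschitz bounds can be taken under the
  integral.\<close>

definition exp_dd :: "real \<Rightarrow> real \<Rightarrow> real" where
  "exp_dd a b = integral {0..1} (\<lambda>t. exp (a + t * (b - a)))"

lemma has_integral_exp_dd: "((\<lambda>t. exp (a + t * (b - a))) has_integral exp_dd a b) {0..1}"
  unfolding exp_dd_def
  by (intro integrable_integral integrable_continuous_real continuous_intros)

lemma exp_dd: "(b - a) * exp_dd a b = exp b - exp a"
proof -
  have "((\<lambda>t. (b - a) * exp (a + t * (b - a))) has_integral exp (a + 1 * (b - a)) - exp (a + 0 * (b - a))) {0..1}"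
    by (rule fundamental_theorem_of_calculus)
       (auto intro!: derivative_eq_intros simp: has_real_derivative_iff_has_vector_derivative[symmetric])
  moreover have "((\<lambda>t. (b - a) * exp (a + t * (b - a))) has_integral (b - a) * exp_dd a b) {0..1}"
    by (intro has_integral_mult_right has_integral_exp_dd)
  ultimately have "exp (a + 1 * (b - a)) - exp (a + 0 * (b - a)) = (b - a) * exp_dd a b"
    by (rule has_integral_unique)
  then show ?thesis
    by simp
qed

lemma exp_dd_self: "exp_dd a a = exp a"
  by (simp add: exp_dd_def)

text \<open>\<open>a + t * (u - a)\<close> is a convex combination of \<open>a\<close> and
  \<open>u\<close>, hence at most \<open>R\<close>, and the two exponents differ by
  \<open>t * (b - c)\<close>. This Lipschitz bound in the second node makes the remainder of
  \<open>mexp_expansion\<close> quadratic.\<close>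

lemma exp_dd_diff_le:
  assumes "a \<le> R" "b \<le> R" "c \<le> R"
  shows "\<bar>exp_dd a b - exp_dd a c\<bar> \<le> exp R * \<bar>b - c\<bar>"
proof -
  have int: "((\<lambda>t. exp (a + t * (b - a)) - exp (a + t * (c - a))) has_integral exp_dd a b - exp_dd a c) {0..1}"
    by (intro has_integral_diff has_integral_exp_dd)
  have "norm (exp_dd a b - exp_dd a c) \<le> (exp R * \<bar>b - c\<bar>) * measure lborel (cbox 0 (1::real))"
  proof (rule has_integral_bound)
    fix t :: real assume "t \<in> cbox 0 1"
    then have t: "0 \<le> t" "t \<le> 1"
      by auto
    have "a + t * (u - a) \<le> R" if "u \<le> R" for u
    proof -
      have "a + t * (u - a) = (1 - t) * a + t * u"
        by (simp add: algebra_simps)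
      also have "\<dots> \<le> (1 - t) * R + t * R"
        using t assms(1) that by (intro add_mono mult_left_mono) auto
      finally show ?thesis
        by (simp add: algebra_simps)
    qed
    then have "\<bar>exp (a + t * (b - a)) - exp (a + t * (c - a))\<bar> \<le> exp R * \<bar>(a + t * (b - a)) - (a + t * (c - a))\<bar>"
      using assms by (intro abs_exp_diff_le) auto
    also have "(a + t * (b - a)) - (a + t * (c - a)) = t * (b - c)"
      by (simp add: algebra_simps)
    also have "exp R * \<bar>t * (b - c)\<bar> \<le> exp R * \<bar>b - c\<bar>"
      using t by (intro mult_left_mono) (auto simp: abs_mult intro!: mult_left_le_one_le)
    finally show "norm (exp (a + t * (b - a)) - exp (a + t * (c - a))) \<le> exp R * \<bar>b - c\<bar>"
      by simp
  qed (use int in auto)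
  then show ?thesis
    by simp
qed

text \<open>First-order expansion of the exponential: \<open>D\<close> is its derivative at \<open>Z\<close> in direction
  \<open>V\<close>, given in the eigenbasis of \<open>Z\<close> by the divided differences of \<open>exp\<close>.\<close>

lemma mexp_expansion:
  fixes V :: "real^'n^'n"
  assumes U: "orthogonal_matrix U" and V: "V \<in> Sym"
    and R: "norm (spectral U a) \<le> R" "norm (spectral U a + V) \<le> R"
    and D: "\<And>i k. (transpose U ** D ** U) $ i $ k = exp_dd (a i) (a k) * (transpose U ** V ** U) $ i $ k"
  shows "norm (mexp (spectral U a + V) - mexp (spectral U a) - D) \<le> exp R * (norm V)\<^sup>2"
proof -
  obtain W b where W: "orthogonal_matrix W" "spectral U a + V = spectral W b"
    using spectral_cases[OF Sym_add[OF spectral_in_Sym V]] by blast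
  define M where "M = transpose U ** W"
  define Y where "Y = transpose U ** V ** W"
  have MT: "W ** transpose M = U"
    using W(1) by (simp add: M_def matrix_transpose_mul matrix_mul_assoc orthogonal_matrix_mults)
  have aR: "a i \<le> R" "b i \<le> R" for i
    using abs_eigenvalue_le_norm[OF U, of a i] abs_eigenvalue_le_norm[OF W(1), of b i] R W(2) by auto
  have entries: "(transpose U ** (spectral W g - spectral U f) ** W) $ i $ j = (g j - f i) * M $ i $ j" for f g i j
  proof -
    have "transpose U ** (spectral W g - spectral U f) ** W = M ** diag g - diag f ** M"
      using U W(1) unfolding M_def spectral_def mm.diff_right mm.diff_left
      by (simp add: matrix_mul_assoc[symmetric] orthogonal_matrix_mults)
    then show ?thesis
      by (simp only: vector_minus_component diag_mult_left diag_mult_right) (simp add: algebra_simps)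
  qed
  have Y: "Y $ i $ j = (b j - a i) * M $ i $ j" for i j
    using entries[of b a i j] unfolding Y_def W(2)[symmetric] by simp
  define P where "P = transpose U ** (spectral W (\<lambda>i. exp (b i)) - spectral U (\<lambda>i. exp (a i)) - D) ** U"
  \<comment> \<open>Inserting the change of basis \<open>M\<close> lets the increment of
    \<open>mexp\<close> and the direction \<open>V\<close> both be read off from \<open>Y\<close>.
    The increment carries the multiplier \<open>exp_dd (a i) (b j)\<close> and \<open>D\<close>
    carries \<open>exp_dd (a i) (a k)\<close>, so only their difference is left.\<close>
  have P_entry: "P $ i $ k = (\<Sum>j\<in>UNIV. (exp_dd (a i) (b j) - exp_dd (a i) (a k)) * (Y $ i $ j * M $ k $ j))" for i k
  proof -
    have "(transpose U ** (spectral W (\<lambda>i. exp (b i)) - spectral U (\<lambda>i. exp (a i))) ** U) $ i $ k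
        = ((transpose U ** (spectral W (\<lambda>i. exp (b i)) - spectral U (\<lambda>i. exp (a i))) ** W) ** transpose M) $ i $ k"
      by (simp only: MT[symmetric] matrix_mul_assoc)
    also have "\<dots> = (\<Sum>j\<in>UNIV. exp_dd (a i) (b j) * (Y $ i $ j * M $ k $ j))"
    proof -
      have "transpose M $ j $ k = M $ k $ j" for j
        by (simp add: transpose_def)
      then show ?thesis
        unfolding matrix_matrix_mult_def[of _ "transpose M"]
        by (simp add: entries Y exp_dd[symmetric] mult_ac)
    qed
    finally have 1: "(transpose U ** (spectral W (\<lambda>i. exp (b i)) - spectral U (\<lambda>i. exp (a i))) ** U) $ i $ k = \<dots>" .
    have "transpose U ** V ** U = Y ** transpose M"
      by (simp only: Y_def MT[symmetric] matrix_mul_assoc)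
    then have "(transpose U ** V ** U) $ i $ k = (\<Sum>j\<in>UNIV. Y $ i $ j * M $ k $ j)"
      by (simp add: matrix_matrix_mult_def transpose_def)
    then show ?thesis
      unfolding P_def mm.diff_right[of "transpose U" _ D] mm.diff_left[of _ "transpose U ** D"]
      by (simp add: 1 D sum_subtractf sum_distrib_left left_diff_distrib)
  qed
  \<comment> \<open>The Lipschitz bound yields \<open>\<bar>b j - a k\<bar>\<close>, which together
    with \<open>M $ k $ j\<close> is again an entry of \<open>Y\<close>. The remainder is thus
    bounded by products of two entries of \<open>Y\<close>, and \<open>Y\<close> has the norm of
    \<open>V\<close>.\<close>
  have Pik: "\<bar>P $ i $ k\<bar> \<le> exp R * (norm (Y $ i) * norm (Y $ k))" for i k
  proof -
    have "\<bar>P $ i $ k\<bar> \<le> (\<Sum>j\<in>UNIV. exp R * (\<bar>Y $ i $ j\<bar> * \<bar>Y $ k $ j\<bar>))"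
      unfolding P_entry
    proof (rule order.trans[OF sum_abs sum_mono])
      fix j
      have "\<bar>exp_dd (a i) (b j) - exp_dd (a i) (a k)\<bar> * (\<bar>Y $ i $ j\<bar> * \<bar>M $ k $ j\<bar>) \<le>
          (exp R * \<bar>b j - a k\<bar>) * (\<bar>Y $ i $ j\<bar> * \<bar>M $ k $ j\<bar>)"
        using exp_dd_diff_le[OF aR(1,2,1)] by (intro mult_right_mono) auto
      then show "\<bar>(exp_dd (a i) (b j) - exp_dd (a i) (a k)) * (Y $ i $ j * M $ k $ j)\<bar>
          \<le> exp R * (\<bar>Y $ i $ j\<bar> * \<bar>Y $ k $ j\<bar>)"
        unfolding Y[of k] abs_mult by (simp add: mult_ac)
    qed
    also have "\<dots> = exp R * ((\<chi> j. \<bar>Y $ i $ j\<bar>) \<bullet> (\<chi> j. \<bar>Y $ k $ j\<bar>))"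
      by (simp add: inner_vec_def sum_distrib_left)
    also have "\<dots> \<le> exp R * (norm (\<chi> j. \<bar>Y $ i $ j\<bar>) * norm (\<chi> j. \<bar>Y $ k $ j\<bar>))"
      by (intro mult_left_mono norm_cauchy_schwarz) auto
    also have "\<dots> = exp R * (norm (Y $ i) * norm (Y $ k))"
      by (simp add: norm_vec_def)
    finally show ?thesis .
  qed
  have nY: "(norm Y)\<^sup>2 = (\<Sum>i\<in>UNIV. (norm (Y $ i))\<^sup>2)"
    unfolding power2_norm_eq_inner by (simp add: inner_vec_def)
  have "(norm P)\<^sup>2 \<le> (\<Sum>i\<in>UNIV. \<Sum>k\<in>UNIV. (exp R * (norm (Y $ i) * norm (Y $ k)))\<^sup>2)"
    unfolding norm_matrix_sq using Pik by (intro sum_mono) (simp add: abs_le_square_iff[symmetric])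
  also have "\<dots> = (exp R)\<^sup>2 * ((norm Y)\<^sup>2 * (norm Y)\<^sup>2)"
    unfolding nY power_mult_distrib sum_product by (simp add: sum_distrib_left)
  also have "\<dots> = (exp R * (norm Y)\<^sup>2)\<^sup>2"
    by (simp add: power2_eq_square)
  finally have "norm P \<le> exp R * (norm Y)\<^sup>2"
    by (simp add: power2_le_iff_abs_le)
  moreover have "norm Y = norm V"
    using U W(1) by (simp add: Y_def norm_orthogonal_left norm_orthogonal_right orthogonal_matrix_transpose)
  moreover have "norm P = norm (mexp (spectral U a + V) - mexp (spectral U a) - D)"
    using U W by (simp add: P_def mexp_spectral norm_orthogonal_left norm_orthogonal_right orthogonal_matrix_transpose)
  ultimately show ?thesis
    by simp
qed

section \<open>Taylor bounds for \<open>mexp\<close> and for congruences\<close>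

lemma spectral_diff: "spectral U a - spectral U b = spectral U (\<lambda>i. a i - b i)"
  using linear_diff[OF bounded_linear.linear[OF bounded_linear_spectral], of U "\<chi> i. a i" "\<chi> i. b i"]
  by simp

lemma norm_spectral_le:
  assumes U: "orthogonal_matrix (U::real^'n^'n)" and K: "K \<ge> 0" "\<And>i. \<bar>f i\<bar> \<le> K * \<bar>g i\<bar>"
  shows "norm (spectral U f) \<le> K * norm (spectral U g)"
proof -
  have "(f j)\<^sup>2 \<le> K\<^sup>2 * (g j)\<^sup>2" for j
    using K abs_le_square_iff[of "f j" "K * g j"] by (simp add: abs_mult power_mult_distrib)
  then have "(norm (spectral U f))\<^sup>2 \<le> (K * norm (spectral U g))\<^sup>2"
    using norm_spectral_diff[OF U U, of f "\<lambda>i. 0"] norm_spectral_diff[OF U U, of g "\<lambda>i. 0"]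
    by (simp add: power_mult_distrib sum_distrib_left mult.assoc[symmetric] sum_mono mult_right_mono)
  then show ?thesis
    using K(1) by (simp add: power2_le_iff_abs_le)
qed

lemma mexp_taylor_le:
  fixes X :: "real^'n^'n"
  assumes "X \<in> Sym"
  shows "norm (mexp X - mat 1 - X) \<le> (norm X)\<^sup>2 * exp (norm X)"
proof -
  obtain U a where U: "orthogonal_matrix U" "X = spectral U a"
    using spectral_cases[OF assms] by blast
  have "mexp X - mat 1 - X = spectral U (\<lambda>i. exp (a i) - 1 - a i)"
    by (simp add: U mexp_spectral spectral_one[OF U(1), symmetric] spectral_diff)
  also have "norm \<dots> \<le> (norm X * exp (norm X)) * norm (spectral U a)"
  proof (rule norm_spectral_le[OF U(1)])
    fix i
    \<comment> \<open>Both quantities are nonnegative, so each is at most their sum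
      \<open>exp (a i) + exp (- a i) - 2\<close>.\<close>
    have "0 \<le> exp (a i) - 1 - a i" "0 \<le> exp (- a i) - 1 + a i"
      using exp_ge_add_one_self[of "a i"] exp_ge_add_one_self[of "- a i"] by linarith+
    then have "\<bar>exp (a i) - 1 - a i\<bar> \<le> (a i)\<^sup>2 * exp \<bar>a i\<bar>"
      using exp_plus_exp_minus_le[of "a i"] by linarith
    also have "\<dots> = (\<bar>a i\<bar> * exp \<bar>a i\<bar>) * \<bar>a i\<bar>"
      by (simp add: power2_eq_square)
    also have "\<dots> \<le> (norm X * exp (norm X)) * \<bar>a i\<bar>"
      using abs_eigenvalue_le_norm[OF U(1), of a i] unfolding U(2)
      by (intro mult_right_mono mult_mono) auto
    finally show "\<bar>exp (a i) - 1 - a i\<bar> \<le> (norm X * exp (norm X)) * \<bar>a i\<bar>" .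
  qed simp
  finally show ?thesis
    by (simp add: U(2) power2_eq_square mult_ac)
qed

lemma norm_mexp_le:
  fixes Z :: "real^'n^'n"
  assumes "Z \<in> Sym" "norm Z \<le> R"
  shows "norm (mexp Z) \<le> norm (mat 1 :: real^'n^'n) + exp R * R"
proof -
  have "0 \<le> R"
    using assms(2) norm_ge_zero order.trans by blast
  then have "norm (mexp Z - mexp 0) \<le> exp R * norm (Z - 0)"
    using assms by (intro mexp_diff_le) auto
  also have "\<dots> \<le> exp R * R"
    using assms(2) by simp
  finally show ?thesis
    using norm_triangle_ineq2[of "mexp Z" "mat 1"] by simp
qed

text \<open>With \<open>mexp X = mat 1 + X + Q\<close> the remainder is
  \<open>Q ** q + A ** q ** Q + (A - mat 1) ** q ** X\<close>. The middle term brings in the bound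
  for the norm of \<open>mexp X\<close>; the other two account for the \<open>2\<close>.\<close>

lemma mexp_conj_expansion:
  fixes X q :: "real^'n^'n"
  assumes X: "X \<in> Sym" "norm X \<le> r"
  shows "norm (mexp X ** q ** mexp X - q - (X ** q + q ** X)) \<le>
    (norm (mat 1 :: real^'n^'n) + exp r * r + 2) * exp r * norm q * (norm X)\<^sup>2"
proof -
  define A where "A = mexp X"
  define Q where "Q = A - mat 1 - X"
  have r: "r \<ge> 0"
    using X(2) norm_ge_zero order.trans by blast
  have Q: "norm Q \<le> (norm X)\<^sup>2 * exp r"
  proof -
    have "norm Q \<le> (norm X)\<^sup>2 * exp (norm X)"
      unfolding Q_def A_def by (rule mexp_taylor_le[OF X(1)])
    also have "\<dots> \<le> (norm X)\<^sup>2 * exp r"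
      using X(2) by (intro mult_left_mono) auto
    finally show ?thesis .
  qed
  have A1: "norm (A - mat 1) \<le> exp r * norm X"
    using mexp_diff_le[OF Sym_zero X(1), of r] X(2) r by (simp add: A_def)
  have A: "norm A \<le> norm (mat 1 :: real^'n^'n) + exp r * r"
    unfolding A_def by (rule norm_mexp_le[OF X])
  have "A = mat 1 + X + Q"
    by (simp add: Q_def)
  then have "A ** q ** A = A ** q ** mat 1 + A ** q ** X + A ** q ** Q"
    by (metis mm.add_right)
  moreover have "A ** q = q + X ** q + Q ** q"
    by (simp add: Q_def mm.diff_left)
  moreover have "A ** q ** X = q ** X + (A - mat 1) ** q ** X"
    by (simp add: mm.diff_left)
  ultimately have "A ** q ** A - q - (X ** q + q ** X) = Q ** q + A ** q ** Q + (A - mat 1) ** q ** X"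
    by simp
  then have "norm (A ** q ** A - q - (X ** q + q ** X)) \<le> norm (Q ** q) + norm (A ** q ** Q) + norm ((A - mat 1) ** q ** X)"
    by (simp add: norm_triangle_mono norm_triangle_ineq)
  also have "norm (Q ** q) \<le> ((norm X)\<^sup>2 * exp r) * norm q"
    by (intro order.trans[OF norm_matrix_mult_le mult_right_mono] Q) auto
  also have "norm (A ** q ** Q) \<le> (norm (mat 1 :: real^'n^'n) + exp r * r) * norm q * ((norm X)\<^sup>2 * exp r)"
    using r by (intro order.trans[OF norm_matrix_mult_le mult_mono[OF order.trans[OF norm_matrix_mult_le mult_right_mono[OF A]] Q]]) auto
  also have "norm ((A - mat 1) ** q ** X) \<le> exp r * norm X * norm q * norm X"
    using r by (intro order.trans[OF norm_matrix_mult_le mult_mono[OF order.trans[OF norm_matrix_mult_le mult_right_mono[OF A1]] order.refl]]) auto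
  finally show ?thesis
    unfolding A_def by (simp add: power2_eq_square algebra_simps)
qed

text \<open>The function is \<open>s coth (s/2)\<close>, with limit \<open>2\<close> at
  \<open>0\<close>. Clearing the denominator leaves \<open>s \<le> exp s - 1\<close>.\<close>

lemma coth_even_bound:
  fixes s :: real
  assumes "s > 0"
  shows "\<bar>s * (exp s + 1) / (exp s - 1)\<bar> \<le> 2 + s"
proof -
  have "exp s - 1 \<ge> s"
    using exp_ge_add_one_self[of s] by linarith
  moreover from this have "s * (exp s + 1) \<le> (2 + s) * (exp s - 1)"
    by (simp add: ring_distribs)
  moreover have "0 \<le> s * (exp s + 1)"
    using assms by simp
  ultimately show ?thesis
    using assms by (simp add: abs_of_nonneg pos_divide_le_eq)
qed

section \<open>Invariance of \<open>exp E\<close> under congruence by its elements\<close>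

context lie_triple_system
begin

text \<open>The tangent vector \<open>X q + q X\<close> of \<open>h \<mapsto> exp (h X) q exp (h X)\<close> at \<open>q = exp Z\<close> is the image
  of \<open>V = ad Z coth (ad Z / 2) X\<close> under the derivative of \<open>exp\<close> at \<open>Z\<close>, and \<open>V\<close> stays in \<open>E\<close>
  because this function of \<open>ad Z\<close> is even.\<close>

lemma euler_step:
  assumes X: "X \<in> E" and R: "R \<ge> 0"
  obtains C where "C \<ge> 0" "\<And>Z h. Z \<in> E \<Longrightarrow> norm Z \<le> R \<Longrightarrow> 0 \<le> h \<Longrightarrow> h \<le> 1 \<Longrightarrow>
    \<exists>Z'\<in>E. spd_dist (mexp Z') (mexp (h *\<^sub>R X) ** mexp Z ** mexp (h *\<^sub>R X)) \<le> C * h\<^sup>2"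
proof -
  define x where "x = norm X"
  define B where "B r = norm (mat 1 :: real^'n^'n) + exp r * r" for r
  \<comment> \<open>Eigenvalues of \<open>Z\<close> differ by at most \<open>2 * R\<close>, so
    \<open>coth_even_bound\<close> gives the factor \<open>2 + 2 * R\<close> and \<open>v\<close>
    bounds the norm of \<open>V\<close>. \<open>C1\<close> adds the quadratic remainders of the
    expansions of \<open>mexp Z'\<close> and of \<open>A ** q ** A\<close>; \<open>C2\<close> bounds
    the product of the norms of their inverses.\<close>
  define v where "v = (2 + 2 * R) * x"
  define C1 where "C1 = exp (R + v) * v\<^sup>2 + (B x + 2) * exp x * B R * x\<^sup>2"
  define C2 where "C2 = B (R + v) * (B x * B R * B x)"
  have x0: "x \<ge> 0" "v \<ge> 0"
    using R by (auto simp: x_def v_def)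
  have B0: "B r \<ge> 0" if "r \<ge> 0" for r
    using that by (simp add: B_def)
  have C12: "C1 \<ge> 0" "C2 \<ge> 0"
    using x0 R B0 by (auto simp: C1_def C2_def)
  show thesis
  proof (rule that[of "sqrt C2 * C1"])
    show "sqrt C2 * C1 \<ge> 0"
      using C12 by simp
    fix Z h assume Z: "Z \<in> E" "norm Z \<le> R" and h: "0 \<le> h" "h \<le> (1::real)"
    have Sym: "X \<in> Sym" "Z \<in> Sym"
      using X Z E_Sym by auto
    obtain U a where U: "orthogonal_matrix U" "Z = spectral U a"
      using spectral_cases[OF Sym(2)] by blast
    \<comment> \<open>This is \<open>s coth (s/2)\<close> at \<open>s = sqrt d\<close>. Evenness in
      \<open>s\<close> makes it a function of \<open>d = (a i - a j)\<^sup>2\<close>, and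
      \<open>2\<close> is its limit at \<open>0\<close>.\<close>
    define G where "G d = (if d = 0 then 2 else sqrt d * (exp (sqrt d) + 1) / (exp (sqrt d) - 1))" for d
    define V where "V = ad_even U a G X"
    have VE: "V \<in> E"
      unfolding V_def using U Z X by (intro ad_even_in) auto
    have "\<bar>G ((a i - a j)\<^sup>2)\<bar> \<le> 2 + 2 * R" for i j
    proof -
      have "\<bar>a i - a j\<bar> \<le> 2 * R"
        using abs_eigenvalue_le_norm[OF U(1), of a i] abs_eigenvalue_le_norm[OF U(1), of a j] Z(2) U(2) by auto
      then show ?thesis
        using coth_even_bound[of "\<bar>a i - a j\<bar>"] by (auto simp: G_def)
    qed
    then have Vv: "norm V \<le> v"
      unfolding V_def v_def x_def by (rule norm_ad_even_le[OF U(1)])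
    \<comment> \<open>The factor \<open>exp s - 1\<close> in the denominator of \<open>G\<close>
      cancels against the divided difference. What remains is the factor by which passing from
      \<open>X\<close> to \<open>X ** q + q ** X\<close> multiplies the entry \<open>(i, k)\<close>
      in the eigenbasis of \<open>Z\<close>.\<close>
    have dd: "exp_dd (a i) (a k) * G ((a i - a k)\<^sup>2) = exp (a i) + exp (a k)" for i k
    proof (cases "a i = a k")
      case True
      then show ?thesis
        by (simp add: G_def exp_dd_self)
    next
      case False
      have *: "dd * (s * (exp s + 1) / (exp s - 1)) = exp p + exp q" 
        if "s > 0" "q = p + s" "s * dd = exp q - exp p" for p q s dd :: real
      proof -
        have "exp s - 1 > 0"
          using that by simp
        moreover have "s * dd * (exp s + 1) = (exp p + exp q) * (exp s - 1)"
          unfolding that(3) that(2) by (simp add: exp_add algebra_simps)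
        ultimately show ?thesis
          by (simp add: divide_eq_eq mult_ac)
      qed
      have dd: "(a k - a i) * exp_dd (a i) (a k) = exp (a k) - exp (a i)"
        by (rule exp_dd)
      show ?thesis
      proof (cases "a i < a k")
        case True
        then show ?thesis
          using *[of "a k - a i" "a k" "a i" "exp_dd (a i) (a k)"] dd by (simp add: G_def abs_if)
      next
        case False
        then show ?thesis
          using *[of "a i - a k" "a i" "a k" "exp_dd (a i) (a k)"] dd \<open>a i \<noteq> a k\<close>
          by (simp add: G_def algebra_simps)
      qed
    qed
    define q where "q = mexp Z"
    define D where "D = h *\<^sub>R (X ** q + q ** X)"
    have D: "(transpose U ** D ** U) $ i $ k = exp_dd (a i) (a k) * (transpose U ** (h *\<^sub>R V) ** U) $ i $ k" for i k
    proof -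
      have "transpose U ** (X ** q + q ** X) ** U =
        (transpose U ** X ** U) ** diag (\<lambda>i. exp (a i)) + diag (\<lambda>i. exp (a i)) ** (transpose U ** X ** U)"
        using U(1) unfolding q_def U(2) mexp_spectral[OF U(1)] unfolding spectral_def mm.add_left mm.add_right
        by (simp add: matrix_mul_assoc[symmetric] orthogonal_matrix_mults)
      then have "(transpose U ** D ** U) $ i $ k = h * ((exp (a i) + exp (a k)) * (transpose U ** X ** U) $ i $ k)"
        unfolding D_def mm.scaleR_left mm.scaleR_right
        by (simp only: vector_scaleR_component vector_add_component diag_mult_left diag_mult_right)
          (simp add: algebra_simps)
      also have "\<dots> = exp_dd (a i) (a k) * (transpose U ** (h *\<^sub>R V) ** U) $ i $ k"
        unfolding V_def mm.scaleR_left mm.scaleR_right dd[symmetric] by (simp add: ad_even_entries[OF U(1)])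
      finally show ?thesis .
    qed
    have hV: "h *\<^sub>R V \<in> Sym" "norm (h *\<^sub>R V) \<le> h * v" "h * v \<le> v"
      using VE E_Sym h Vv x0 by (auto intro!: Sym_scaleR mult_left_mono mult_left_le_one_le)
    define Z' where "Z' = Z + h *\<^sub>R V"
    have Z': "Z' \<in> E" "norm Z' \<le> R + v"
      unfolding Z'_def using Z VE E hV norm_triangle_ineq[of Z "h *\<^sub>R V"]
      by (auto simp: subspace_add subspace_scale)
    have 1: "norm (mexp Z' - q - D) \<le> exp (R + v) * v\<^sup>2 * h\<^sup>2"
    proof -
      have "norm (mexp Z' - q - D) \<le> exp (R + v) * (norm (h *\<^sub>R V))\<^sup>2"
        unfolding Z'_def q_def U(2) using D hV(1) Z(2) Z'(2) x0(2) U
        by (intro mexp_expansion[OF U(1)]) (auto simp: Z'_def)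
      also have "\<dots> \<le> exp (R + v) * (h * v)\<^sup>2"
        using hV(2) by (intro mult_left_mono power_mono) auto
      finally show ?thesis
        by (simp add: power_mult_distrib mult_ac)
    qed
    define A where "A = mexp (h *\<^sub>R X)"
    have hX: "h *\<^sub>R X \<in> Sym" "norm (h *\<^sub>R X) \<le> x"
      using Sym h by (auto simp: x_def intro!: Sym_scaleR mult_left_le_one_le)
    have 2: "norm (A ** q ** A - q - D) \<le> (B x + 2) * exp x * B R * x\<^sup>2 * h\<^sup>2"
    proof -
      have "norm (A ** q ** A - q - (h *\<^sub>R X ** q + q ** (h *\<^sub>R X))) \<le> (B x + 2) * exp x * norm q * (norm (h *\<^sub>R X))\<^sup>2"
        unfolding A_def B_def by (rule mexp_conj_expansion[OF hX])
      also have "\<dots> = (B x + 2) * exp x * norm q * (x\<^sup>2 * h\<^sup>2)"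
        using h by (simp add: x_def power_mult_distrib mult_ac)
      also have "\<dots> \<le> (B x + 2) * exp x * B R * (x\<^sup>2 * h\<^sup>2)"
        using norm_mexp_le[OF Sym(2) Z(2)] B0[OF x0(1)] unfolding q_def B_def[of R]
        by (intro mult_right_mono mult_left_mono) auto
      finally show ?thesis
        by (simp add: D_def mm.scaleR_left mm.scaleR_right scaleR_add_right mult.assoc)
    qed
    have "mexp Z' - A ** q ** A = (mexp Z' - q - D) - (A ** q ** A - q - D)"
      by simp
    then have diff: "norm (A ** q ** A - mexp Z') \<le> C1 * h\<^sup>2"
      using 1 2 norm_triangle_ineq4[of "mexp Z' - q - D" "A ** q ** A - q - D"]
      by (simp add: C1_def norm_minus_commute algebra_simps)
    have A: "invertible A" "transpose A = A" "q \<in> SPD" "mexp Z' \<in> SPD"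
      using hX Z' Sym E_Sym by (auto simp: A_def q_def invertible_mexp mexp_in_SPD)
    have AqA: "A ** q ** A \<in> SPD"
      using SPD_conj[OF A(3,1)] A(2) by simp
    have i1: "norm (matrix_inv (mexp Z')) \<le> B (R + v)"
      using Z' E_Sym norm_mexp_le[of "- Z'"] by (auto simp: matrix_inv_mexp B_def Sym_minus)
    have i2: "norm (matrix_inv (A ** q ** A)) \<le> B x * B R * B x"
    proof -
      have "matrix_inv (A ** q ** A) = mexp (- (h *\<^sub>R X)) ** mexp (- Z) ** mexp (- (h *\<^sub>R X))"
        using matrix_inv_conj[OF A(1) invertible_SPD[OF A(3)]] A(2) hX(1) Sym(2)
        by (simp add: A_def q_def matrix_inv_mexp Sym_minus)
      moreover have "norm (mexp (- (h *\<^sub>R X))) \<le> B x" "norm (mexp (- Z)) \<le> B R"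
        unfolding B_def using hX Sym Z by (auto intro!: norm_mexp_le)
      ultimately have "norm (matrix_inv (A ** q ** A)) \<le>
          norm (mexp (- (h *\<^sub>R X)) ** mexp (- Z)) * norm (mexp (- (h *\<^sub>R X)))"
        "norm (mexp (- (h *\<^sub>R X)) ** mexp (- Z)) \<le> B x * B R"
        using norm_matrix_mult_le mult_mono[OF \<open>norm (mexp (- (h *\<^sub>R X))) \<le> B x\<close> \<open>norm (mexp (- Z)) \<le> B R\<close>
            B0[OF x0(1)] norm_ge_zero] by (auto intro: order_trans)
      then show ?thesis
        using mult_mono[OF _ \<open>norm (mexp (- (h *\<^sub>R X))) \<le> B x\<close>, of _ "B x * B R"] B0[OF x0(1)] B0[OF R]
        by (meson mult_nonneg_nonneg norm_ge_zero order_trans)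
    qed
    \<comment> \<open>A norm error of order \<open>h\<^sup>2\<close> makes \<open>Theta\<close> of
      order \<open>h^4\<close>, hence the error in \<open>spd_dist\<close> of order
      \<open>h\<^sup>2\<close>.\<close>
    have "(spd_dist (mexp Z') (A ** q ** A))\<^sup>2 \<le> Theta (mexp Z') (A ** q ** A)"
      by (rule spd_dist_sq_le_Theta[OF A(4) AqA])
    also have "\<dots> \<le> norm (matrix_inv (mexp Z')) * norm (matrix_inv (A ** q ** A)) * (norm (A ** q ** A - mexp Z'))\<^sup>2"
      by (intro Theta_le_norm invertible_SPD A(4) AqA)
    also have "\<dots> \<le> C2 * (C1 * h\<^sup>2)\<^sup>2"
      unfolding C2_def using i1 i2 diff x0 R B0 by (intro mult_mono power_mono) auto
    also have "\<dots> = (sqrt C2 * C1 * h\<^sup>2)\<^sup>2"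
      using C12 by (simp add: power_mult_distrib)
    finally have "spd_dist (mexp Z') (A ** q ** A) \<le> sqrt C2 * C1 * h\<^sup>2"
      using C12 by (simp add: power2_le_iff_abs_le)
    then show "\<exists>Z'\<in>E. spd_dist (mexp Z') (mexp (h *\<^sub>R X) ** mexp Z ** mexp (h *\<^sub>R X)) \<le> sqrt C2 * C1 * h\<^sup>2"
      using Z'(1) unfolding A_def q_def by blast
  qed
qed

text \<open>The errors of \<open>N\<close> Euler steps add up to \<open>O(1/N)\<close>, since congruences are isometries.\<close>

theorem mexp_conj_in:
  assumes X: "X \<in> E" and Y: "Y \<in> E"
  shows "mexp X ** mexp Y ** mexp X \<in> mexp ` E"
proof -
  have Sym: "X \<in> Sym" "Y \<in> Sym"
    using X Y E_Sym by auto
  \<comment> \<open>\<open>2 * norm X + norm Y\<close> bounds the logarithms along the exact curve,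
    and \<open>1\<close> leaves room for the accumulated error of the Euler steps.\<close>
  define R where "R = 2 * norm X + norm Y + 1"
  have "R \<ge> 0"
    by (simp add: R_def)
  then obtain C where C: "C \<ge> 0" "\<And>Z h. Z \<in> E \<Longrightarrow> norm Z \<le> R \<Longrightarrow> 0 \<le> h \<Longrightarrow> h \<le> 1 \<Longrightarrow>
    \<exists>Z'\<in>E. spd_dist (mexp Z') (mexp (h *\<^sub>R X) ** mexp Z ** mexp (h *\<^sub>R X)) \<le> C * h\<^sup>2"
    using euler_step[OF X] by blast
  define c where "c t = mexp (t *\<^sub>R X) ** mexp Y ** mexp (t *\<^sub>R X)" for t
  have tX: "t *\<^sub>R X \<in> Sym" "invertible (mexp (t *\<^sub>R X))" "transpose (mexp (t *\<^sub>R X)) = mexp (t *\<^sub>R X)" for t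
    using Sym by (auto simp: Sym_scaleR invertible_mexp)
  have cSPD: "c t \<in> SPD" for t
    using SPD_conj[OF mexp_in_SPD[OF Sym(2)] tX(2)] tX(3) by (simp add: c_def)
  have c_add: "mexp (s *\<^sub>R X) ** c t ** mexp (s *\<^sub>R X) = c (t + s)" for s t
  proof -
    have "mexp (s *\<^sub>R X) ** c t ** mexp (s *\<^sub>R X) =
        (mexp (s *\<^sub>R X) ** mexp (t *\<^sub>R X)) ** mexp Y ** (mexp (t *\<^sub>R X) ** mexp (s *\<^sub>R X))"
      by (simp only: c_def matrix_mul_assoc)
    then show ?thesis
      unfolding mexp_mult_scaleR[OF Sym(1)] by (simp add: c_def add.commute)
  qed
  \<comment> \<open>Congruence by \<open>mexp (t *\<^sub>R X)\<close> takes
    \<open>mexp ((- 2 * t) *\<^sub>R X)\<close> to the identity and \<open>mexp Y\<close> to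
    \<open>c t\<close>; the triangle inequality through the identity bounds the distance of the
    original two points.\<close>
  have log_c: "norm (spd_log (c t)) \<le> 2 * norm X + norm Y" if t: "0 \<le> t" "t \<le> 1" for t
  proof -
    have "mexp (t *\<^sub>R X) ** mexp ((- 2 * t) *\<^sub>R X) ** mexp (t *\<^sub>R X) = mat 1"
      unfolding mexp_mult_scaleR[OF Sym(1)] by simp
    then have "norm (spd_log (c t)) = spd_dist (mexp ((- 2 * t) *\<^sub>R X)) (mexp Y)"
      using spd_dist_conj[OF mexp_in_SPD[OF tX(1)] mexp_in_SPD[OF Sym(2)] tX(2), of t "- 2 * t"] tX(3)
      unfolding spd_dist_one[OF cSPD, symmetric] by (simp add: c_def)
    also have "\<dots> \<le> spd_dist (mexp ((- 2 * t) *\<^sub>R X)) (mat 1) + spd_dist (mat 1) (mexp Y)"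
      by (intro spd_dist_triangle mexp_in_SPD tX Sym mat_1_SPD)
    also have "\<dots> = 2 * t * norm X + norm Y"
      using t spd_dist_commute[OF mat_1_SPD mexp_in_SPD[OF tX(1)]]
      by (simp only: spd_dist_one_mexp[OF tX(1)] spd_dist_one_mexp[OF Sym(2)]) simp
    also have "\<dots> \<le> 2 * norm X + norm Y"
      using t by (simp add: mult_left_le_one_le)
    finally show ?thesis .
  qed
  \<comment> \<open>The condition \<open>C \<le> real N\<close> keeps the accumulated error at most
    \<open>1\<close> during all \<open>N\<close> steps, so the approximants stay in the ball of
    radius \<open>R\<close> for which \<open>C\<close> was obtained.\<close>
  have approx: "\<exists>Z\<in>E. norm (Z - spd_log (c 1)) \<le> C / real N" if N: "N \<noteq> 0" "C \<le> real N" for N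
  proof -
    have "\<exists>Z\<in>E. spd_dist (mexp Z) (c (real k / real N)) \<le> real k * (C / (real N)\<^sup>2)" if "k \<le> N" for k
      using that
    proof (induction k)
      case 0
      then show ?case
        using Y Sym by (intro bexI[of _ Y]) (auto simp: c_def spd_dist_self mexp_in_SPD)
    next
      case (Suc k)
      then obtain Z where Z: "Z \<in> E" "spd_dist (mexp Z) (c (real k / real N)) \<le> real k * (C / (real N)\<^sup>2)"
        by auto
      have ZS: "Z \<in> Sym"
        using Z E_Sym by blast
      have k01: "0 \<le> real k / real N" "real k / real N \<le> 1"
        using Suc.prems N by auto
      have "real k * (C / (real N)\<^sup>2) \<le> real N * (real N / (real N)\<^sup>2)"
        using Suc.prems N C(1) by (intro mult_mono divide_right_mono) auto
      also have "\<dots> = 1"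
        using N by (simp add: power2_eq_square)
      finally have "spd_dist (mexp Z) (c (real k / real N)) \<le> 1"
        using Z(2) by linarith
      moreover have "norm (spd_log (c (real k / real N)) - Z) \<le> spd_dist (mexp Z) (c (real k / real N))"
        using norm_diff_le_spd_dist[OF ZS spd_log_Sym[OF cSPD]] by (simp add: cSPD)
      ultimately have "norm Z \<le> R"
        using log_c[OF k01] norm_triangle_ineq4[of "spd_log (c (real k / real N))" "spd_log (c (real k / real N)) - Z"]
        unfolding R_def by simp
      define h where "h = 1 / real N"
      have h: "0 \<le> h" "h \<le> 1"
        using N by (auto simp: h_def)
      obtain Z' where Z': "Z' \<in> E" "spd_dist (mexp Z') (mexp (h *\<^sub>R X) ** mexp Z ** mexp (h *\<^sub>R X)) \<le> C * h\<^sup>2"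
        using C(2)[OF Z(1) \<open>norm Z \<le> R\<close> h] by blast
      have cs: "c (real (Suc k) / real N) = mexp (h *\<^sub>R X) ** c (real k / real N) ** mexp (h *\<^sub>R X)"
        unfolding c_add h_def by (simp add: add_divide_distrib add.commute)
      have "spd_dist (mexp (h *\<^sub>R X) ** mexp Z ** mexp (h *\<^sub>R X)) (c (real (Suc k) / real N)) = spd_dist (mexp Z) (c (real k / real N))"
        unfolding cs using spd_dist_conj[OF mexp_in_SPD[OF ZS] cSPD tX(2)] tX(3) by metis
      moreover have "mexp (h *\<^sub>R X) ** mexp Z ** mexp (h *\<^sub>R X) \<in> SPD"
        using SPD_conj[OF mexp_in_SPD[OF ZS] tX(2)] tX(3) by metis
      moreover have "mexp Z' \<in> SPD"
        using Z'(1) E_Sym by (intro mexp_in_SPD) blast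
      ultimately have "spd_dist (mexp Z') (c (real (Suc k) / real N)) \<le> C * h\<^sup>2 + real k * (C / (real N)\<^sup>2)"
        using spd_dist_triangle[OF _ _ cSPD] Z'(2) Z(2) by (smt (verit, best))
      also have "\<dots> = real (Suc k) * (C / (real N)\<^sup>2)"
        by (simp add: h_def power_divide add_divide_distrib algebra_simps)
      finally show ?case
        using Z'(1) by blast
    qed
    from this[of N] obtain Z where Z: "Z \<in> E" "spd_dist (mexp Z) (c 1) \<le> C / real N"
      using N by (auto simp: power2_eq_square)
    then have "Z \<in> Sym"
      using E_Sym by blast
    then have "norm (spd_log (c 1) - Z) \<le> C / real N"
      using norm_diff_le_spd_dist[OF _ spd_log_Sym[OF cSPD], of Z 1] Z(2) by (simp add: cSPD)
    then show ?thesis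
      using Z(1) by (auto simp: norm_minus_commute)
  qed
  \<comment> \<open>The steps only give approximation by elements of \<open>E\<close>; a subspace of
    a finite-dimensional space is closed, so the limit belongs to it.\<close>
  have "spd_log (c 1) \<in> closure E"
    unfolding closure_approachable dist_norm
  proof (intro allI impI)
    fix e :: real assume e: "e > 0"
    obtain N :: nat where "real N > max C (C / e)"
      using reals_Archimedean2 by blast
    then have N: "real N > C" "real N * e > C"
      using e by (auto simp: pos_divide_less_eq)
    then have "N \<noteq> 0"
      using C(1) by auto
    then obtain Z where "Z \<in> E" "norm (Z - spd_log (c 1)) \<le> C / real N"
      using approx[of N] N by auto
    moreover have "C / real N < e"
      using N \<open>N \<noteq> 0\<close> by (simp add: pos_divide_less_eq mult.commute)
    ultimately show "\<exists>Z\<in>E. norm (Z - spd_log (c 1)) < e"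
      by (intro bexI[of _ Z]) auto
  qed
  then have "spd_log (c 1) \<in> E"
    using closed_subspace[OF E] by simp
  then show ?thesis
    using mexp_spd_log[OF cSPD[of 1]] by (intro image_eqI[of _ _ "spd_log (c 1)"]) (auto simp: c_def)
qed

end

section \<open>Projection and decomposition\<close>

lemma continuous_on_mexp: "continuous_on Sym (mexp :: real^'n^'n \<Rightarrow> real^'n^'n)"
  unfolding continuous_on_def
proof
  fix A :: "real^'n^'n" assume A: "A \<in> Sym"
  define K where "K = exp (norm A + 1)"
  have "eventually (\<lambda>B. B \<in> Sym \<and> dist B A < 1) (at A within Sym)"
    using eventually_at_ball'[of 1 A Sym] by (rule eventually_mono) (auto simp: dist_commute)
  then have "eventually (\<lambda>B. norm (mexp B - mexp A) \<le> K * norm (B - A)) (at A within Sym)"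
  proof (rule eventually_mono)
    fix B assume B: "B \<in> Sym \<and> dist B A < 1"
    then have "norm B \<le> norm A + 1"
      using norm_triangle_ineq2[of B A] by (simp add: dist_norm)
    then show "norm (mexp B - mexp A) \<le> K * norm (B - A)"
      unfolding K_def using A B by (intro mexp_diff_le) auto
  qed
  moreover have "((\<lambda>B. K * norm (B - A)) \<longlongrightarrow> K * norm (A - A)) (at A within Sym)"
    by (intro tendsto_intros)
  ultimately have "((\<lambda>B. mexp B - mexp A) \<longlongrightarrow> 0) (at A within Sym)"
    by (rule_tac Lim_null_comparison[where g = "\<lambda>B. K * norm (B - A)"]) simp_all
  then show "(mexp \<longlongrightarrow> mexp A) (at A within Sym)"
    by (simp add: LIM_zero_iff)
qed

text \<open>Differentiability of the squared norm of \<open>spd_log\<close> gives continuity after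
  the congruence by \<open>r\<close>, and the square root removes the square.\<close>

lemma continuous_on_spd_dist:
  fixes x :: "real^'n^'n"
  assumes "x \<in> SPD"
  shows "continuous_on SPD (spd_dist x)"
proof -
  obtain X where X: "X \<in> Sym" "x = mexp X"
    using SPD_cases[OF assms] by blast
  define r where "r = matrix_inv (spd_sqrt x)"
  have "r = mexp (- ((1/2) *\<^sub>R X))"
    unfolding r_def X(2) spd_sqrt_mexp[OF X(1)] using X(1) by (intro matrix_inv_mexp Sym_scaleR)
  then have r: "invertible r" "transpose r = r"
    using X(1) by (auto simp: invertible_mexp Sym_minus Sym_scaleR)
  have "continuous_on SPD (\<lambda>y::real^'n^'n. (norm (spd_log y))\<^sup>2)"
    using has_derivative_norm_spd_log_sq by (intro has_derivative_continuous_on)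
  moreover have "continuous_on SPD (\<lambda>y. r ** y ** r)"
    by (intro mm.continuous_on continuous_on_const continuous_on_id)
  ultimately have "continuous_on SPD (\<lambda>y. (norm (spd_log (r ** y ** r)))\<^sup>2)"
    by (rule continuous_on_compose2) (use SPD_conj[OF _ r(1)] r(2) in auto)
  then have "continuous_on SPD (\<lambda>y. sqrt ((norm (spd_log (r ** y ** r)))\<^sup>2))"
    by (rule continuous_on_real_sqrt)
  then show ?thesis
    unfolding spd_dist_def r_def[symmetric] by simp
qed

lemma has_vector_derivative_mexp_conj:
  fixes Y x :: "real^'n^'n"
  assumes Y: "Y \<in> Sym"
  shows "((\<lambda>t. mexp (t *\<^sub>R Y) ** x ** mexp (t *\<^sub>R Y)) has_vector_derivative Y ** x + x ** Y) (at 0)"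
proof -
  have E: "((\<lambda>t. mexp (t *\<^sub>R Y)) has_derivative (\<lambda>h. h *\<^sub>R Y)) (at 0)"
    using has_vector_derivative_mexp[OF Y, of 0] by (simp add: has_vector_derivative_def)
  then have "((\<lambda>t. mexp (t *\<^sub>R Y) ** x) has_derivative (\<lambda>h. (h *\<^sub>R Y) ** x)) (at 0)"
    by (rule bounded_linear.has_derivative[OF mm.bounded_linear_left])
  from mm.FDERIV[OF this E] show ?thesis
    by (simp add: has_vector_derivative_def mm.scaleR_left mm.scaleR_right scaleR_add_right add.commute)
qed

section \<open>Nearest points of \<open>exp E\<close> and the decomposition\<close>

context lie_triple_system
begin

lemma F_Sym: "perp_in_Sym E \<subseteq> Sym"
  by (auto simp: perp_in_Sym_def)

lemma mexp_E_SPD: "mexp ` E \<subseteq> SPD"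
  using E_Sym mexp_in_SPD by blast

lemma E_scale: "X \<in> E \<Longrightarrow> r *\<^sub>R X \<in> E" "X \<in> E \<Longrightarrow> - X \<in> E"
  using E by (auto simp: subspace_scale subspace_neg)

lemma spd_dist_mexp_conj:
  assumes "X \<in> Sym" "x \<in> SPD" "y \<in> SPD"
  shows "spd_dist (mexp X ** x ** mexp X) (mexp X ** y ** mexp X) = spd_dist x y"
    and "mexp X ** x ** mexp X \<in> SPD"
  using spd_dist_conj[OF assms(2,3) invertible_mexp[OF assms(1)]]
    SPD_conj[OF assms(2) invertible_mexp[OF assms(1)]] assms(1) by auto

lemma mexp_conj_cancel:
  assumes "X \<in> Sym"
  shows "mexp (- X) ** (mexp X ** x ** mexp X) ** mexp (- X) = x"
    and "mexp X ** (mexp (- X) ** x ** mexp (- X)) ** mexp X = x"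
  using mexp_mult_minus[OF assms] mexp_minus_mult[OF assms]
  by (metis matrix_mul_assoc matrix_mul_lid matrix_mul_rid)+

lemma orthogonal_E_F:
  assumes "L \<in> perp_in_Sym E" "Y \<in> E"
  shows "(norm L)\<^sup>2 + (norm Y)\<^sup>2 \<le> (spd_dist (mexp L) (mexp Y))\<^sup>2"
proof -
  have "L \<bullet> Y = 0"
    using assms by (auto simp: perp_in_Sym_def inner_eq_trace Sym_def)
  then have "(norm L)\<^sup>2 + (norm Y)\<^sup>2 = (norm (Y - L))\<^sup>2"
    by (simp add: power2_norm_eq_inner inner_diff_left inner_diff_right inner_commute)
  also have "\<dots> \<le> (spd_dist (mexp L) (mexp Y))\<^sup>2"
    using assms E_Sym F_Sym by (intro power_mono norm_diff_le_spd_dist) auto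
  finally show ?thesis .
qed

text \<open>Congruence by \<open>mexp (- X)\<close> moves \<open>mexp (2 *\<^sub>R X)\<close> to the
  identity, \<open>x\<close> to \<open>mexp L\<close> and, by \<open>mexp_conj_in\<close>,
  \<open>q\<close> to some \<open>mexp Y\<close> with \<open>Y\<close> in \<open>E\<close>.
  Distances from the identity are norms, and \<open>orthogonal_E_F\<close> applies.\<close>

lemma pythagoras:
  assumes X: "X \<in> E" and L: "L \<in> perp_in_Sym E" and q: "q \<in> mexp ` E"
    and x: "x = mexp X ** mexp L ** mexp X"
  shows "(spd_dist x (mexp (2 *\<^sub>R X)))\<^sup>2 + (spd_dist (mexp (2 *\<^sub>R X)) q)\<^sup>2 \<le> (spd_dist x q)\<^sup>2"
proof -
  have Sym: "X \<in> Sym" "L \<in> Sym" "- X \<in> Sym"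
    using X L E_Sym F_Sym by auto
  obtain Y where Y: "Y \<in> E" "mexp (- X) ** q ** mexp (- X) = mexp Y"
    using q mexp_conj_in[OF E_scale(2)[OF X]] by auto
  have YS: "Y \<in> Sym"
    using Y E_Sym by auto
  have qY: "q = mexp X ** mexp Y ** mexp X"
    unfolding Y(2)[symmetric] by (rule mexp_conj_cancel(2)[OF Sym(1), symmetric])
  have p: "mexp (2 *\<^sub>R X) = mexp X ** mat 1 ** mexp X"
    using mexp_mult_scaleR[OF Sym(1), of 1 1] by simp
  have "spd_dist x (mexp (2 *\<^sub>R X)) = norm L"
    unfolding x p spd_dist_mexp_conj(1)[OF Sym(1) mexp_in_SPD[OF Sym(2)] mat_1_SPD]
    using spd_dist_commute[OF mat_1_SPD mexp_in_SPD[OF Sym(2)]] spd_dist_one_mexp[OF Sym(2)] by simp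
  moreover have "spd_dist (mexp (2 *\<^sub>R X)) q = norm Y"
    unfolding qY p spd_dist_mexp_conj(1)[OF Sym(1) mat_1_SPD mexp_in_SPD[OF YS]]
    by (rule spd_dist_one_mexp[OF YS])
  moreover have "spd_dist x q = spd_dist (mexp L) (mexp Y)"
    unfolding qY x by (rule spd_dist_mexp_conj(1)[OF Sym(1) mexp_in_SPD[OF Sym(2)] mexp_in_SPD[OF YS]])
  ultimately show ?thesis
    using orthogonal_E_F[OF L Y(1)] by simp
qed

lemma minimizer_exists:
  assumes x: "x \<in> SPD"
  obtains Z where "Z \<in> E" "\<And>q. q \<in> mexp ` E \<Longrightarrow> spd_dist x (mexp Z) \<le> spd_dist x q"
proof -
  \<comment> \<open>If \<open>norm W > r\<close>, then \<open>W\<close> is farther from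
    \<open>spd_log x\<close> than \<open>0\<close> is, so \<open>mexp W\<close> cannot be closer to
    \<open>x\<close> than the identity, the image of \<open>0\<close>. Minimising over the compact
    set \<open>K\<close> is therefore enough.\<close>
  define r where "r = 2 * norm (spd_log x)"
  define K where "K = E \<inter> cball 0 r"
  have K: "compact K" "0 \<in> K"
    using closed_subspace[OF E] subspace_0[OF E] by (auto simp: K_def r_def closed_Int_compact)
  have "continuous_on E mexp"
    using continuous_on_mexp E_Sym continuous_on_subset by blast
  then have "continuous_on E (\<lambda>Z. spd_dist x (mexp Z))"
    using continuous_on_compose2[OF continuous_on_spd_dist[OF x]] mexp_E_SPD by blast
  then have "continuous_on K (\<lambda>Z. spd_dist x (mexp Z))"
    by (rule continuous_on_subset) (simp add: K_def)
  then obtain Z where Z: "Z \<in> K" "\<And>W. W \<in> K \<Longrightarrow> spd_dist x (mexp Z) \<le> spd_dist x (mexp W)"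
    using continuous_attains_inf[OF K(1)] K(2) by blast
  have "spd_dist x (mexp Z) \<le> spd_dist x (mexp W)" if W: "W \<in> E" for W
  proof (cases "W \<in> K")
    case False
    then have "norm W > r"
      using W by (simp add: K_def)
    have WS: "W \<in> Sym"
      using W E_Sym by auto
    have "spd_dist x (mexp Z) \<le> spd_dist x (mat 1)"
      using Z(2)[OF K(2)] by simp
    also have "\<dots> = norm (spd_log x)"
      using spd_dist_commute[OF mat_1_SPD x] spd_dist_one[OF x] by simp
    also have "\<dots> \<le> norm (W - spd_log x)"
      using \<open>norm W > r\<close> norm_triangle_ineq2[of W "spd_log x"] by (simp add: r_def)
    also have "\<dots> \<le> spd_dist x (mexp W)"
      using norm_diff_le_spd_dist[OF spd_log_Sym[OF x] WS] x by simp
    finally show ?thesis .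
  qed (rule Z(2))
  then show thesis
    using Z(1) by (intro that[of Z]) (auto simp: K_def)
qed

lemma decomposition_exists:
  assumes x: "x \<in> SPD"
  obtains X L where "X \<in> E" "L \<in> perp_in_Sym E" "x = mexp X ** mexp L ** mexp X"
proof -
  obtain Z where Z: "Z \<in> E" "\<And>q. q \<in> mexp ` E \<Longrightarrow> spd_dist x (mexp Z) \<le> spd_dist x q"
    using minimizer_exists[OF x] by blast
  define X where "X = (1/2) *\<^sub>R Z"
  have X: "X \<in> E" "- X \<in> E" "X \<in> Sym" "- X \<in> Sym"
    using Z(1) E_scale E_Sym by (auto simp: X_def)
  have ZX: "mexp Z = mexp X ** mat 1 ** mexp X"
    using mexp_half_sq[of Z] Z(1) E_Sym by (auto simp: X_def)
  define y where "y = mexp (- X) ** x ** mexp (- X)"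
  have y: "y \<in> SPD" "x = mexp X ** y ** mexp X"
    using spd_dist_mexp_conj(2)[OF X(4) x x] mexp_conj_cancel(2)[OF X(3)] by (simp_all add: y_def)
  define L where "L = spd_log y"
  have L: "L \<in> Sym" "y = mexp L"
    using y(1) by (simp_all add: L_def spd_log_Sym)
  have min: "spd_dist y (mat 1) \<le> spd_dist y q" if q: "q \<in> mexp ` E" for q
  proof -
    have "mexp X ** q ** mexp X \<in> mexp ` E"
      using q mexp_conj_in[OF X(1)] by auto
    then have "spd_dist x (mexp Z) \<le> spd_dist x (mexp X ** q ** mexp X)"
      by (rule Z(2))
    then show ?thesis
      unfolding y(2) ZX using spd_dist_mexp_conj(1)[OF X(3) y(1)] q mexp_E_SPD by (metis mat_1_SPD subsetD)
  qed
  have "trace (L ** Y) = 0" if Y: "Y \<in> E" for Y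
  proof -
    have YS: "t *\<^sub>R Y \<in> Sym" "t *\<^sub>R Y \<in> E" for t
      using Y E_Sym E_scale by auto
    \<comment> \<open>The derivative is available only for the distance from the identity. So the
      competitor \<open>mexp ((- 2 * t) *\<^sub>R Y)\<close> is moved to the identity, and the same
      congruence carries \<open>y\<close> to \<open>c t\<close>.\<close>
    define c where "c t = mexp (t *\<^sub>R Y) ** y ** mexp (t *\<^sub>R Y)" for t
    have cSPD: "c t \<in> SPD" for t
      unfolding c_def by (rule spd_dist_mexp_conj(2)[OF YS(1) y(1) y(1)])
    define f where "f t = (norm (spd_log (c t)))\<^sup>2" for t
    have c0: "c 0 = y"
      by (simp add: c_def)
    have "(c has_vector_derivative Y ** y + y ** Y) (at 0)"
      unfolding c_def using YS(1)[of 1] by (intro has_vector_derivative_mexp_conj) simp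
    then have "(f has_real_derivative 2 * trace (spd_log (c 0) ** matrix_inv (c 0) ** (Y ** y + y ** Y))) (at 0)"
      unfolding f_def using cSPD by (intro DERIV_norm_spd_log_sq[where T = UNIV]) auto
    moreover have "f 0 \<le> f t" for t
    proof -
      have "mexp (t *\<^sub>R Y) ** mexp ((- 2 * t) *\<^sub>R Y) ** mexp (t *\<^sub>R Y) = mat 1"
        using Y E_Sym by (simp only: mexp_mult_scaleR subsetD[of E Sym]) simp
      then have "spd_dist (mat 1) (c t) = spd_dist (mexp ((- 2 * t) *\<^sub>R Y)) y"
        using spd_dist_mexp_conj(1)[OF YS(1) mexp_in_SPD[OF YS(1)] y(1), of t "- 2 * t"] by (simp add: c_def)
      then have "norm (spd_log (c t)) = spd_dist y (mexp ((- 2 * t) *\<^sub>R Y))"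
        using spd_dist_one[OF cSPD] spd_dist_commute[OF mexp_in_SPD[OF YS(1)] y(1)] by metis
      moreover have "norm (spd_log (c 0)) = spd_dist y (mat 1)"
        using spd_dist_one[OF y(1)] spd_dist_commute[OF mat_1_SPD y(1)] by (simp add: c0)
      ultimately show ?thesis
        unfolding f_def using min[OF imageI[OF YS(2)], of "- 2 * t"]
        by (intro power_mono) (simp_all add: spd_dist_nonneg)
    qed
    ultimately have "2 * trace (spd_log (c 0) ** matrix_inv (c 0) ** (Y ** y + y ** Y)) = 0"
      by (intro DERIV_local_min[of f _ 0 1]) auto
    \<comment> \<open>Each half of the velocity contributes \<open>trace (L ** Y)\<close>, by
      cyclicity of the trace and because \<open>L\<close> commutes with
      \<open>mexp L\<close>.\<close>
    then have "trace (L ** mexp (- L) ** (Y ** mexp L + mexp L ** Y)) = 0"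
      using L by (simp add: c0 L_def[symmetric] matrix_inv_mexp)
    moreover have "trace (L ** mexp (- L) ** (mexp L ** Y)) = trace (L ** Y)"
      using mexp_minus_mult[OF L(1)] by (metis matrix_mul_assoc matrix_mul_lid)
    moreover have "trace (L ** mexp (- L) ** (Y ** mexp L)) = trace (L ** Y)"
    proof -
      have "trace (L ** mexp (- L) ** (Y ** mexp L)) = trace (mexp L ** (L ** mexp (- L) ** Y))"
        using trace_mul_sym[of "L ** mexp (- L) ** Y" "mexp L"] by (simp add: matrix_mul_assoc)
      also have "mexp L ** (L ** mexp (- L) ** Y) = L ** Y"
        using mexp_mult_minus[OF L(1)] mexp_commute[OF L(1), of 1] 
        by simp (metis matrix_mul_assoc matrix_mul_lid)
      finally show ?thesis .
    qed
    ultimately show ?thesis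
      by (simp add: mm.add_right trace_add)
  qed
  then have "L \<in> perp_in_Sym E"
    using L(1) by (simp add: perp_in_Sym_def)
  then show thesis
    using that X(1) y(2) L(2) by blast
qed

text \<open>Write \<open>p\<close> and \<open>p'\<close> for the exponentials of
  \<open>2 *\<^sub>R X\<close> and \<open>2 *\<^sub>R X'\<close>. Adding the two instances of
  \<open>pythagoras\<close> with the roles of \<open>p\<close> and \<open>p'\<close> exchanged
  cancels the distances from \<open>x\<close> and forces the distance between \<open>p\<close> and
  \<open>p'\<close> to vanish.\<close>

lemma decomposition_unique:
  assumes "X \<in> E" "L \<in> perp_in_Sym E" "X' \<in> E" "L' \<in> perp_in_Sym E"
    and "mexp X ** mexp L ** mexp X = mexp X' ** mexp L' ** mexp X'"
  shows "X = X'" "mexp L = mexp L'"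
proof -
  have Sym: "2 *\<^sub>R X \<in> Sym" "2 *\<^sub>R X' \<in> Sym" "X \<in> Sym" "X' \<in> Sym"
    using assms E_Sym by auto
  have E2: "mexp (2 *\<^sub>R X) \<in> mexp ` E" "mexp (2 *\<^sub>R X') \<in> mexp ` E"
    using assms E_scale by auto
  have "(norm (2 *\<^sub>R X' - 2 *\<^sub>R X))\<^sup>2 \<le> (spd_dist (mexp (2 *\<^sub>R X)) (mexp (2 *\<^sub>R X')))\<^sup>2"
    by (intro power_mono norm_diff_le_spd_dist Sym) simp
  also have "\<dots> \<le> 0"
    using pythagoras[OF assms(1,2) E2(2) refl] pythagoras[OF assms(3,4) E2(1) assms(5)]
      zero_le_power2[of "spd_dist (mexp (2 *\<^sub>R X')) (mexp (2 *\<^sub>R X))"] by linarith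
  finally show XX': "X = X'"
    by simp
  show "mexp L = mexp L'"
    using assms(5) mexp_conj_cancel(1)[OF Sym(3)] unfolding XX' by metis
qed

text \<open>\<open>pythagoras\<close> works both ways: it shows minimality, and it forces any
  competitor at no greater distance to have distance \<open>0\<close> from
  \<open>mexp (2 *\<^sub>R X)\<close>.\<close>

lemma is_nearest_decomposition:
  assumes X: "X \<in> E" and L: "L \<in> perp_in_Sym E" and x: "x = mexp X ** mexp L ** mexp X"
  shows "is_nearest (mexp ` E) x p \<longleftrightarrow> p = mexp (2 *\<^sub>R X)"
proof -
  have Sym: "X \<in> Sym" "L \<in> Sym" "2 *\<^sub>R X \<in> Sym"
    using X L E_Sym F_Sym by auto
  have xS: "x \<in> SPD"
    unfolding x using Sym by (intro spd_dist_mexp_conj(2)[of _ _ "mat 1"]) (auto simp: mexp_in_SPD)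
  have E2: "mexp (2 *\<^sub>R X) \<in> mexp ` E"
    using X E_scale by auto
  note pyth = pythagoras[OF X L _ x]
  show ?thesis
    unfolding is_nearest_iff[OF xS mexp_E_SPD]
  proof
    assume p: "p = mexp (2 *\<^sub>R X)"
    have "spd_dist x p \<le> spd_dist x q" if "q \<in> mexp ` E" for q
    proof (rule power2_le_imp_le)
      show "(spd_dist x p)\<^sup>2 \<le> (spd_dist x q)\<^sup>2"
        using pyth[OF that] zero_le_power2[of "spd_dist (mexp (2 *\<^sub>R X)) q"] unfolding p by linarith
    qed (rule spd_dist_nonneg)
    then show "p \<in> mexp ` E \<and> (\<forall>q\<in>mexp ` E. spd_dist x p \<le> spd_dist x q)"
      using E2 p by blast
  next
    assume p: "p \<in> mexp ` E \<and> (\<forall>q\<in>mexp ` E. spd_dist x p \<le> spd_dist x q)"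
    then obtain Y where Y: "Y \<in> E" "p = mexp Y"
      by blast
    have YS: "Y \<in> Sym"
      using Y E_Sym by auto
    have "(spd_dist x p)\<^sup>2 \<le> (spd_dist x (mexp (2 *\<^sub>R X)))\<^sup>2"
      using p E2 by (intro power_mono) (auto simp: spd_dist_nonneg)
    then have "(spd_dist (mexp (2 *\<^sub>R X)) p)\<^sup>2 \<le> 0"
      using pyth[of p] p by linarith
    then have "norm (Y - 2 *\<^sub>R X) \<le> 0"
      using norm_diff_le_spd_dist[OF Sym(3) YS] Y(2) by simp
    then show "p = mexp (2 *\<^sub>R X)"
      using Y(2) by simp
  qed
qed

lemma ai_proj_decomposition:
  assumes X: "X \<in> E" and L: "L \<in> perp_in_Sym E" and x: "x = mexp X ** mexp L ** mexp X"
  shows "ai_proj (mexp ` E) x = mexp (2 *\<^sub>R X)"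
    and "spd_sqrt (ai_proj (mexp ` E) x) = mexp X"
    and "matrix_inv (mexp X) ** x ** matrix_inv (mexp X) = mexp L"
proof -
  have Sym: "X \<in> Sym" "2 *\<^sub>R X \<in> Sym"
    using X E_Sym by auto
  show 1: "ai_proj (mexp ` E) x = mexp (2 *\<^sub>R X)"
    unfolding ai_proj_def is_nearest_decomposition[OF assms] by simp
  show "spd_sqrt (ai_proj (mexp ` E) x) = mexp X"
    unfolding 1 spd_sqrt_mexp[OF Sym(2)] by simp
  show "matrix_inv (mexp X) ** x ** matrix_inv (mexp X) = mexp L"
    unfolding x matrix_inv_mexp[OF Sym(1)] by (rule mexp_conj_cancel(1)[OF Sym(1)])
qed

text \<open>Minimality of \<open>p y\<close> for \<open>y\<close> bounds the distance from
  \<open>x\<close> to \<open>p y\<close> by \<open>2 * spd_dist x y + spd_dist x (p x)\<close>, and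
  \<open>pythagoras\<close> at \<open>p x\<close> turns the excess into a bound on the displacement.
  It is weaker than the 1-Lipschitz property of projections in nonpositive curvature, but tends to
  \<open>0\<close> as \<open>y\<close> approaches \<open>x\<close>.\<close>

lemma ai_proj_displacement:
  assumes x: "x \<in> SPD" and y: "y \<in> SPD"
  defines "p \<equiv> ai_proj (mexp ` E)"
  shows "(norm (spd_log (p y) - spd_log (p x)))\<^sup>2 \<le> (2 * spd_dist x y + spd_dist x (p x))\<^sup>2 - (spd_dist x (p x))\<^sup>2"
proof -
  obtain X L where X: "X \<in> E" "L \<in> perp_in_Sym E" "x = mexp X ** mexp L ** mexp X"
    using decomposition_exists[OF x] by blast
  obtain Y M where Y: "Y \<in> E" "M \<in> perp_in_Sym E" "y = mexp Y ** mexp M ** mexp Y"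
    using decomposition_exists[OF y] by blast
  have px: "p x = mexp (2 *\<^sub>R X)" "p y = mexp (2 *\<^sub>R Y)"
    unfolding p_def using ai_proj_decomposition X Y by blast+
  have pE: "p x \<in> mexp ` E" "p y \<in> mexp ` E" "p x \<in> SPD" "p y \<in> SPD"
    using X Y E_scale mexp_E_SPD unfolding px by auto
  have "spd_dist y (p y) \<le> spd_dist y (p x)"
    using is_nearest_decomposition[OF Y, of "p y"] is_nearest_iff[OF y mexp_E_SPD] px pE by blast
  also have "\<dots> \<le> spd_dist x y + spd_dist x (p x)"
    using spd_dist_triangle[OF y x pE(3)] spd_dist_commute[OF x y] by simp
  finally have "spd_dist x (p y) \<le> 2 * spd_dist x y + spd_dist x (p x)"
    using spd_dist_triangle[OF x y pE(4)] by simp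
  then have "(spd_dist x (p y))\<^sup>2 \<le> (2 * spd_dist x y + spd_dist x (p x))\<^sup>2"
    by (intro power_mono) (auto simp: spd_dist_nonneg)
  moreover have "(spd_dist x (p x))\<^sup>2 + (spd_dist (p x) (p y))\<^sup>2 \<le> (spd_dist x (p y))\<^sup>2"
    unfolding px(1) by (rule pythagoras[OF X(1,2) pE(2) X(3)])
  moreover have "(norm (spd_log (p y) - spd_log (p x)))\<^sup>2 \<le> (spd_dist (p x) (p y))\<^sup>2"
    using norm_diff_le_spd_dist[OF spd_log_Sym[OF pE(3)] spd_log_Sym[OF pE(4)]] pE(3,4)
    by (intro power_mono) auto
  ultimately show ?thesis
    by linarith
qed

lemma continuous_on_log_ai_proj: "continuous_on SPD (\<lambda>x. spd_log (ai_proj (mexp ` E) x))"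
  unfolding continuous_on_def
proof
  fix x :: "real^'n^'n" assume x: "x \<in> SPD"
  define z where "z y = spd_log (ai_proj (mexp ` E) y)" for y
  define d where "d = spd_dist x (ai_proj (mexp ` E) x)"
  define b where "b y = sqrt ((2 * spd_dist x y + d)\<^sup>2 - d\<^sup>2)" for y
  have "eventually (\<lambda>y. norm (z y - z x) \<le> b y) (at x within SPD)"
    unfolding eventually_at_topological using ai_proj_displacement[OF x]
    by (intro exI[of _ UNIV]) (auto simp: b_def z_def d_def intro!: real_le_rsqrt)
  moreover have "(spd_dist x \<longlongrightarrow> 0) (at x within SPD)"
    using continuous_on_spd_dist[OF x] x spd_dist_self[OF x] unfolding continuous_on_def by fastforce
  then have "(b \<longlongrightarrow> sqrt ((2 * 0 + d)\<^sup>2 - d\<^sup>2)) (at x within SPD)"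
    unfolding b_def by (intro tendsto_intros)
  ultimately have "((\<lambda>y. z y - z x) \<longlongrightarrow> 0) (at x within SPD)"
    by (rule_tac Lim_null_comparison[where g = b]) simp_all
  then show "((\<lambda>x. spd_log (ai_proj (mexp ` E) x)) \<longlongrightarrow> spd_log (ai_proj (mexp ` E) x)) (at x within SPD)"
    by (simp add: LIM_zero_iff z_def)
qed

lemma decomposition_homeomorphism:
  "homeomorphism SPD ((mexp ` E) \<times> (mexp ` perp_in_Sym E))
    (\<lambda>x. let e = spd_sqrt (ai_proj (mexp ` E) x) in (e, matrix_inv e ** x ** matrix_inv e))
    (\<lambda>(e, f). e ** f ** e)"
proof -
  define h where "h x = (let e = spd_sqrt (ai_proj (mexp ` E) x) in (e, matrix_inv e ** x ** matrix_inv e))" for x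
  define g where "g = (\<lambda>(e :: real^'n^'n, f). e ** f ** e)"
  have h: "h (mexp X ** mexp L ** mexp X) = (mexp X, mexp L)" if "X \<in> E" "L \<in> perp_in_Sym E" for X L
    unfolding h_def Let_def using ai_proj_decomposition[OF that refl] by simp
  have g_SPD: "mexp X ** mexp L ** mexp X \<in> SPD" if "X \<in> E" "L \<in> perp_in_Sym E" for X L
    using that E_Sym F_Sym by (intro spd_dist_mexp_conj(2)[of _ _ "mat 1"]) (auto intro: mexp_in_SPD)
  have gh: "g (h x) = x \<and> h x \<in> (mexp ` E) \<times> (mexp ` perp_in_Sym E)" if x: "x \<in> SPD" for x
  proof -
    obtain X L where "X \<in> E" "L \<in> perp_in_Sym E" "x = mexp X ** mexp L ** mexp X"
      using decomposition_exists[OF x] by blast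
    then show ?thesis
      using h by (auto simp: g_def)
  qed
  have hg: "h (g y) = y \<and> g y \<in> SPD" if "y \<in> (mexp ` E) \<times> (mexp ` perp_in_Sym E)" for y
    using that h g_SPD by (auto simp: g_def)
  have "continuous_on SPD h"
  proof -
    \<comment> \<open>With \<open>mexp (X x)\<close> and \<open>mexp (- X x)\<close> standing for
      the square root and its inverse, continuity reduces to that of \<open>X\<close> and of
      \<open>mexp\<close>.\<close>
    define X where "X x = (1/2) *\<^sub>R spd_log (ai_proj (mexp ` E) x)" for x
    have X: "X x \<in> E" "h x = (mexp (X x), mexp (- X x) ** x ** mexp (- X x))" if x: "x \<in> SPD" for x
    proof -
      obtain W L where W: "W \<in> E" "L \<in> perp_in_Sym E" "x = mexp W ** mexp L ** mexp W"
        using decomposition_exists[OF x] by blast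
      have "2 *\<^sub>R W \<in> Sym" "W \<in> Sym"
        using W E_Sym by auto
      then have "X x = W"
        unfolding X_def ai_proj_decomposition(1)[OF W] by simp
      then show "X x \<in> E" "h x = (mexp (X x), mexp (- X x) ** x ** mexp (- X x))"
        using W(1) \<open>W \<in> Sym\<close> unfolding h_def Let_def ai_proj_decomposition(2)[OF W]
        by (simp_all add: matrix_inv_mexp)
    qed
    have cX: "continuous_on SPD X"
      unfolding X_def by (intro continuous_on_scaleR continuous_on_const continuous_on_log_ai_proj)
    have "continuous_on SPD (\<lambda>x. mexp (X x))"
      by (rule continuous_on_compose2[OF continuous_on_mexp cX]) (use X(1) E_Sym in blast)
    moreover have "continuous_on SPD (\<lambda>x. mexp (- X x))"
      by (rule continuous_on_compose2[OF continuous_on_mexp continuous_on_minus[OF cX]])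
        (use X(1) E_scale(2) E_Sym in blast)
    ultimately have "continuous_on SPD (\<lambda>x. (mexp (X x), mexp (- X x) ** x ** mexp (- X x)))"
      by (intro continuous_on_Pair mm.continuous_on continuous_on_id)
    then show ?thesis
      using X(2) by (simp cong: continuous_on_cong)
  qed
  moreover have "continuous_on ((mexp ` E) \<times> (mexp ` perp_in_Sym E)) g"
    unfolding g_def case_prod_unfold
    by (intro mm.continuous_on continuous_on_fst continuous_on_snd continuous_on_id)
  moreover have "h ` SPD = (mexp ` E) \<times> (mexp ` perp_in_Sym E)"
  proof (intro equalityI subsetI)
    fix y assume "y \<in> (mexp ` E) \<times> (mexp ` perp_in_Sym E)"
    with hg[OF this] show "y \<in> h ` SPD"
      by (metis imageI)
  qed (use gh in blast)
  moreover have "g ` ((mexp ` E) \<times> (mexp ` perp_in_Sym E)) = SPD"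
  proof (intro equalityI subsetI)
    fix x :: "real^'n^'n" assume "x \<in> SPD"
    with gh[OF this] show "x \<in> g ` ((mexp ` E) \<times> (mexp ` perp_in_Sym E))"
      by (metis imageI)
  qed (use hg in blast)
  ultimately have "homeomorphism SPD ((mexp ` E) \<times> (mexp ` perp_in_Sym E)) h g"
    using gh hg unfolding homeomorphism_def by blast
  then show ?thesis
    unfolding h_def g_def .
qed

end

theorem theorem5p1:
  fixes E F :: "(real^'n^'n) set"
  assumes "subspace E" and "E \<subseteq> Sym"
    and "\<And>X Y. X \<in> E \<Longrightarrow> Y \<in> E \<Longrightarrow> commutator X (commutator X Y) \<in> E"
    and "F = perp_in_Sym E"
  shows
    "(\<forall>x\<in>SPD. \<exists>!p. is_nearest (mexp ` E) x p) \<and>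
     (\<forall>x\<in>SPD. \<exists>!p. p \<in> (mexp ` E) \<times> (mexp ` F) \<and> x = fst p ** snd p ** fst p) \<and>
     (\<forall>x\<in>SPD.
        let e = spd_sqrt (ai_proj (mexp ` E) x);
            f = matrix_inv e ** x ** matrix_inv e
        in e \<in> mexp ` E \<and> f \<in> mexp ` F \<and> x = e ** f ** e) \<and>
     (\<exists>g. homeomorphism SPD ((mexp ` E) \<times> (mexp ` F))
        (\<lambda>x. let e = spd_sqrt (ai_proj (mexp ` E) x)
             in (e, matrix_inv e ** x ** matrix_inv e)) g)"
proof -
  interpret lie_triple_system E
    using assms(1-3) by unfold_locales
  have F: "F = perp_in_Sym E"
    by (rule assms(4))
  have 1: "\<exists>!p. is_nearest (mexp ` E) x p" if x: "x \<in> SPD" for x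
    using decomposition_exists[OF x] is_nearest_decomposition by metis
  have 2: "\<exists>!p. p \<in> (mexp ` E) \<times> (mexp ` F) \<and> x = fst p ** snd p ** fst p" if x: "x \<in> SPD" for x
  proof -
    obtain X L where X: "X \<in> E" "L \<in> F" "x = mexp X ** mexp L ** mexp X"
      using decomposition_exists[OF x] unfolding F by blast
    show ?thesis
    proof (rule ex1I[of _ "(mexp X, mexp L)"])
      fix p assume p: "p \<in> (mexp ` E) \<times> (mexp ` F) \<and> x = fst p ** snd p ** fst p"
      then obtain X' L' where "X' \<in> E" "L' \<in> F" "p = (mexp X', mexp L')"
        by auto
      then show "p = (mexp X, mexp L)"
        using decomposition_unique[of X L X' L'] X p unfolding F by auto
    qed (use X in auto)
  qed
  have 3: "let e = spd_sqrt (ai_proj (mexp ` E) x); f = matrix_inv e ** x ** matrix_inv e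
      in e \<in> mexp ` E \<and> f \<in> mexp ` F \<and> x = e ** f ** e" if x: "x \<in> SPD" for x
  proof -
    obtain X L where X: "X \<in> E" "L \<in> perp_in_Sym E" "x = mexp X ** mexp L ** mexp X"
      using decomposition_exists[OF x] by blast
    show ?thesis
      unfolding Let_def ai_proj_decomposition(2,3)[OF X] F using X by blast
  qed
  show ?thesis
  proof (intro conjI ballI 1 2 3)
    show "\<exists>g. homeomorphism SPD ((mexp ` E) \<times> (mexp ` F))
        (\<lambda>x. let e = spd_sqrt (ai_proj (mexp ` E) x)
             in (e, matrix_inv e ** x ** matrix_inv e)) g"
      unfolding F by (rule exI, rule decomposition_homeomorphism)
  qed
qed

end
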